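(* Let $p$ be a prime, let $q=p^u$ and $Q=p^s$ with integers $u,s\ge 1$, and let $f(x)=\sum_{l=0}^d a_l x^l\in\mathbb F_Q[x]$ have degree $d\ge 2$ with $\gcd(d,p)=1$. Let $X/\mathbb F_Q$ be the generalized Artin-Schreier curve $X: y^q-y=f(x)$, and let $\sigma=\max\{s_p(l) : l\in \mathrm{supp}(X)\}$. Then $$NP_1(X/\mathbb F_Q)\ \ge\ \frac1\sigma .$$
   Context: The curve $X$ means the smooth projective absolutely irreducible curve over $\mathbb F_Q$ with affine equation $y^q-y=f(x)$; its genus is $g=(q-1)(d-1)/2$. There is no assumed relation between $u$ and $s$. $\mathrm{supp}(X)=\{i : a_i\ne 0\}$, and $s_p(i)$ is the sum of the digits of the base-$p$ expansion of the nonnegative integer $i$. The $L$-polynomial of $X/\mathbb F_Q$ is $L_X(T)=\exp\left(\sum_{i\ge1}(\#X(\mathbb F_{Q^i})-Q^i-1)\frac{T^i}{i}\right)=\sum_{i=0}^{2g}c_iT^i\in\mathbb Z[T]$. The Newton polygon $NP(X/\mathbb F_Q)$ is the lower convex hull of the points $(i,\mathrm{ord}_p(c_i)/s)$, $0\le i\le 2g$, where $\mathrm{ord}_p$ is the $p$-adic valuation and $\mathrm{ord}_p(0)=\infty$. $NP_1(X/\mathbb F_Q)$ denotes its first slope (the slope of its leftmost segment). *)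

theory Defs
  imports "HOL-Analysis.Analysis" "HOL-Algebra.Algebraic_Closure_Type" "HOL-Algebra.Generated_Fields"
    "HOL-Computational_Algebra.Computational_Algebra"
begin

text \<open>
  The base field with \<open>Q\<close> elements is a type \<open>'k\<close> of class \<open>finite_field\<close>. Everything about the
  curve takes place in one ambient field: an algebraic closure of \<open>F(x)\<close>, where \<open>F\<close> is an
  algebraic closure of the base field.
\<close>

type_synonym 'k ambient = "'k alg_closure poly fract alg_closure"

text \<open>The field with \<open>Q ^ n\<close> elements (for \<open>n \<ge> 1\<close>) inside \<open>F\<close>.\<close>

definition field_extension :: "nat \<Rightarrow> 'k::finite_field alg_closure set" where
  "field_extension n = {c. c ^ (CARD('k) ^ n) = c}"

definition of_polynomial :: "'k::finite_field alg_closure poly \<Rightarrow> 'k ambient" where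
  "of_polynomial h = to_ac (to_fract h)"

definition constants :: "nat \<Rightarrow> 'k::finite_field ambient set" where
  "constants n = (\<lambda>c. of_polynomial [:c:]) ` field_extension n"

definition x_coord :: "'k::finite_field ambient" where
  "x_coord = of_polynomial [:0, 1:]"

text \<open>
  A root of \<open>Y^q - Y - f(x)\<close>. That polynomial is irreducible over \<open>F(x)\<close> when the degree of \<open>f\<close>
  is prime to the characteristic and \<open>q\<close> is a power of it, so up to isomorphism over \<open>F(x)\<close>
  nothing depends on the choice.
\<close>

definition y_coord :: "nat \<Rightarrow> 'k::finite_field poly \<Rightarrow> 'k ambient" where
  "y_coord q f = (SOME y. y ^ q - y = of_polynomial (map_poly to_ac f))"

text \<open>The function field of the curve over the field with \<open>Q ^ n\<close> elements.\<close>

definition function_field :: "nat \<Rightarrow> 'k::finite_field poly \<Rightarrow> nat \<Rightarrow> 'k ambient set" where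
  "function_field q f n =
     generate_field ring_of_type_algebra (constants n \<union> {x_coord, y_coord q f})"

text \<open>
  Valuation rings \<open>V\<close> of \<open>L\<close> containing \<open>C\<close>, both subfields of an ambient
  type. If \<open>L\<close> is the function
  field of a smooth projective curve over \<open>C\<close>, these are the closed points of the curve, and the
  rational points are those with residue field \<open>C\<close>.
\<close>

definition valuation_ring :: "'a::field set \<Rightarrow> 'a set \<Rightarrow> 'a set \<Rightarrow> bool" where
  "valuation_ring C L V \<longleftrightarrow>
     subring V ring_of_type_algebra \<and> C \<subseteq> V \<and> V \<subset> L \<and>
     (\<forall>z\<in>L. z \<in> V \<or> inverse z \<in> V)"

definition valuation_ideal :: "'a::field set \<Rightarrow> 'a set" where
  "valuation_ideal V = {z \<in> V. z = 0 \<or> inverse z \<notin> V}"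

definition rational_place :: "'a::field set \<Rightarrow> 'a set \<Rightarrow> 'a set \<Rightarrow> bool" where
  "rational_place C L V \<longleftrightarrow>
     valuation_ring C L V \<and> (\<forall>z\<in>V. \<exists>c\<in>C. z - c \<in> valuation_ideal V)"

text \<open>
  The number of points, over the field with \<open>Q ^ n\<close> elements, of the smooth projective curve with
  affine equation \<open>y^q - y = f(x)\<close>.
\<close>

definition point_count :: "nat \<Rightarrow> 'k::finite_field poly \<Rightarrow> nat \<Rightarrow> nat" where
  "point_count q f n = card {V. rational_place (constants n) (function_field q f n) V}"

text \<open>
  The genus of that curve when the degree of \<open>f\<close> is prime to the characteristic and \<open>q\<close> is a
  power of it; the product is then even.
\<close>

definition genus :: "nat \<Rightarrow> 'k::finite_field poly \<Rightarrow> nat" where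
  "genus q f = (q - 1) * (Polynomial.degree f - 1) div 2"

text \<open>The coefficients are a priori rational, because of the denominators in the exponential.\<close>

definition L_function :: "nat \<Rightarrow> 'k::finite_field poly \<Rightarrow> rat fps" where
  "L_function q f = fps_compose (fps_exp 1)
     (Abs_fps (\<lambda>i. if i = 0 then 0
        else (of_nat (point_count q f i) - of_nat (CARD('k)) ^ i - 1) / of_nat i))"

definition p_adic_ord :: "nat \<Rightarrow> rat \<Rightarrow> ereal" where
  "p_adic_ord p r =
     (if r = 0 then \<infinity>
      else let (a, b) = quotient_of r
        in ereal (real (multiplicity (int p) a) - real (multiplicity (int p) b)))"

text \<open>
  The lower convex hull of the points \<open>(i, v i)\<close>, \<open>i \<le> m\<close>, as a function of the abscissa. Points
  at height \<open>\<infinity>\<close> do not contribute; outside the range of the hull the value is \<open>\<infinity>\<close>.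
\<close>

definition lower_hull :: "(nat \<Rightarrow> ereal) \<Rightarrow> nat \<Rightarrow> real \<Rightarrow> ereal" where
  "lower_hull v m t =
     Inf {ereal y | y. (t, y) \<in> convex hull {(real i, real_of_ereal (v i)) | i. i \<le> m \<and> v i \<noteq> \<infinity>}}"

text \<open>The slope of the leftmost segment of a polygon starting at abscissa 0.\<close>

definition first_slope :: "(real \<Rightarrow> ereal) \<Rightarrow> ereal" where
  "first_slope N = (THE m. \<exists>e>0. \<forall>t. 0 < t \<and> t \<le> e \<longrightarrow> N t = N 0 + m * ereal t)"

definition newton_polygon ::
  "nat \<Rightarrow> nat \<Rightarrow> nat \<Rightarrow> 'k::finite_field poly \<Rightarrow> real \<Rightarrow> ereal" where
  "newton_polygon p s q f =
     lower_hull (\<lambda>i. p_adic_ord p (fps_nth (L_function q f) i) / ereal (real s)) (2 * genus q f)"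

text \<open>
  For \<open>p \<ge> 2\<close> we have \<open>p ^ k > n\<close> whenever \<open>k > n\<close>, so the sum runs over all base-\<open>p\<close> digits.
\<close>

definition digit_sum :: "nat \<Rightarrow> nat \<Rightarrow> nat" where
  "digit_sum p n = (\<Sum>k\<le>n. n div p ^ k mod p)"

definition supp :: "'k::finite_field poly \<Rightarrow> nat set" where
  "supp f = {i. Polynomial.coeff f i \<noteq> 0}"

definition max_digit_sum :: "nat \<Rightarrow> 'k::finite_field poly \<Rightarrow> nat" where
  "max_digit_sum p f = Max (digit_sum p ` supp f)"

end

theory Submission
  imports Defs
begin

text \<open>
  Since \<open>L\<close> has constant term 1, its first slope is at least \<open>1 / \<sigma>\<close> iff \<open>ord_p (c_i) \<ge> i s / \<sigma>\<close> for all \<open>i\<close>.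
  Newton's identities \<open>n c_n = \<Sum> c_i S_(n-i)\<close> transport lower bounds on the power sums \<open>S_n = #X(F_(Q^n)) - Q^n - 1\<close>
  to the coefficients only up to the valuation of \<open>n\<close>. This loss is removed by Graeffe transforms:
  they replace the roots of the polynomial \<open>L\<close> by their squares, so slopes double, while \<open>L\<close> keeps its degree and the loss stays bounded.

  The divisibility of \<open>S_n\<close> is a theorem in the style of Ax: on the vector space \<open>F_(Q^n)\<close> over the prime field, the function
  \<open>x \<mapsto> Tr(\<beta> f(x))\<close> has degree at most \<open>\<sigma>\<close>, because \<open>x^l\<close> is a product of \<open>s_p(l)\<close> additive functions,
  and the number of zeros of a function of low degree is highly divisible by \<open>p\<close>. These numbers determine \<open>S_n\<close>.

  That \<open>L\<close> is a polynomial follows from the elementary theory of the L-series of \<open>n \<mapsto> \<psi>(\<beta> f)\<close>: for degree at least \<open>d\<close>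
  its coefficients are sums of a nontrivial character, and the conjugates under Frobenius of \<open>\<beta>\<close> are grouped together in one
  factor. Finally, the rational places of the function field are the affine points and one place at infinity. Existence of
  places is Chevalley's extension theorem; a place over an affine point \<open>(a, b)\<close> is unique because \<open>y - b\<close> is a local
  multiple of \<open>x - a\<close>, and a place at infinity because \<open>x\<close> and \<open>y\<close> have the coprime pole orders \<open>q\<close> and \<open>d\<close>.
\<close>

text \<open>The obstacle is that the character sums lie in a cyclotomic field, where the classical
  route to their p-adic size goes through Gauss sums. Here complex characters only show that L is a
  polynomial; all divisibility is proved for integers. Adding the sums over all nontrivial p-th
  roots of unity turns them into \<open>p * (number of zeros) - p ^ r\<close>, and this factor p
  makes the exponent exact: p times the indicator of 0 on the prime field becomes divisible by
  \<open>p ^ (k+1)\<close> after \<open>k (p-1) + 1\<close> differences, composition with a function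
  of degree \<sigma> changes this order to \<open>\<sigma> k (p-1) + 1\<close>, and summation over a
  group of order \<open>p ^ r\<close> uses up \<open>r (p-1)\<close> of it. So
  \<open>p ^ (k+1)\<close> divides the sum whenever \<open>\<sigma> k < r\<close>; the largest such
  k + 1 is the ceiling of r / \<sigma>. With r = s n the valuation of S_n is at least n s /
  \<sigma>, homogeneous in n, as the passage from power sums to coefficients requires.\<close>

unbundle no vec_syntax

subsection \<open>Power sums and the valuations of coefficients\<close>

definition pval :: "nat \<Rightarrow> rat \<Rightarrow> int" where
  "pval p r = (case quotient_of r of (a, b) \<Rightarrow>
     int (multiplicity (int p) a) - int (multiplicity (int p) b))"

lemma p_adic_ord_pval:
  "p_adic_ord p r = (if r = 0 then \<infinity> else ereal (real_of_int (pval p r)))"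
  by (auto simp: p_adic_ord_def pval_def Let_def split: prod.splits)

lemma pval_of_int_divide:
  assumes "Factorial_Ring.prime p" "a \<noteq> 0" "b \<noteq> 0"
  shows "pval p (of_int a / of_int b) =
           int (multiplicity (int p) a) - int (multiplicity (int p) b)"
proof -
  obtain c d where cd: "quotient_of (of_int a / of_int b) = (c, d)"
    by (cases "quotient_of (of_int a / of_int b :: rat)") auto
  from cd have d: "d > 0" and eq: "of_int a / of_int b = (of_int c / of_int d :: rat)"
    using quotient_of_denom_pos quotient_of_div by blast+
  have "of_int (a * d) = (of_int (c * b) :: rat)"
    using eq d assms by (simp add: field_simps)
  hence e: "a * d = c * b" by linarith
  have c: "c \<noteq> 0" using e d assms by auto
  have P: "prime_elem (int p)" using assms(1) by (simp add: prime_imp_prime_elem)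
  have "multiplicity (int p) a + multiplicity (int p) d =
        multiplicity (int p) c + multiplicity (int p) b"
    using e prime_elem_multiplicity_mult_distrib[OF P] assms d c
    by (metis less_irrefl)
  thus ?thesis by (simp add: pval_def cd)
qed

lemma rat_frac_obtain:
  fixes r :: rat assumes "r \<noteq> 0"
  obtains a b where "r = of_int a / of_int b" "a \<noteq> 0" "b \<noteq> 0"
proof -
  obtain c d where cd: "quotient_of r = (c, d)" by (cases "quotient_of r") auto
  have "d > 0" "r = of_int c / of_int d"
    using cd quotient_of_denom_pos quotient_of_div by blast+
  with assms that[of c d] show thesis by auto
qed

lemma pval_mult:
  assumes "Factorial_Ring.prime p" "x \<noteq> 0" "y \<noteq> 0"
  shows "pval p (x * y) = pval p x + pval p y"
proof -
  obtain a b where x: "x = of_int a / of_int b" "a \<noteq> 0" "b \<noteq> 0" using rat_frac_obtain[OF assms(2)] .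
  obtain c d where y: "y = of_int c / of_int d" "c \<noteq> 0" "d \<noteq> 0" using rat_frac_obtain[OF assms(3)] .
  have P: "prime_elem (int p)" using assms(1) by (simp add: prime_imp_prime_elem)
  have "x * y = of_int (a * c) / of_int (b * d)" by (simp add: x y)
  hence "pval p (x * y) = int (multiplicity (int p) (a * c)) - int (multiplicity (int p) (b * d))"
    using pval_of_int_divide[OF assms(1), of "a * c" "b * d"] x y by simp
  thus ?thesis
    using x y pval_of_int_divide[OF assms(1)] by (simp add: prime_elem_multiplicity_mult_distrib[OF P])
qed

lemma pval_of_int:
  assumes "Factorial_Ring.prime p" "a \<noteq> 0"
  shows "pval p (of_int a) = int (multiplicity (int p) a)"
  using pval_of_int_divide[OF assms, of 1] by simp

lemma pval_add:
  assumes "Factorial_Ring.prime p" "x \<noteq> 0" "y \<noteq> 0" "x + y \<noteq> 0"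
  shows "pval p (x + y) \<ge> min (pval p x) (pval p y)"
proof -
  obtain a b where x: "x = of_int a / of_int b" "a \<noteq> 0" "b \<noteq> 0" using rat_frac_obtain[OF assms(2)] .
  obtain c d where y: "y = of_int c / of_int d" "c \<noteq> 0" "d \<noteq> 0" using rat_frac_obtain[OF assms(3)] .
  have P: "prime_elem (int p)" using assms(1) by (simp add: prime_imp_prime_elem)
  have U: "\<not> is_unit (int p)" using assms(1) by (metis P not_prime_elem_one prime_elem_def)
  have eq: "x + y = of_int (a * d + c * b) / of_int (b * d)" using x y by (simp add: field_simps)
  have nz: "a * d + c * b \<noteq> 0" using eq assms(4) by (metis div_0 of_int_0)
  let ?m = "\<lambda>z. multiplicity (int p) z"
  define k where "k = min (?m (a * d)) (?m (c * b))"
  have "int p ^ k dvd a * d" "int p ^ k dvd c * b"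
    unfolding k_def by (auto intro!: multiplicity_dvd')
  hence "int p ^ k dvd a * d + c * b" by (rule dvd_add)
  hence "k \<le> ?m (a * d + c * b)" using nz U by (intro multiplicity_geI) auto
  moreover have "pval p (x + y) = int (?m (a * d + c * b)) - int (?m (b * d))"
    using pval_of_int_divide[OF assms(1) nz, of "b * d"] eq x y by simp
  moreover have "pval p x = int (?m a) - int (?m b)" "pval p y = int (?m c) - int (?m d)"
    using x y pval_of_int_divide[OF assms(1)] by auto
  moreover have "?m (a * d) = ?m a + ?m d" "?m (c * b) = ?m c + ?m b" "?m (b * d) = ?m b + ?m d"
    using x y by (simp_all add: prime_elem_multiplicity_mult_distrib[OF P])
  ultimately show ?thesis unfolding k_def by linarith
qed

text \<open>A lower bound for the valuation; 0 satisfies all of them, although \<open>pval\<close>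
  returns 0 there. The bound is real because the slopes s / \<sigma> are fractions.\<close>

definition vge :: "nat \<Rightarrow> real \<Rightarrow> rat \<Rightarrow> bool" where
  "vge p x r \<longleftrightarrow> r = 0 \<or> x \<le> real_of_int (pval p r)"

lemma vge_0 [simp]: "vge p x 0" by (simp add: vge_def)

lemma vge_mono: "vge p x r \<Longrightarrow> y \<le> x \<Longrightarrow> vge p y r" by (auto simp: vge_def)

lemma vge_mult:
  assumes "Factorial_Ring.prime p" "vge p x r" "vge p y t"
  shows "vge p (x + y) (r * t)"
  using assms(2,3) pval_mult[OF assms(1), of r t] by (cases "r = 0 \<or> t = 0") (auto simp: vge_def)

lemma vge_add:
  assumes "Factorial_Ring.prime p" "vge p x r" "vge p x t"
  shows "vge p x (r + t)"
proof (cases "r = 0 \<or> t = 0 \<or> r + t = 0")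
  case False
  thus ?thesis using assms pval_add[OF assms(1), of r t] unfolding vge_def by linarith
qed (use assms in \<open>auto simp: vge_def\<close>)

lemma vge_sum:
  assumes "Factorial_Ring.prime p" "\<And>i. i \<in> A \<Longrightarrow> vge p x (f i)"
  shows "vge p x (\<Sum>i\<in>A. f i)"
  using assms(2) by (induction A rule: infinite_finite_induct) (auto intro!: vge_add assms(1))

lemma vge_of_int:
  assumes "Factorial_Ring.prime p" "int p ^ k dvd a"
  shows "vge p (real k) (of_int a)"
proof (cases "a = 0")
  case False
  have "\<not> is_unit (int p)"
    using assms(1) by (metis not_prime_elem_one prime_elem_def prime_imp_prime_elem prime_nat_int_transfer)
  hence "k \<le> multiplicity (int p) a" using False assms by (intro multiplicity_geI) auto
  thus ?thesis using pval_of_int[OF assms(1) False] by (simp add: vge_def)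
qed auto

lemma pval_uminus: "Factorial_Ring.prime p \<Longrightarrow> x \<noteq> 0 \<Longrightarrow> pval p (- x) = pval p x"
  using pval_mult[of p "-1" x] pval_of_int[of p "-1"] by (simp add: multiplicity_unit_right)

text \<open>Strict case of the ultrametric inequality; the reverse bound comes from writing x as
  \<open>(x + y) + (- y)\<close>. Valuations are integers, so strictness can be stated with
  \<open>+ 1\<close>.\<close>

lemma pval_dominant:
  assumes "Factorial_Ring.prime p" "x \<noteq> 0" "vge p (real_of_int (pval p x) + 1) y"
  shows "x + y \<noteq> 0 \<and> pval p (x + y) = pval p x"
proof (cases "y = 0")
  case False
  hence y: "pval p y > pval p x" using assms by (auto simp: vge_def)
  have nz: "x + y \<noteq> 0"
  proof
    assume "x + y = 0"
    hence "y = - x" by (simp add: eq_neg_iff_add_eq_0 add.commute)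
    thus False using y pval_uminus[OF assms(1,2)] by simp
  qed
  have "pval p (x + y) \<ge> pval p x" using pval_add[OF assms(1,2) False nz] y by simp
  moreover have "pval p x \<ge> min (pval p (x + y)) (pval p (- y))"
    using pval_add[OF assms(1) nz, of "- y"] False assms by simp
  hence "pval p x \<ge> pval p (x + y)" using y pval_uminus[OF assms(1) False] by linarith
  ultimately show ?thesis using nz by simp
qed (use assms in auto)

text \<open>The crude estimate that a divisor with valuation v exceeds v, since it is at least
  \<open>p ^ v\<close>, suffices: the Graeffe argument only asks for a loss bounded in terms of the
  index.\<close>

lemma vge_divide_nat:
  assumes "Factorial_Ring.prime p" "vge p x (of_nat (Suc n) * r)"
  shows "vge p (x - real (Suc n)) r"
proof (cases "r = 0")
  case False
  have "pval p (of_nat (Suc n) :: rat) = int (multiplicity (int p) (int (Suc n)))"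
    using pval_of_int[OF assms(1), of "int (Suc n)"] by simp
  moreover have "multiplicity (int p) (int (Suc n)) \<le> Suc n"
  proof -
    have "int p ^ multiplicity (int p) (int (Suc n)) dvd int (Suc n)" by (rule multiplicity_dvd)
    hence "p ^ multiplicity (int p) (int (Suc n)) \<le> Suc n"
      by (metis dvd_imp_le int_dvd_int_iff of_nat_power zero_less_Suc)
    moreover have "multiplicity (int p) (int (Suc n)) < p ^ multiplicity (int p) (int (Suc n))"
      by (intro power_gt_expt prime_gt_Suc_0_nat assms(1))
    ultimately show ?thesis by linarith
  qed
  ultimately show ?thesis
    using assms(2) False pval_mult[OF assms(1), of "of_nat (Suc n)" r] by (auto simp: vge_def)
qed auto

section \<open>Newton's identities for power series\<close>

lemma log_deriv_coeff:
  fixes L D :: "'a :: comm_ring_1 fps"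
  assumes "fps_deriv L = L * D"
  shows "of_nat (Suc n) * L $ Suc n = (\<Sum>i\<le>n. L $ i * D $ (n - i))"
  using arg_cong[OF assms, of "\<lambda>f. f $ n"] by (simp add: fps_mult_nth atLeast0AtMost)

text \<open>Each use of Newton's identity divides by n and costs at most n. The accumulated loss
  stays within \<open>n * n\<close> because \<open>m * m + n \<le> n * n\<close> for n = m +
  1.\<close>

lemma coeff_bound_of_log_deriv:
  fixes L D :: "rat fps"
  assumes p: "Factorial_Ring.prime p" and L: "L $ 0 = 1" "fps_deriv L = L * D"
    and D: "\<And>n. vge p (real (Suc n) * w) (D $ n)"
  shows "vge p (real n * w - real n * real n) (L $ n)"
proof (induction n rule: less_induct)
  case (less n)
  show ?case
  proof (cases n)
    case 0
    thus ?thesis using L vge_of_int[OF p, of 0 1] by simp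
  next
    case (Suc m)
    have "vge p (real n * w - real m * real m) (\<Sum>i\<le>m. L $ i * D $ (m - i))"
    proof (rule vge_sum[OF p])
      fix i assume i: "i \<in> {..m}"
      have "vge p ((real i * w - real i * real i) + real (Suc (m - i)) * w) (L $ i * D $ (m - i))"
        using i Suc by (intro vge_mult[OF p] less D) auto
      moreover have "(real i * w - real i * real i) + real (Suc (m - i)) * w
          \<ge> real n * w - real m * real m"
      proof -
        have "real i * w + real (Suc (m - i)) * w = real n * w"
          using i Suc by (simp add: of_nat_diff algebra_simps)
        moreover have "real i * real i \<le> real m * real m" using i by (intro mult_mono) auto
        ultimately show ?thesis by linarith
      qed
      ultimately show "vge p (real n * w - real m * real m) (L $ i * D $ (m - i))"
        by (rule vge_mono)
    qed
    hence "vge p (real n * w - real m * real m - real (Suc m)) (L $ Suc m)"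
      using log_deriv_coeff[OF L(2), of m] vge_divide_nat[OF p] by simp
    thus ?thesis unfolding Suc by (rule vge_mono) (simp add: algebra_simps)
  qed
qed

section \<open>Graeffe transforms\<close>

definition even_part :: "'a::zero fps \<Rightarrow> 'a fps" where
  "even_part P = Abs_fps (\<lambda>n. P $ (2 * n))"

definition reflect :: "'a::comm_ring_1 fps \<Rightarrow> 'a fps" where
  "reflect P = Abs_fps (\<lambda>n. (-1) ^ n * P $ n)"

lemma reflect_mult: "reflect (P * R) = reflect P * reflect R"
proof (rule fps_ext)
  fix n
  have "(-1) ^ n * (P $ i * R $ (n - i)) = ((-1) ^ i * P $ i) * ((-1) ^ (n - i) * R $ (n - i))"
    if "i \<le> n" for i
  proof -
    have "(-1 :: 'a) ^ n = (-1) ^ i * (-1) ^ (n - i)" using that by (simp flip: power_add)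
    thus ?thesis by (simp add: mult_ac)
  qed
  thus "reflect (P * R) $ n = (reflect P * reflect R) $ n"
    by (simp add: reflect_def fps_mult_nth sum_distrib_left)
qed

lemma deriv_reflect: "fps_deriv (reflect P) = - reflect (fps_deriv P)"
  by (rule fps_ext) (simp add: reflect_def algebra_simps)

text \<open>If L is a product of factors 1 - a T, then \<open>L * reflect L\<close> is a product of
  factors 1 - a^2 T^2, and its even part one of factors 1 - a^2 T. The new power sums are the old
  ones of even index; as \<open>D $ n\<close> belongs to the power sum of index n + 1, they are the
  entries of D at odd places.\<close>

lemma graeffe_log_deriv:
  fixes L D :: "rat fps"
  assumes "fps_deriv L = L * D"
  shows "fps_deriv (even_part (L * reflect L)) =
           even_part (L * reflect L) * Abs_fps (\<lambda>n. D $ Suc (2 * n))"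
proof (rule fps_ext)
  fix n
  define P where "P = L * reflect L"
  define E where "E = D - reflect D"
  have "fps_deriv P = P * E"
    unfolding P_def E_def using assms by (simp add: deriv_reflect reflect_mult algebra_simps)
  hence "of_nat (Suc (Suc (2 * n))) * P $ Suc (Suc (2 * n)) =
      (\<Sum>i\<le>Suc (2 * n). P $ i * E $ (Suc (2 * n) - i))"
    by (rule log_deriv_coeff)
  \<comment> \<open>E is an odd series, so only even i survive.\<close>
  also have "\<dots> = (\<Sum>i\<in>(\<lambda>j. 2 * j) ` {..n}. P $ i * E $ (Suc (2 * n) - i))"
  proof (rule sum.mono_neutral_right)
    show "\<forall>i\<in>{..Suc (2 * n)} - (\<lambda>j. 2 * j) ` {..n}. P $ i * E $ (Suc (2 * n) - i) = 0"
    proof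
      fix i assume i: "i \<in> {..Suc (2 * n)} - (\<lambda>j. 2 * j) ` {..n}"
      have "odd i"
      proof
        assume "even i"
        then obtain j where "i = 2 * j" by auto
        with i show False by auto
      qed
      with i have "even (Suc (2 * n) - i)" by auto
      thus "P $ i * E $ (Suc (2 * n) - i) = 0" by (simp add: E_def reflect_def)
    qed
  qed auto
  also have "\<dots> = (\<Sum>j\<le>n. P $ (2 * j) * E $ (Suc (2 * n) - 2 * j))"
    by (subst sum.reindex) (auto simp: inj_on_def)
  also have "\<dots> = (\<Sum>j\<le>n. 2 * (P $ (2 * j) * D $ Suc (2 * (n - j))))"
  proof (rule sum.cong)
    fix j assume "j \<in> {..n}"
    hence "Suc (2 * n) - 2 * j = Suc (2 * (n - j))" by auto
    thus "P $ (2 * j) * E $ (Suc (2 * n) - 2 * j) = 2 * (P $ (2 * j) * D $ Suc (2 * (n - j)))"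
      by (simp add: E_def reflect_def)
  qed simp
  finally have "of_nat (Suc n) * P $ (2 * Suc n) = (\<Sum>j\<le>n. P $ (2 * j) * D $ Suc (2 * (n - j)))"
    by (simp add: algebra_simps flip: sum_distrib_left)
  thus "fps_deriv (even_part (L * reflect L)) $ n =
      (even_part (L * reflect L) * Abs_fps (\<lambda>n. D $ Suc (2 * n))) $ n"
    by (simp add: even_part_def fps_mult_nth atLeast0AtMost flip: P_def)
qed

text \<open>The invariant of the Graeffe iteration: N bounds the degree and stays fixed while w
  doubles. Entry n of D is, up to sign, the power sum of index n + 1 of the reciprocal
  roots.\<close>

definition slope_datum :: "nat \<Rightarrow> nat \<Rightarrow> real \<Rightarrow> rat fps \<Rightarrow> bool" where
  "slope_datum p N w L \<longleftrightarrow> L $ 0 = 1 \<and> (\<forall>n>N. L $ n = 0) \<and>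
     (\<exists>D. fps_deriv L = L * D \<and> (\<forall>n. vge p (real (Suc n) * w) (D $ n)))"

lemma slope_datum_graeffe:
  assumes "slope_datum p N w L"
  shows "slope_datum p N (2 * w) (even_part (L * reflect L))"
proof -
  from assms obtain D where D: "fps_deriv L = L * D" "\<And>n. vge p (real (Suc n) * w) (D $ n)"
    and L: "L $ 0 = 1" "\<And>n. n > N \<Longrightarrow> L $ n = 0"
    unfolding slope_datum_def by blast
  have "even_part (L * reflect L) $ n = 0" if "n > N" for n
  proof -
    have "L $ i * reflect L $ (2 * n - i) = 0" if "i \<le> 2 * n" for i
      using that \<open>n > N\<close> L(2)[of i] L(2)[of "2 * n - i"]
      by (cases "i > N") (auto simp: reflect_def)
    hence "(\<Sum>i = 0..2 * n. L $ i * reflect L $ (2 * n - i)) = 0" by (intro sum.neutral) auto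
    thus ?thesis by (simp add: even_part_def fps_mult_nth)
  qed
  moreover have "vge p (real (Suc n) * (2 * w)) (Abs_fps (\<lambda>n. D $ Suc (2 * n)) $ n)" for n
    using D(2)[of "Suc (2 * n)"] by (simp add: algebra_simps)
  ultimately show ?thesis
    unfolding slope_datum_def using L graeffe_log_deriv[OF D(1)]
    by (auto simp: even_part_def reflect_def)
qed

text \<open>
  At the smallest index where the weighted valuation is minimal, the square of the coefficient
  dominates the Graeffe transform, so the defect doubles.
\<close>
lemma graeffe_doubles_defect:
  assumes p: "Factorial_Ring.prime p" and L: "slope_datum p N w L"
    and n: "L $ n \<noteq> 0" "real_of_int (pval p (L $ n)) - real n * w \<le> - x"
  shows "\<exists>m. even_part (L * reflect L) $ m \<noteq> 0 \<and>
      real_of_int (pval p (even_part (L * reflect L) $ m)) - real m * (2 * w) \<le> - (2 * x)"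
proof -
  define A where "A = {n. L $ n \<noteq> 0}"
  define \<delta> where "\<delta> = (\<lambda>n. real_of_int (pval p (L $ n)) - real n * w)"
  have "A \<subseteq> {..N}" using L unfolding A_def slope_datum_def by (auto simp: not_less[symmetric])
  hence fin: "finite A" by (rule finite_subset) simp
  have nA: "n \<in> A" using n by (simp add: A_def)
  define \<mu> where "\<mu> = Min (\<delta> ` A)"
  have \<mu>: "\<mu> \<in> \<delta> ` A" "\<And>i. i \<in> A \<Longrightarrow> \<mu> \<le> \<delta> i"
    unfolding \<mu>_def using fin nA by (auto intro!: Min_in)
  define m where "m = (LEAST i. i \<in> A \<and> \<delta> i = \<mu>)"
  have mA: "m \<in> A" "\<delta> m = \<mu>"
    using LeastI_ex[of "\<lambda>i. i \<in> A \<and> \<delta> i = \<mu>"] \<mu>(1) unfolding m_def by auto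
  have less: "\<mu> < \<delta> i" if "i \<in> A" "i < m" for i
    using not_less_Least[of i "\<lambda>i. i \<in> A \<and> \<delta> i = \<mu>"] \<mu>(2)[OF that(1)] that
    unfolding m_def by fastforce
  define t where "t = (\<lambda>i. L $ i * ((-1) ^ (2 * m - i) * L $ (2 * m - i)))"
  have tm: "t m \<noteq> 0" "pval p (t m) = 2 * pval p (L $ m)"
  proof -
    have nz: "L $ m \<noteq> 0" using mA by (simp add: A_def)
    have "t m = L $ m * L $ m \<or> t m = - (L $ m * L $ m)"
      unfolding t_def by (cases "even m") auto
    thus "t m \<noteq> 0" "pval p (t m) = 2 * pval p (L $ m)"
      using nz pval_uminus[OF p, of "L $ m * L $ m"] pval_mult[OF p nz nz] by auto
  qed
  \<comment> \<open>Of two different indices with sum 2 m one is below m, where the minimum is not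
    attained. The resulting strict inequality becomes a gap of 1 by integrality.\<close>
  have rest: "vge p (real_of_int (pval p (t m)) + 1) (t i)" if i: "i \<le> 2 * m" "i \<noteq> m" for i
  proof (cases "t i = 0")
    case False
    define j where "j = 2 * m - i"
    have A: "i \<in> A" "j \<in> A" using False by (auto simp: A_def t_def j_def)
    have "\<delta> i + \<delta> j > 2 * \<mu>"
    proof (cases "i < m")
      case True
      thus ?thesis using less[OF A(1)] \<mu>(2)[OF A(2)] by linarith
    next
      case False
      hence "j < m" using i by (simp add: j_def)
      thus ?thesis using less[OF A(2)] \<mu>(2)[OF A(1)] by linarith
    qed
    moreover have "real i * w + real j * w = 2 * (real m * w)"
    proof -
      have "real i + real j = 2 * real m" using i by (simp add: j_def of_nat_diff)
      thus ?thesis by (metis distrib_right mult.assoc)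
    qed
    ultimately have "real_of_int (pval p (L $ i) + pval p (L $ j)) > real_of_int (2 * pval p (L $ m))"
      using mA(2) by (simp add: \<delta>_def)
    hence *: "pval p (L $ i) + pval p (L $ j) \<ge> 2 * pval p (L $ m) + 1" by linarith
    have "t i = L $ i * L $ j \<or> t i = - (L $ i * L $ j)"
      unfolding t_def j_def[symmetric] by (cases "even j") auto
    hence "pval p (t i) = pval p (L $ i) + pval p (L $ j)"
      using A pval_uminus[OF p, of "L $ i * L $ j"] pval_mult[OF p, of "L $ i" "L $ j"]
      unfolding A_def by auto
    with * show ?thesis by (simp add: vge_def tm)
  qed auto
  have "even_part (L * reflect L) $ m = (\<Sum>i\<le>2 * m. t i)"
    by (simp add: even_part_def fps_mult_nth reflect_def t_def atLeast0AtMost)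
  also have "\<dots> = t m + (\<Sum>i\<in>{..2 * m} - {m}. t i)" by (rule sum.remove) auto
  finally have eq: "even_part (L * reflect L) $ m = t m + (\<Sum>i\<in>{..2 * m} - {m}. t i)" .
  have "vge p (real_of_int (pval p (t m)) + 1) (\<Sum>i\<in>{..2 * m} - {m}. t i)"
    by (rule vge_sum[OF p]) (auto intro!: rest)
  from pval_dominant[OF p tm(1) this]
  have "even_part (L * reflect L) $ m \<noteq> 0"
    and "pval p (even_part (L * reflect L) $ m) = 2 * pval p (L $ m)" by (simp_all add: eq tm)
  moreover have "\<delta> m \<le> - x" using mA(2) \<mu>(2)[OF nA] n(2) by (simp add: \<delta>_def)
  ultimately show ?thesis by (intro exI[of _ m]) (simp add: \<delta>_def)
qed

lemma graeffe_iterate: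
  assumes p: "Factorial_Ring.prime p" and L: "slope_datum p N w L"
    and n: "L $ n \<noteq> 0" "real_of_int (pval p (L $ n)) - real n * w \<le> - x"
  shows "\<exists>L' w' m. slope_datum p N w' L' \<and> L' $ m \<noteq> 0 \<and>
      real_of_int (pval p (L' $ m)) - real m * w' \<le> - (2 ^ k * x)"
  using L n
proof (induction k arbitrary: L w n x)
  case 0
  thus ?case by force
next
  case (Suc k)
  obtain m where m: "even_part (L * reflect L) $ m \<noteq> 0"
    "real_of_int (pval p (even_part (L * reflect L) $ m)) - real m * (2 * w) \<le> - (2 * x)"
    using graeffe_doubles_defect[OF p Suc.prems] by blast
  from Suc.IH[OF slope_datum_graeffe[OF Suc.prems(1)] m] show ?case by (simp add: mult_ac)
qed

theorem coeff_valuation_of_power_sums: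
  assumes p: "Factorial_Ring.prime p" and L: "slope_datum p N w L"
  shows "vge p (real n * w) (L $ n)"
proof (rule ccontr)
  assume not: "\<not> vge p (real n * w) (L $ n)"
  define x where "x = real n * w - real_of_int (pval p (L $ n))"
  have x: "x > 0" and nz: "L $ n \<noteq> 0" using not by (auto simp: vge_def x_def)
  \<comment> \<open>By \<open>coeff_bound_of_log_deriv\<close> no coefficient of index at most N
    falls short of its bound by more than \<open>N * N\<close>; enough doublings push the defect
    beyond that.\<close>
  obtain k :: nat where "real N * real N / x < real k" using reals_Archimedean2 by blast
  moreover have "real k < 2 ^ k" by (rule of_nat_less_two_power)
  ultimately have "real N * real N / x < 2 ^ k" by linarith
  hence k: "real N * real N < 2 ^ k * x" using x by (simp add: pos_divide_less_eq)
  obtain L' w' m where L': "slope_datum p N w' L'" "L' $ m \<noteq> 0"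
      "real_of_int (pval p (L' $ m)) - real m * w' \<le> - (2 ^ k * x)"
    using graeffe_iterate[OF p L nz, of x k] by (auto simp: x_def)
  from L'(1) obtain D where "L' $ 0 = 1" "fps_deriv L' = L' * D"
    "\<And>n. vge p (real (Suc n) * w') (D $ n)" "\<And>n. n > N \<Longrightarrow> L' $ n = 0"
    unfolding slope_datum_def by blast
  with coeff_bound_of_log_deriv[OF p, of L' D w' m] L'(2)
  have "real_of_int (pval p (L' $ m)) \<ge> real m * w' - real m * real m" and "m \<le> N"
    by (auto simp: vge_def not_less[symmetric])
  moreover have "real m * real m \<le> real N * real N" using \<open>m \<le> N\<close> by (intro mult_mono) auto
  ultimately show False using L'(3) k by linarith
qed

subsection \<open>Functions of bounded degree on elementary abelian groups\<close>

definition shift_diff :: "'a::plus \<Rightarrow> ('a \<Rightarrow> 'b::minus) \<Rightarrow> 'a \<Rightarrow> 'b" where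
  "shift_diff c h x = h (x + c) - h x"

text \<open>Being a polynomial function of degree below m modulo P, with base points and steps taken
  from C. The index is one more than the degree, whereas in \<open>fun_degree_le\<close> it is the
  degree itself.\<close>

primrec diffs_dvd :: "'a::plus set \<Rightarrow> int \<Rightarrow> nat \<Rightarrow> ('a \<Rightarrow> int) \<Rightarrow> bool" where
  "diffs_dvd C P 0 h \<longleftrightarrow> (\<forall>x\<in>C. P dvd h x)"
| "diffs_dvd C P (Suc m) h \<longleftrightarrow> (\<forall>c\<in>C. diffs_dvd C P m (shift_diff c h))"

primrec fun_degree_le :: "nat \<Rightarrow> ('a::plus \<Rightarrow> 'b::minus) \<Rightarrow> bool" where
  "fun_degree_le 0 h \<longleftrightarrow> (\<forall>x y. h x = h y)"
| "fun_degree_le (Suc m) h \<longleftrightarrow> (\<forall>c. fun_degree_le m (shift_diff c h))"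

lemma diffs_dvd_add:
  "diffs_dvd C P m h \<Longrightarrow> diffs_dvd C P m k \<Longrightarrow> diffs_dvd C P m (\<lambda>x. h x + k x)"
proof (induction m arbitrary: h k)
  case (Suc m)
  have "shift_diff c (\<lambda>x. h x + k x) = (\<lambda>x. shift_diff c h x + shift_diff c k x)" for c
    by (auto simp: shift_diff_def)
  with Suc show ?case by simp
qed auto

lemma diffs_dvd_cmult:
  "diffs_dvd C P m h \<Longrightarrow> diffs_dvd C (a * P) m (\<lambda>x. a * h x)"
proof (induction m arbitrary: h)
  case (Suc m)
  have "shift_diff c (\<lambda>x. a * h x) = (\<lambda>x. a * shift_diff c h x)" for c
    by (auto simp: shift_diff_def algebra_simps)
  with Suc show ?case by simp
qed auto

lemma diffs_dvd_weaken: "diffs_dvd C P m h \<Longrightarrow> R dvd P \<Longrightarrow> diffs_dvd C R m h"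
  by (induction m arbitrary: h) (auto dest: dvd_trans)

lemma diffs_dvd_0: "diffs_dvd C P m (\<lambda>x. 0)"
proof (induction m)
  case (Suc m)
  have "shift_diff c (\<lambda>x. 0 :: int) = (\<lambda>x. 0)" for c :: 'a by (auto simp: shift_diff_def)
  with Suc show ?case by simp
qed auto

lemma diffs_dvd_1: "diffs_dvd C 1 m h"
  by (induction m arbitrary: h) auto

lemma diffs_dvd_sum:
  assumes "\<And>i. i \<in> A \<Longrightarrow> diffs_dvd C P m (h i)"
  shows "diffs_dvd C P m (\<lambda>x. \<Sum>i\<in>A. h i x)"
  using assms
  by (induction A rule: infinite_finite_induct) (auto intro: diffs_dvd_0 diffs_dvd_add)

lemma diffs_dvd_shift:
  fixes C :: "'a::ab_semigroup_add set"
  assumes "\<And>x y. x \<in> C \<Longrightarrow> y \<in> C \<Longrightarrow> x + y \<in> C" "c \<in> C" "diffs_dvd C P m h"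
  shows "diffs_dvd C P m (\<lambda>x. h (x + c))"
  using assms(3)
proof (induction m arbitrary: h)
  case (Suc m)
  have "shift_diff d (\<lambda>x. h (x + c)) = (\<lambda>x. shift_diff d h (x + c))" for d
    by (auto simp: shift_diff_def add_ac)
  with Suc show ?case by simp
qed (use assms in auto)

lemma diffs_dvd_Suc:
  fixes C :: "'a::ab_semigroup_add set"
  assumes "\<And>x y. x \<in> C \<Longrightarrow> y \<in> C \<Longrightarrow> x + y \<in> C" "diffs_dvd C P m h"
  shows "diffs_dvd C P (Suc m) h"
  using assms(2)
proof (induction m arbitrary: h)
  case 0
  thus ?case using assms(1) by (auto simp: shift_diff_def)
qed auto

lemma diffs_dvd_mono:
  fixes C :: "'a::ab_semigroup_add set"
  assumes "\<And>x y. x \<in> C \<Longrightarrow> y \<in> C \<Longrightarrow> x + y \<in> C" "diffs_dvd C P m h" "m \<le> n"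
  shows "diffs_dvd C P n h"
  using assms(3) by (induction n rule: dec_induct) (auto intro: assms diffs_dvd_Suc simp del: diffs_dvd.simps(2))

lemma diffs_dvd_funpow:
  assumes "c \<in> C" "diffs_dvd C P (m + l) h"
  shows "diffs_dvd C P m ((shift_diff c ^^ l) h)"
  using assms(2)
proof (induction l arbitrary: h)
  case (Suc l)
  have "diffs_dvd C P (m + l) (shift_diff c h)" using Suc.prems assms(1) by simp
  from Suc.IH[OF this] show ?case by (simp add: funpow_swap1)
qed auto

lemma funpow_shift_diff_sum:
  fixes h :: "'b \<Rightarrow> 'a::plus \<Rightarrow> int"
  shows "(shift_diff c ^^ l) (\<lambda>x. \<Sum>i\<in>A. a i * h i x) = (\<lambda>x. \<Sum>i\<in>A. a i * (shift_diff c ^^ l) (h i) x)"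
proof (induction l)
  case (Suc l)
  show ?case
    unfolding funpow.simps o_def Suc
    by (rule ext) (simp add: shift_diff_def sum_subtractf algebra_simps)
qed auto

text \<open>Translation by c is 1 + Delta, so translation by i c is its i-th power.\<close>

lemma shift_multiple_expand:
  fixes h :: "'a::comm_ring_1 \<Rightarrow> int"
  shows "h (x + of_nat i * c) = (\<Sum>l\<le>i. int (i choose l) * (shift_diff c ^^ l) h x)"
proof (induction i arbitrary: h x)
  case (Suc i)
  let ?D = "\<lambda>l. (shift_diff c ^^ l) h x"
  have "h (x + of_nat (Suc i) * c) = h (x + of_nat i * c) + shift_diff c h (x + of_nat i * c)"
    by (simp add: shift_diff_def algebra_simps)
  also have "\<dots> = (\<Sum>l\<le>i. int (i choose l) * ?D l) + (\<Sum>l\<le>i. int (i choose l) * ?D (Suc l))"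
    by (simp only: Suc funpow_swap1 funpow.simps o_def)
  also have "(\<Sum>l\<le>i. int (i choose l) * ?D l) = (\<Sum>l\<le>Suc i. int (i choose l) * ?D l)"
    by simp
  also have "\<dots> = ?D 0 + (\<Sum>l\<le>i. int (i choose Suc l) * ?D (Suc l))"
    by (subst sum.atMost_Suc_shift) simp
  also have "?D 0 + (\<Sum>l\<le>i. int (i choose Suc l) * ?D (Suc l)) + (\<Sum>l\<le>i. int (i choose l) * ?D (Suc l))
      = ?D 0 + (\<Sum>l\<le>i. int (Suc i choose Suc l) * ?D (Suc l))"
    by (simp add: algebra_simps sum.distrib)
  also have "\<dots> = (\<Sum>l\<le>Suc i. int (Suc i choose l) * ?D l)"
    by (simp only: sum.atMost_Suc_shift) simp
  finally show ?case .
qed auto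

definition multiples_sum :: "nat \<Rightarrow> 'a::comm_ring_1 \<Rightarrow> ('a \<Rightarrow> int) \<Rightarrow> 'a \<Rightarrow> int" where
  "multiples_sum p c h x = (\<Sum>i<p. h (x + of_nat i * c))"

text \<open>With Delta for \<open>shift_diff c\<close>, the operator is the sum of (1 + Delta)^i
  over i < p, that is, ((1 + Delta)^p - 1) / Delta.\<close>

lemma multiples_sum_expand:
  "multiples_sum p c h = (\<lambda>x. \<Sum>l<p. int (p choose Suc l) * (shift_diff c ^^ l) h x)"
proof
  fix x
  let ?D = "\<lambda>l. (shift_diff c ^^ l) h x"
  have "multiples_sum p c h x = (\<Sum>i<p. \<Sum>l<p. int (i choose l) * ?D l)"
    unfolding multiples_sum_def shift_multiple_expand
    by (intro sum.cong sum.mono_neutral_left) (auto simp: binomial_eq_0)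
  also have "\<dots> = (\<Sum>l<p. \<Sum>i<p. int (i choose l) * ?D l)" by (rule sum.swap)
  also have "\<dots> = (\<Sum>l<p. int (p choose Suc l) * ?D l)"
  proof (rule sum.cong)
    fix l assume "l \<in> {..<p}"
    hence p: "Suc (p - 1) = p" by simp
    have "(\<Sum>i<p. i choose l) = (\<Sum>i\<le>p - 1. i choose l)"
      by (subst p[symmetric], subst lessThan_Suc_atMost) (rule refl)
    also have "\<dots> = p choose Suc l" by (subst sum_choose_upper) (simp only: p)
    finally have "(\<Sum>i<p. int (i choose l)) = int (p choose Suc l)"
      by (simp only: of_nat_sum[symmetric])
    thus "(\<Sum>i<p. int (i choose l) * ?D l) = int (p choose Suc l) * ?D l"
      by (simp only: sum_distrib_right[symmetric])
  qed simp
  finally show "multiples_sum p c h x = (\<Sum>l<p. int (p choose Suc l) * ?D l)" .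
qed

text \<open>
  Summation over the multiples of \<open>c\<close> is \<open>\<Delta>\<^sub>c ^ (p - 1)\<close> up to a multiple of \<open>p\<close>.
\<close>
lemma diffs_dvd_multiples_sum:
  fixes C :: "'a::comm_ring_1 set"
  assumes p: "Factorial_Ring.prime p" and C: "\<And>x y. x \<in> C \<Longrightarrow> y \<in> C \<Longrightarrow> x + y \<in> C" and c: "c \<in> C"
    and h: "diffs_dvd C (int p ^ Suc k) (m + (p - 1)) h" "diffs_dvd C (int p ^ k) m h"
  shows "diffs_dvd C (int p ^ Suc k) m (multiples_sum p c h)"
  unfolding multiples_sum_expand
proof (rule diffs_dvd_sum)
  fix l assume l: "l \<in> {..<p}"
  show "diffs_dvd C (int p ^ Suc k) m (\<lambda>x. int (p choose Suc l) * (shift_diff c ^^ l) h x)"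
  \<comment> \<open>The last term has coefficient 1 and takes p - 1 differences; all others have a
    coefficient divisible by p and get by with one power of p less.\<close>
  proof (cases "l = p - 1")
    case True
    hence "Suc l = p" using l by simp
    hence "(\<lambda>x. int (p choose Suc l) * (shift_diff c ^^ l) h x) = (shift_diff c ^^ l) h"
      by (simp only: binomial_n_n of_nat_1 mult_1)
    thus ?thesis using diffs_dvd_funpow[OF c h(1)] True by (simp only:)
  next
    case False
    hence "p dvd p choose Suc l" using l by (intro dvd_choose_prime) (use p in auto)
    moreover have "diffs_dvd C (int p ^ k) (m + l) h" by (rule diffs_dvd_mono[OF C h(2)]) auto
    hence "diffs_dvd C (int (p choose Suc l) * int p ^ k) m
        (\<lambda>x. int (p choose Suc l) * (shift_diff c ^^ l) h x)"
      by (intro diffs_dvd_cmult diffs_dvd_funpow[OF c])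
    moreover have "int p ^ Suc k dvd int (p choose Suc l) * int p ^ k"
      using \<open>p dvd p choose Suc l\<close> by (simp add: mult_dvd_mono)
    ultimately show ?thesis using diffs_dvd_weaken by blast
  qed
qed

section \<open>Summation over elementary abelian groups\<close>

definition add_subgroup :: "'a::ab_group_add set \<Rightarrow> bool" where
  "add_subgroup K \<longleftrightarrow> 0 \<in> K \<and> (\<forall>x\<in>K. \<forall>y\<in>K. x + y \<in> K \<and> x - y \<in> K)"

lemma add_subgroup_of_nat_mult:
  fixes K :: "'a::comm_ring_1 set"
  shows "add_subgroup K \<Longrightarrow> c \<in> K \<Longrightarrow> of_nat i * c \<in> K"
  by (induction i) (auto simp: add_subgroup_def algebra_simps)

text \<open>An i prime to p is invertible modulo p, and an additive subgroup contains all natural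
  multiples of its elements.\<close>

lemma add_subgroup_multiple_cancel:
  fixes K :: "'a::comm_ring_1 set"
  assumes p: "Factorial_Ring.prime p" "CHAR('a) = p" and K: "add_subgroup K"
    and i: "0 < i" "i < p" "of_nat i * c \<in> K"
  shows "c \<in> K"
proof -
  have "coprime i p" using prime_imp_coprime_nat[OF p(1), of i] i nat_dvd_not_less by (simp add: coprime_commute)
  then obtain j y where j: "i * j = p * y + 1" using bezout_nat[of i p] i(1) by auto
  have "of_nat (i * j) = (1 :: 'a)" unfolding j using p(2) of_nat_CHAR[where 'a='a] by simp
  hence "of_nat j * (of_nat i * c) = 1 * c" by (metis mult.assoc mult.commute of_nat_mult)
  hence "c = of_nat j * (of_nat i * c)" by simp
  thus ?thesis using add_subgroup_of_nat_mult[OF K i(3)] by metis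
qed

text \<open>K is a direct sum of cyclic groups of order p, so summing over it amounts to one
  operator \<open>multiples_sum p c\<close> per generator c, evaluated at 0. The subgroups H of
  order p ^ i carry the induction; i = r gives K.\<close>

lemma sum_over_subgroup_as_multiples_sums:
  fixes K :: "'a::comm_ring_1 set"
  assumes p: "Factorial_Ring.prime p" "CHAR('a) = p" and K: "add_subgroup K" "card K = p ^ r"
    and "i \<le> r"
  shows "\<exists>H cs. add_subgroup H \<and> H \<subseteq> K \<and> card H = p ^ i \<and> length cs = i \<and> set cs \<subseteq> K \<and>
     (\<forall>h. sum h H = fold (multiples_sum p) cs h 0)"
  using assms(5)
proof (induction i)
  case 0
  show ?case
    by (rule exI[of _ "{0}"], rule exI[of _ "[]"]) (use K in \<open>auto simp: add_subgroup_def\<close>)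
next
  case (Suc i)
  then obtain H cs where H: "add_subgroup H" "H \<subseteq> K" "card H = p ^ i" "length cs = i" "set cs \<subseteq> K"
     "\<And>h. sum h H = fold (multiples_sum p) cs h 0" by auto
  have "p > 1" using p(1) by (rule prime_gt_1_nat)
  have finK: "finite K" using K \<open>p > 1\<close> by (intro card_ge_0_finite) auto
  have "card H < card K" using H K Suc.prems \<open>p > 1\<close> by simp
  then obtain c where c: "c \<in> K" "c \<notin> H" using H(2) by (metis less_irrefl subsetI subset_antisym)
  define \<pi> where "\<pi> = (\<lambda>(x, j :: nat). x + of_nat j * c)"
  have inj: "inj_on \<pi> (H \<times> {..<p})"
  proof -
    have *: "j = j' \<and> x = x'"
      if "x \<in> H" "x' \<in> H" "j \<le> j'" "j' < p" "x + of_nat j * c = x' + of_nat j' * c" for x x' j j'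
    proof -
      have "of_nat (j' - j) * c = x - x'" using that by (simp add: of_nat_diff algebra_simps)
      hence "of_nat (j' - j) * c \<in> H" using that H(1) by (simp add: add_subgroup_def)
      hence "\<not> 0 < j' - j" using add_subgroup_multiple_cancel[OF p H(1), of "j' - j" c] c(2) that(4)
        by (metis diff_le_self le_less_trans)
      hence "j' = j" using that(3) by simp
      thus ?thesis using that(5) by simp
    qed
    show ?thesis
    proof (rule inj_onI)
      fix a b assume ab: "a \<in> H \<times> {..<p}" "b \<in> H \<times> {..<p}" "\<pi> a = \<pi> b"
      obtain x j x' j' where "a = (x, j)" "b = (x', j')" by (cases a, cases b) auto
      thus "a = b"
        using *[of x x' j j'] *[of x' x j' j] ab by (cases "j \<le> j'") (auto simp: \<pi>_def)
    qed
  qed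
  define H' where "H' = \<pi> ` (H \<times> {..<p})"
  have mem: "x + of_nat j * c \<in> H'" if "x \<in> H" for x j
  proof -
    have "of_nat j = (of_nat (p * (j div p) + j mod p) :: 'a)" by simp
    also have "\<dots> = of_nat (j mod p)" using p(2) of_nat_CHAR[where 'a='a] by (simp only: of_nat_add of_nat_mult) simp
    finally have "of_nat j = (of_nat (j mod p) :: 'a)" .
    thus ?thesis using that \<open>p > 1\<close> unfolding H'_def \<pi>_def by (intro image_eqI[of _ _ "(x, j mod p)"]) auto
  qed
  have "add_subgroup H'"
    unfolding add_subgroup_def
  proof (intro conjI ballI)
    show "0 \<in> H'" using mem[of 0 0] H(1) by (simp add: add_subgroup_def)
    fix a b assume "a \<in> H'" "b \<in> H'"
    then obtain x j x' j' where ab: "a = x + of_nat j * c" "b = x' + of_nat j' * c"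
        "x \<in> H" "x' \<in> H" "j < p" "j' < p" by (auto simp: H'_def \<pi>_def)
    have "x + x' \<in> H" "x - x' \<in> H" using ab H(1) by (auto simp: add_subgroup_def)
    moreover have "a + b = (x + x') + of_nat (j + j') * c" using ab by (simp add: algebra_simps)
    \<comment> \<open>Coefficients are natural numbers, so - j' is replaced by p - j'.\<close>
    moreover have "a - b = (x - x') + of_nat (j + (p - j')) * c"
      using ab p(2) by (simp add: algebra_simps of_nat_diff) (metis of_nat_CHAR mult_zero_right)
    ultimately show "a + b \<in> H'" "a - b \<in> H'" using mem by metis+
  qed
  moreover have "H' \<subseteq> K"
    using H(2) c(1) K(1) add_subgroup_of_nat_mult[OF K(1) c(1)] by (auto simp: H'_def \<pi>_def add_subgroup_def)
  moreover have "card H' = p ^ Suc i" using inj H(3) by (simp add: H'_def card_image card_cartesian_product)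
  moreover have "sum h H' = fold (multiples_sum p) (c # cs) h 0" for h
  proof -
    have "sum h H' = (\<Sum>(x, j)\<in>H \<times> {..<p}. h (x + of_nat j * c))"
      unfolding H'_def by (subst sum.reindex[OF inj]) (simp add: \<pi>_def case_prod_beta o_def)
    also have "\<dots> = (\<Sum>x\<in>H. multiples_sum p c h x)"
      unfolding multiples_sum_def by (rule sum.cartesian_product[symmetric])
    finally show ?thesis using H(6) by simp
  qed
  ultimately show ?case using H c by (intro exI[of _ H'] exI[of _ "c # cs"]) auto
qed

text \<open>Each of the r summation operators lowers the order by p - 1. Order 0 means pointwise
  divisibility, and it is reached because \<open>s * k < r\<close> gives
  \<open>s * k * (p - 1) + 1 \<le> r * (p - 1)\<close>.\<close>

lemma sum_dvd_of_diffs_dvd: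
  fixes K :: "'a::comm_ring_1 set"
  assumes p: "Factorial_Ring.prime p" "CHAR('a) = p" and K: "add_subgroup K" "card K = p ^ r"
    and s: "s \<ge> 1" and h: "\<And>k. diffs_dvd K (int p ^ Suc k) (s * k * (p - 1) + 1) h"
    and k: "s * k < r"
  shows "int p ^ Suc k dvd sum h K"
proof -
  have add: "x + y \<in> K" if "x \<in> K" "y \<in> K" for x y using K(1) that by (simp add: add_subgroup_def)
  \<comment> \<open>All exponents are carried along at once: an operator obtains its bound for
    \<open>p ^ Suc k\<close> from the bounds for \<open>p ^ Suc k\<close> and
    \<open>p ^ k\<close>.\<close>
  have step: "diffs_dvd K (int p ^ Suc k) (s * k * (p - 1) + 1 - (p - 1) * (i + length cs))
      (fold (multiples_sum p) cs h)"
    if "set cs \<subseteq> K" "\<And>k. diffs_dvd K (int p ^ Suc k) (s * k * (p - 1) + 1 - (p - 1) * i) h" for cs i h k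
    using that
  proof (induction cs arbitrary: i h)
    case (Cons c cs)
    have "diffs_dvd K (int p ^ Suc k) (s * k * (p - 1) + 1 - (p - 1) * Suc i) (multiples_sum p c h)" for k
    proof (rule diffs_dvd_multiples_sum[OF p(1) add])
      show "c \<in> K" using Cons by simp
      show "diffs_dvd K (int p ^ Suc k) (s * k * (p - 1) + 1 - (p - 1) * Suc i + (p - 1)) h"
        by (rule diffs_dvd_mono[OF add Cons.prems(2)]) auto
      show "diffs_dvd K (int p ^ k) (s * k * (p - 1) + 1 - (p - 1) * Suc i) h"
      proof (cases k)
        case (Suc j)
        \<comment> \<open>Passing from k to k - 1 frees s (p - 1) orders, at least the p - 1 used up
          by the operator.\<close>
        have "1 * (p - 1) \<le> s * (p - 1)" using s by (rule mult_right_mono) simp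
        hence "s * j * (p - 1) + 1 - (p - 1) * i \<le> s * k * (p - 1) + 1 - (p - 1) * Suc i"
          by (simp add: Suc algebra_simps)
        thus ?thesis unfolding Suc using Cons.prems(2)[of j] diffs_dvd_mono[OF add] by blast
      qed (simp add: diffs_dvd_1)
    qed auto
    from Cons.IH[of "Suc i" "multiples_sum p c h", OF _ this] Cons.prems(1) show ?case by simp
  qed auto
  obtain H cs where H: "H \<subseteq> K" "card H = p ^ r" "length cs = r" "set cs \<subseteq> K"
     "\<And>h. sum h H = fold (multiples_sum p) cs h 0"
    using sum_over_subgroup_as_multiples_sums[OF p K, of r] by auto
  have "finite K" using K(2) p(1) by (intro card_ge_0_finite) (auto simp: prime_gt_0_nat)
  hence [simp]: "H = K" using H K by (intro card_subset_eq) auto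
  have "(s * k + 1) * (p - 1) \<le> r * (p - 1)" using k by (intro mult_right_mono) auto
  moreover have "p - 1 \<ge> 1" using prime_gt_1_nat[OF p(1)] by simp
  ultimately have "s * k * (p - 1) + 1 - (p - 1) * (0 + length cs) = 0"
    by (simp add: H algebra_simps)
  with step[OF H(4), of 0 h k] h have "diffs_dvd K (int p ^ Suc k) 0 (fold (multiples_sum p) cs h)"
    by simp
  hence "int p ^ Suc k dvd fold (multiples_sum p) cs h 0" using K(1) by (simp add: add_subgroup_def)
  thus ?thesis using H(5)[of h] by simp
qed

section \<open>Integer-valued functions on the prime field\<close>

lemma diffs_dvd_prime_field:
  fixes h :: "'a::comm_ring_1 \<Rightarrow> int"
  assumes "\<And>x. P dvd (shift_diff 1 ^^ m) h x"
  shows "diffs_dvd (range of_nat) P m h"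
  using assms
proof (induction m arbitrary: h)
  case (Suc m)
  have "diffs_dvd (range of_nat) P m (shift_diff (of_nat c) h)" for c
  proof -
    \<comment> \<open>A difference with step c telescopes into unit differences, so step 1 alone
      decides.\<close>
    have "shift_diff (of_nat c) h = (\<lambda>x. \<Sum>i<c. shift_diff 1 h (x + of_nat i))"
    proof
      fix x show "shift_diff (of_nat c) h x = (\<Sum>i<c. shift_diff 1 h (x + of_nat i))"
        by (induction c) (auto simp: shift_diff_def algebra_simps)
    qed
    moreover have "diffs_dvd (range of_nat) P m (shift_diff 1 h)"
      using Suc.prems by (intro Suc.IH) (simp add: funpow_swap1)
    ultimately show ?thesis
      by (auto intro!: diffs_dvd_sum diffs_dvd_shift simp: image_iff simp flip: of_nat_add)
  qed
  thus ?case by auto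
qed auto

text \<open>In characteristic p every function has period p along 1, so (1 + Delta)^p = 1 and
  Delta^p is p times an integer combination of Delta, ..., Delta^(p-1). Thus each further p - 1
  differences give a factor p, provided that one Delta is left over; this is why w enters through
  \<open>shift_diff 1 w\<close>.\<close>

lemma prime_field_diffs:
  fixes h :: "'a::comm_ring_1 \<Rightarrow> int"
  assumes p: "Factorial_Ring.prime p" "CHAR('a) = p"
  shows "\<exists>w. (shift_diff 1 ^^ Suc (k * (p - 1))) h = (\<lambda>x. int p ^ k * shift_diff 1 w x)"
proof (induction k)
  case (Suc k)
  let ?d = "shift_diff (1::'a) :: ('a \<Rightarrow> int) \<Rightarrow> 'a \<Rightarrow> int"
  obtain w where w: "(?d ^^ Suc (k * (p - 1))) h = (\<lambda>x. int p ^ k * ?d w x)" using Suc by blast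
  have "p > 1" using p(1) by (rule prime_gt_1_nat)
  define v where "v = (\<lambda>x. \<Sum>l\<in>{..<p - 1}. - int ((p choose Suc l) div p) * (?d ^^ l) w x)"
  have pd: "p dvd p choose Suc l" if "l < p - 1" for l
    using that p(1) by (intro dvd_choose_prime) auto
  have "(?d ^^ p) w = (\<lambda>x. int p * ?d v x)"
  proof
    fix x
    have "w x = w (x + of_nat p * 1)" using p(2) by (metis add.right_neutral mult_zero_left of_nat_CHAR)
    also have "\<dots> = (\<Sum>l\<le>Suc (p - 1). int (p choose l) * (?d ^^ l) w x)"
      using \<open>p > 1\<close> by (subst shift_multiple_expand) simp
    also have "\<dots> = w x + (\<Sum>l\<le>p - 1. int (p choose Suc l) * (?d ^^ Suc l) w x)"
      by (subst sum.atMost_Suc_shift) simp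
    also have "{..p - 1} = insert (p - 1) {..<p - 1}" by auto
    also have "(\<Sum>l\<in>insert (p - 1) {..<p - 1}. int (p choose Suc l) * (?d ^^ Suc l) w x) =
       (?d ^^ p) w x + (\<Sum>l<p - 1. int (p choose Suc l) * (?d ^^ Suc l) w x)"
      using \<open>p > 1\<close> by (subst sum.insert) auto
    finally have "(?d ^^ p) w x = - (\<Sum>l<p - 1. int (p choose Suc l) * (?d ^^ Suc l) w x)" by simp
    also have "\<dots> = int p * (\<Sum>l<p - 1. - int ((p choose Suc l) div p) * (?d ^^ Suc l) w x)"
      unfolding sum_distrib_left sum_negf[symmetric]
    proof (rule sum.cong)
      fix l assume "l \<in> {..<p - 1}"
      hence "int (p choose Suc l) = int p * int ((p choose Suc l) div p)"
        using pd[of l] by (metis dvd_mult_div_cancel lessThan_iff of_nat_mult)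
      thus "- (int (p choose Suc l) * (?d ^^ Suc l) w x) =
          int p * (- int ((p choose Suc l) div p) * (?d ^^ Suc l) w x)" by simp
    qed simp
    also have "(\<Sum>l<p - 1. - int ((p choose Suc l) div p) * (?d ^^ Suc l) w x) = ?d v x"
      using funpow_shift_diff_sum[of 1 1 "\<lambda>l. - int ((p choose Suc l) div p)" "\<lambda>l. (?d ^^ l) w" "{..<p - 1}"]
      by (simp add: v_def)
    finally show "(?d ^^ p) w x = int p * ?d v x" .
  qed
  moreover have "(?d ^^ Suc (Suc k * (p - 1))) h = (\<lambda>x. int p ^ k * (?d ^^ p) w x)"
  proof -
    have "Suc (Suc k * (p - 1)) = (p - 1) + Suc (k * (p - 1))" by simp
    hence "(?d ^^ Suc (Suc k * (p - 1))) h = (?d ^^ (p - 1)) (\<lambda>x. int p ^ k * ?d w x)"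
      by (simp only: funpow_add o_def w)
    also have "\<dots> = (\<lambda>x. int p ^ k * (?d ^^ (p - 1)) (?d w) x)"
      using funpow_shift_diff_sum[of "p - 1" 1 "\<lambda>l. int p ^ k" "\<lambda>l. ?d w" "{0::nat}"] by simp
    also have "(?d ^^ (p - 1)) (?d w) = (?d ^^ p) w"
      using \<open>p > 1\<close> funpow_swap1[of ?d "p - 1" w] by (metis Suc_diff_1 funpow.simps(2) o_apply order_less_trans zero_less_one)
    finally show ?thesis .
  qed
  ultimately show ?case by (intro exI[of _ v]) (auto simp: mult_ac)
qed (auto intro: exI[of _ h])

lemma diffs_dvd_prime_field_any:
  fixes h :: "'a::comm_ring_1 \<Rightarrow> int"
  assumes p: "Factorial_Ring.prime p" "CHAR('a) = p"
  shows "diffs_dvd (range of_nat) (int p ^ k) (Suc (k * (p - 1))) h"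
proof (rule diffs_dvd_prime_field)
  fix x show "int p ^ k dvd (shift_diff 1 ^^ Suc (k * (p - 1))) h x"
    using prime_field_diffs[OF p, of k h] by auto
qed

section \<open>Differences along cubes and composition of functions\<close>

definition cube_diff :: "('a::comm_monoid_add \<Rightarrow> 'b::comm_ring_1) \<Rightarrow> 'i set \<Rightarrow> ('i \<Rightarrow> 'a) \<Rightarrow> 'a \<Rightarrow> 'b" where
  "cube_diff h J c x = (\<Sum>U\<in>Pow J. (-1) ^ card (J - U) * h (x + sum c U))"

lemma sum_Pow_insert:
  assumes "finite J" "j \<notin> J"
  shows "(\<Sum>U\<in>Pow (insert j J). f U) = (\<Sum>U\<in>Pow J. f U) + (\<Sum>U\<in>Pow J. f (insert j U))"
proof -
  have "inj_on (insert j) (Pow J)" using assms(2) by (auto simp: inj_on_def)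
  thus ?thesis
    unfolding Pow_insert using assms
    by (subst sum.union_disjoint) (auto simp: sum.reindex)
qed

lemma cube_diff_insert:
  assumes "finite J" "j \<notin> J"
  shows "cube_diff h (insert j J) c x = cube_diff h J c (x + c j) - cube_diff h J c x"
proof -
  have 1: "card (insert j J - U) = Suc (card (J - U))" if "U \<subseteq> J" for U
  proof -
    have "insert j J - U = insert j (J - U)" using that assms by auto
    thus ?thesis using assms by simp
  qed
  have 2: "J - insert j U = J - U" "sum c (insert j U) = c j + sum c U" if "U \<subseteq> J" for U
  proof -
    show "J - insert j U = J - U" using that assms by auto
    have "finite U" "j \<notin> U" using that assms finite_subset by auto
    thus "sum c (insert j U) = c j + sum c U" by simp
  qed
  have "cube_diff h (insert j J) c x =
     (\<Sum>U\<in>Pow J. - ((-1) ^ card (J - U) * h (x + sum c U))) +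
     (\<Sum>U\<in>Pow J. (-1) ^ card (J - U) * h (x + c j + sum c U))"
    unfolding cube_diff_def sum_Pow_insert[OF assms]
    by (intro arg_cong2[of _ _ _ _ "(+)"] sum.cong) (auto simp: 1 2 add_ac)
  thus ?thesis by (simp add: cube_diff_def sum_negf)
qed

lemma cube_diff_empty [simp]: "cube_diff h {} c x = h x"
  by (simp add: cube_diff_def)

lemma cube_diff_shift_diff:
  "cube_diff (shift_diff d h) J c x = cube_diff h J c (x + d) - cube_diff h J c x"
  unfolding cube_diff_def shift_diff_def
  by (simp add: algebra_simps sum_subtractf)

lemma cube_diff_insert_shift:
  assumes "finite J" "j \<notin> J"
  shows "cube_diff h (insert j J) c x = cube_diff (shift_diff (c j) h) J c x"
  by (simp add: cube_diff_insert[OF assms] cube_diff_shift_diff)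

lemma cube_diff_cong: "(\<And>i. i \<in> J \<Longrightarrow> c i = c' i) \<Longrightarrow> cube_diff h J c x = cube_diff h J c' x"
  unfolding cube_diff_def by (intro sum.cong refl arg_cong2[of _ _ _ _ "(*)"] arg_cong[of _ _ h] arg_cong2[of _ _ _ _ "(+)"]) auto

lemma cube_diff_dvd:
  assumes "finite J" "diffs_dvd C P (card J) h" "c ` J \<subseteq> C" "x \<in> C"
  shows "P dvd cube_diff h J c x"
  using assms
proof (induction J arbitrary: h rule: finite_induct)
  case (insert j J)
  hence "P dvd cube_diff (shift_diff (c j) h) J c x" by (intro insert.IH) auto
  thus ?case using insert.hyps by (simp add: cube_diff_insert_shift)
qed auto

lemma diffs_dvd_of_cube_diff:
  assumes "\<And>c x. (\<And>i. c i \<in> C) \<Longrightarrow> x \<in> C \<Longrightarrow> P dvd cube_diff h {..<m} c x"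
  shows "diffs_dvd C P m h"
  using assms
proof (induction m arbitrary: h)
  case (Suc m)
  have "diffs_dvd C P m (shift_diff d h)" if d: "d \<in> C" for d
  proof (rule Suc.IH)
    fix c :: "nat \<Rightarrow> 'a" and x assume c: "\<And>i. c i \<in> C" "x \<in> C"
    have "P dvd cube_diff h {..<Suc m} (c(m := d)) x" using c d by (intro Suc.prems) auto
    moreover have "cube_diff h {..<Suc m} (c(m := d)) x = cube_diff (shift_diff d h) {..<m} (c(m := d)) x"
      using cube_diff_insert_shift[of "{..<m}" m h "c(m := d)" x] by (simp add: lessThan_Suc)
    moreover have "\<dots> = cube_diff (shift_diff d h) {..<m} c x" by (rule cube_diff_cong) auto
    ultimately show "P dvd cube_diff (shift_diff d h) {..<m} c x" by simp
  qed
  thus ?case by simp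
qed (auto simp: lessThan_0)

lemma fun_degree_le_Suc: "fun_degree_le m (h :: 'a::plus \<Rightarrow> 'b::ab_group_add) \<Longrightarrow> fun_degree_le (Suc m) h"
proof (induction m arbitrary: h)
  case 0
  have "shift_diff c h x = 0" for c x using 0 by (simp add: shift_diff_def)
  thus ?case by simp
qed auto

lemma fun_degree_le_mono:
  "fun_degree_le m (h :: 'a::plus \<Rightarrow> 'b::ab_group_add) \<Longrightarrow> m \<le> n \<Longrightarrow> fun_degree_le n h"
  by (rule dec_induct[of m n "\<lambda>n. fun_degree_le n h"]) (auto intro: fun_degree_le_Suc simp del: fun_degree_le.simps(2))

lemma cube_diff_eq_0:
  fixes h :: "'a::comm_monoid_add \<Rightarrow> 'b::comm_ring_1"
  assumes "finite J" "fun_degree_le m h" "card J > m"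
  shows "cube_diff h J c x = 0"
  using assms
proof (induction J arbitrary: h m rule: finite_induct)
  case (insert j J)
  show ?case
  proof (cases m)
    case 0
    have z: "shift_diff (c j) h = (\<lambda>x. 0)"
      using insert.prems 0 by (auto simp: shift_diff_def fun_eq_iff)
    show ?thesis unfolding cube_diff_insert_shift[OF insert.hyps] z by (simp add: cube_diff_def)
  next
    case (Suc k)
    hence "cube_diff (shift_diff (c j) h) J c x = 0"
      using insert by (intro insert.IH[of k]) auto
    thus ?thesis using insert.hyps by (simp add: cube_diff_insert_shift)
  qed
qed auto

text \<open>Moebius inversion over subsets. It expresses the value at a far corner by differences at
  x, of which only those of small order survive for a function of bounded degree.\<close>

lemma cube_diff_inversion:
  assumes "finite J"
  shows "h (x + sum c J) = (\<Sum>U\<in>Pow J. cube_diff h U c x)"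
  using assms
proof (induction J arbitrary: x rule: finite_induct)
  case (insert j J)
  have "h (x + sum c (insert j J)) = h ((x + c j) + sum c J)" using insert by (simp add: add_ac)
  also have "\<dots> = (\<Sum>U\<in>Pow J. cube_diff h U c (x + c j))" by (rule insert.IH)
  also have "\<dots> = (\<Sum>U\<in>Pow J. cube_diff h U c x + cube_diff h (insert j U) c x)"
  proof (intro sum.cong refl)
    fix U assume "U \<in> Pow J"
    hence "finite U" "j \<notin> U" using insert.hyps finite_subset by auto
    thus "cube_diff h U c (x + c j) = cube_diff h U c x + cube_diff h (insert j U) c x"
      by (simp add: cube_diff_insert)
  qed
  also have "\<dots> = (\<Sum>U\<in>Pow (insert j J). cube_diff h U c x)"
    using insert.hyps by (simp add: sum_Pow_insert sum.distrib)
  finally show ?case .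
qed auto

text \<open>Adding or removing a fixed j in J outside A pairs the supersets with opposite
  signs.\<close>

lemma alternating_sum_supersets:
  assumes "finite J" "A \<subset> J"
  shows "(\<Sum>S\<in>{S. A \<subseteq> S \<and> S \<subseteq> J}. (-1) ^ card (J - S)) = (0 :: int)"
proof -
  obtain j where j: "j \<in> J" "j \<notin> A" using assms(2) by blast
  define B where "B = J - A - {j}"
  have B: "finite B" "j \<notin> B" "J - A = insert j B" using assms j by (auto simp: B_def)
  have "bij_betw (\<lambda>R. J - R) (Pow (J - A)) {S. A \<subseteq> S \<and> S \<subseteq> J}"
    by (rule bij_betw_byWitness[of _ "\<lambda>R. J - R"]) (use assms in auto)
  hence "(\<Sum>S\<in>{S. A \<subseteq> S \<and> S \<subseteq> J}. (-1) ^ card (J - S)) = (\<Sum>R\<in>Pow (J - A). (-1) ^ card (J - (J - R)) :: int)"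
    by (rule sum.reindex_bij_betw[symmetric])
  also have "\<dots> = (\<Sum>R\<in>Pow (insert j B). (-1) ^ card R)"
    unfolding B(3) using B(3) by (intro sum.cong refl arg_cong[of _ _ "\<lambda>n. (-1) ^ n"] arg_cong[of _ _ card]) auto
  also have "\<dots> = (\<Sum>R\<in>Pow B. (-1) ^ card R + (-1) ^ card (insert j R))"
    using B by (simp add: sum_Pow_insert sum.distrib)
  also have "\<dots> = 0"
    using B by (intro sum.neutral) (auto simp: finite_subset subset_iff card_insert_if)
  finally show ?thesis .
qed

text \<open>
  Expanding both functions over cubes, only families of at most \<open>s\<close>-element sets covering
  the whole cube survive, and such a family has more than \<open>n\<close> members.
\<close>
lemma diffs_dvd_compose:
  fixes h :: "'a::comm_ring_1 \<Rightarrow> int" and g :: "'c::ab_group_add \<Rightarrow> 'a"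
  assumes K: "add_subgroup K" and C: "add_subgroup C" and g: "fun_degree_le s g" "g ` K \<subseteq> C"
    and h: "diffs_dvd C P (Suc n) h"
  shows "diffs_dvd K P (Suc (s * n)) (\<lambda>x. h (g x))"
proof (rule diffs_dvd_of_cube_diff)
  fix c :: "nat \<Rightarrow> 'c" and x
  assume c: "\<And>i. c i \<in> K" and x: "x \<in> K"
  define J where "J = {..<Suc (s * n)}"
  have fin: "finite J" by (simp add: J_def)
  define d where "d = (\<lambda>T. cube_diff g T c x)"
  \<comment> \<open>The value of g at the corner S is \<open>d {}\<close> plus the sum of
    \<open>d T\<close> over \<open>F S\<close>. It is itself a corner of a cube for h, with base
    point \<open>d {}\<close> and one step \<open>d T\<close> for each small nonempty T.\<close>
  define F where "F = (\<lambda>S :: nat set. {T. T \<subseteq> S \<and> T \<noteq> {} \<and> card T \<le> s})"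
  have sumK: "sum c U \<in> K" for U
    using c K by (induction U rule: infinite_finite_induct) (auto simp: add_subgroup_def)
  have dC: "d T \<in> C" for T
  proof -
    have gC: "g (x + sum c U) \<in> C" for U using g(2) sumK x K by (auto simp: add_subgroup_def)
    have neg: "(-1) ^ m * y \<in> C" if "y \<in> C" for m y
    proof -
      have "0 - y \<in> C" using that C unfolding add_subgroup_def by blast
      thus ?thesis using that by (cases "even m") auto
    qed
    have sumC: "sum f A \<in> C" if "\<And>i. i \<in> A \<Longrightarrow> f i \<in> C" for f and A :: "nat set set"
      using that C by (induction A rule: infinite_finite_induct) (auto simp: add_subgroup_def)
    show ?thesis unfolding d_def cube_diff_def by (intro sumC neg gC)
  qed
  have finF: "finite (F S)" if "S \<subseteq> J" for S
  proof -
    have "F S \<subseteq> Pow J" using that by (auto simp: F_def)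
    thus ?thesis using fin finite_subset by blast
  qed
  have expand: "h (g (x + sum c S)) = (\<Sum>T\<in>Pow (F S). cube_diff h T d (d {}))" if S: "S \<subseteq> J" for S
  proof -
    have finS: "finite S" using S fin finite_subset by blast
    have "g (x + sum c S) = sum d (Pow S)"
      unfolding d_def by (rule cube_diff_inversion[OF finS])
    also have "\<dots> = sum d (insert {} (F S))"
    proof (rule sum.mono_neutral_right)
      show "\<forall>T\<in>Pow S - insert {} (F S). d T = 0"
      proof
        fix T assume "T \<in> Pow S - insert {} (F S)"
        hence "finite T" "card T > s" using finS finite_subset by (auto simp: F_def)
        thus "d T = 0" unfolding d_def by (intro cube_diff_eq_0[OF _ g(1)])
      qed
    qed (use finS in \<open>auto simp: F_def\<close>)
    also have "\<dots> = d {} + sum d (F S)" using finF[OF S] by (simp add: F_def)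
    finally show ?thesis using cube_diff_inversion[OF finF[OF S], of h "d {}" d] by simp
  qed
  have "cube_diff (\<lambda>x. h (g x)) J c x =
      (\<Sum>S\<in>Pow J. \<Sum>T\<in>Pow (F S). (-1) ^ card (J - S) * cube_diff h T d (d {}))"
    unfolding cube_diff_def[of "\<lambda>x. h (g x)"]
    by (intro sum.cong refl) (simp add: expand sum_distrib_left)
  also have "\<dots> = (\<Sum>(S, T)\<in>Sigma (Pow J) (\<lambda>S. Pow (F S)). (-1) ^ card (J - S) * cube_diff h T d (d {}))"
    by (rule sum.Sigma) (auto simp: fin finF)
  \<comment> \<open>T is a family of sets: it is contained in \<open>F S\<close> exactly when it is
    contained in \<open>F J\<close> and its union lies in S. For fixed T the signs cancel unless the
    union is all of J.\<close>
  also have "\<dots> = (\<Sum>(T, S)\<in>Sigma (Pow (F J)) (\<lambda>T. {S. \<Union>T \<subseteq> S \<and> S \<subseteq> J}).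
      (-1) ^ card (J - S) * cube_diff h T d (d {}))"
    by (rule sum.reindex_bij_witness[of _ "\<lambda>(T, S). (S, T)" "\<lambda>(S, T). (T, S)"])
      (auto simp: F_def)
  also have "\<dots> = (\<Sum>T\<in>Pow (F J). \<Sum>S\<in>{S. \<Union>T \<subseteq> S \<and> S \<subseteq> J}. (-1) ^ card (J - S) * cube_diff h T d (d {}))"
    by (rule sum.Sigma[symmetric]) (auto simp: fin finF)
  also have "P dvd \<dots>"
  proof (rule dvd_sum)
    fix T assume T: "T \<in> Pow (F J)"
    hence finT: "finite T" using finF[of J] finite_subset by auto
    have "P dvd (\<Sum>S\<in>{S. \<Union>T \<subseteq> S \<and> S \<subseteq> J}. (-1) ^ card (J - S)) * cube_diff h T d (d {})"
    proof (cases "\<Union>T = J")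
      case False
      hence "\<Union>T \<subset> J" using T by (auto simp: F_def)
      thus ?thesis using alternating_sum_supersets[OF fin] by simp
    next
      case True
      have "card (\<Union>T) \<le> (\<Sum>A\<in>T. card A)" by (rule card_Union_le_sum_card)
      also have "\<dots> \<le> (\<Sum>A\<in>T. s)" using T by (intro sum_mono) (auto simp: F_def)
      finally have "Suc (s * n) \<le> card T * s" using True by (simp add: J_def)
      hence "Suc n \<le> card T" by (metis Suc_le_eq mult.commute mult_less_cancel1)
      hence "diffs_dvd C P (card T) h"
        using diffs_dvd_mono[OF _ h] C by (auto simp: add_subgroup_def)
      hence "P dvd cube_diff h T d (d {})" by (rule cube_diff_dvd[OF finT]) (auto intro: dC)
      thus ?thesis by simp
    qed
    thus "P dvd (\<Sum>S\<in>{S. \<Union>T \<subseteq> S \<and> S \<subseteq> J}. (-1) ^ card (J - S) * cube_diff h T d (d {}))"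
      by (simp add: sum_distrib_right)
  qed
  finally show "P dvd cube_diff (\<lambda>x. h (g x)) {..<Suc (s * n)} c x" by (simp add: J_def)
qed

text \<open>For p times the indicator of 0, divisibility by \<open>p ^ Suc k\<close> is reached at
  order \<open>k * (p - 1) + 1\<close>. The composite with g therefore meets the hypothesis of
  \<open>sum_dvd_of_diffs_dvd\<close>, and its sum over K is p times the number of zeros.\<close>

theorem zero_count_dvd:
  fixes K :: "'a::comm_ring_1 set"
  assumes p: "Factorial_Ring.prime p" "CHAR('a) = p" and K: "add_subgroup K" "card K = p ^ r"
    and g: "fun_degree_le s g" "g ` K \<subseteq> (range of_nat :: 'a set)" and s: "s \<ge> 1" "s * k < r"
  shows "p ^ Suc k dvd p * card {x\<in>K. g x = 0}"
proof -
  have fin: "finite K" using K(2) p(1) by (intro card_ge_0_finite) (auto simp: prime_gt_0_nat)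
  have C: "add_subgroup (range of_nat :: 'a set)"
    unfolding add_subgroup_def
  proof (intro conjI ballI)
    fix x y :: 'a assume "x \<in> range of_nat" "y \<in> range of_nat"
    then obtain i j where ij: "x = of_nat i" "y = of_nat j" by auto
    show "x + y \<in> range of_nat" using ij by (metis of_nat_add rangeI)
    have "x - y = of_nat (i + (p - 1) * j)"
    proof -
      have "of_nat (p - 1) = (-1 :: 'a)"
        using p(2) prime_gt_0_nat[OF p(1)] by (metis of_nat_diff of_nat_CHAR of_nat_1 diff_0 Suc_leI One_nat_def)
      thus ?thesis using ij by simp
    qed
    thus "x - y \<in> range of_nat" by (metis rangeI)
  qed (metis of_nat_0 rangeI)
  define h :: "'a \<Rightarrow> int" where "h = (\<lambda>x. int p * (if x = 0 then 1 else 0))"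
  have "diffs_dvd K (int p ^ Suc k) (s * k * (p - 1) + 1) (\<lambda>x. h (g x))" for k
  proof -
    have "diffs_dvd (range of_nat) (int p * int p ^ k) (Suc (k * (p - 1))) h"
      unfolding h_def by (intro diffs_dvd_cmult diffs_dvd_prime_field_any p)
    from diffs_dvd_compose[OF K(1) C g this] show ?thesis by (simp add: mult_ac)
  qed
  from sum_dvd_of_diffs_dvd[OF p K s(1) this s(2)]
  have "int p ^ Suc k dvd (\<Sum>x\<in>K. h (g x))" .
  also have "(\<Sum>x\<in>K. h (g x)) = int (p * card {x\<in>K. g x = 0})"
    using fin by (simp add: h_def sum.If_cases Int_def conj_commute flip: sum_distrib_left)
  finally show ?thesis by (metis int_dvd_int_iff of_nat_power)
qed

section \<open>Degrees of polynomial functions and base-p digits\<close>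

lemma fun_degree_le_add:
  fixes h k :: "'a::plus \<Rightarrow> 'b::ab_group_add"
  shows "fun_degree_le m h \<Longrightarrow> fun_degree_le m k \<Longrightarrow> fun_degree_le m (\<lambda>x. h x + k x)"
proof (induction m arbitrary: h k)
  case (Suc m)
  have "shift_diff c (\<lambda>x. h x + k x) = (\<lambda>x. shift_diff c h x + shift_diff c k x)" for c
    by (auto simp: shift_diff_def)
  with Suc show ?case by simp
next
  case 0
  show ?case unfolding fun_degree_le.simps(1)
  proof (intro allI)
    fix x y
    have "h x = h y" "k x = k y" using 0 unfolding fun_degree_le.simps(1) by blast+
    thus "h x + k x = h y + k y" by simp
  qed
qed

lemma fun_degree_le_const: "fun_degree_le m (\<lambda>x :: 'a::plus. c :: 'b::ab_group_add)"
  by (rule fun_degree_le_mono[of 0]) auto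

lemma fun_degree_le_sum:
  fixes h :: "'i \<Rightarrow> 'a::plus \<Rightarrow> 'b::ab_group_add"
  assumes "\<And>i. i \<in> A \<Longrightarrow> fun_degree_le m (h i)"
  shows "fun_degree_le m (\<lambda>x. \<Sum>i\<in>A. h i x)"
  using assms
  by (induction A rule: infinite_finite_induct) (auto intro: fun_degree_le_add fun_degree_le_const)

lemma fun_degree_le_additive:
  fixes h :: "'a::plus \<Rightarrow> 'b::ab_group_add"
  assumes "\<And>x y. L (x + y) = L x + L y" "fun_degree_le m h"
  shows "fun_degree_le m (\<lambda>x. L (h x) :: 'b)"
  using assms(2)
proof (induction m arbitrary: h)
  case (Suc m)
  have "L (x - y) = L x - L y" for x y using assms(1)[of "x - y" y] by simp
  hence "shift_diff c (\<lambda>x. L (h x)) = (\<lambda>x. L (shift_diff c h x))" for c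
    by (auto simp: shift_diff_def)
  with Suc show ?case by simp
next
  case 0
  show ?case unfolding fun_degree_le.simps(1)
  proof (intro allI)
    fix x y
    have "h x = h y" using 0 unfolding fun_degree_le.simps(1) by blast
    thus "L (h x) = L (h y)" by simp
  qed
qed

lemma fun_degree_le_shift:
  fixes h :: "'a::ab_semigroup_add \<Rightarrow> 'b::ab_group_add"
  shows "fun_degree_le m h \<Longrightarrow> fun_degree_le m (\<lambda>x. h (x + c))"
proof (induction m arbitrary: h)
  case (Suc m)
  have "shift_diff d (\<lambda>x. h (x + c)) = (\<lambda>x. shift_diff d h (x + c))" for d
    by (auto simp: shift_diff_def add_ac)
  with Suc show ?case by simp
next
  case 0
  thus ?case unfolding fun_degree_le.simps(1) by blast
qed

text \<open>Leibniz rule: the difference of h L is (Delta h) L plus the constant L(c) times a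
  translate of h.\<close>

lemma fun_degree_le_mult_additive:
  fixes h L :: "'a::ab_semigroup_add \<Rightarrow> 'b::comm_ring_1"
  assumes "\<And>x y. L (x + y) = L x + L y" "fun_degree_le m h"
  shows "fun_degree_le (Suc m) (\<lambda>x. h x * L x)"
  using assms(2)
proof (induction m arbitrary: h)
  case 0
  have "h = (\<lambda>x. h undefined)" using 0 unfolding fun_degree_le.simps(1) by blast
  then obtain a where "h = (\<lambda>x. a)" by blast
  thus ?case by (auto simp: shift_diff_def assms(1) algebra_simps)
next
  case (Suc m)
  have "fun_degree_le (Suc m) (shift_diff c (\<lambda>x. h x * L x))" for c
  proof -
    have "shift_diff c (\<lambda>x. h x * L x) = (\<lambda>x. shift_diff c h x * L x + L c * h (x + c))"
      by (auto simp: shift_diff_def assms(1) algebra_simps)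
    moreover have "fun_degree_le (Suc m) (\<lambda>x. shift_diff c h x * L x)"
      using Suc by simp
    moreover have "fun_degree_le (Suc m) (\<lambda>x. L c * h (x + c))"
      by (intro fun_degree_le_additive[of "\<lambda>y. L c * y"] fun_degree_le_shift Suc.prems) (simp add: algebra_simps)
    ultimately show ?thesis by (simp only: fun_degree_le_add)
  qed
  thus ?case unfolding fun_degree_le.simps(2)[of "Suc m"] by blast
qed

lemma digit_sum_extend:
  assumes "p \<ge> 2" "n \<le> N"
  shows "digit_sum p n = (\<Sum>k\<le>N. n div p ^ k mod p)"
  unfolding digit_sum_def
proof (rule sum.mono_neutral_left)
  show "\<forall>i\<in>{..N} - {..n}. n div p ^ i mod p = 0"
  proof
    fix i assume "i \<in> {..N} - {..n}"
    hence "n < p ^ i" using power_gt_expt[of p i] assms(1) by auto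
    thus "n div p ^ i mod p = 0" by simp
  qed
qed (use assms in auto)

lemma digit_sum_rec:
  assumes "p \<ge> 2" "n > 0"
  shows "digit_sum p n = n mod p + digit_sum p (n div p)"
proof -
  obtain m where m: "n = Suc m" using assms(2) by (cases n) auto
  have "n div p < n" using assms by simp
  hence "digit_sum p (n div p) = (\<Sum>k\<le>m. n div p div p ^ k mod p)"
    using m by (intro digit_sum_extend assms(1)) auto
  moreover have "digit_sum p n = n mod p + (\<Sum>k\<le>m. n div p ^ Suc k mod p)"
    unfolding digit_sum_def m by (subst sum.atMost_Suc_shift) simp
  ultimately show ?thesis by (simp add: div_mult2_eq)
qed

text \<open>Induction on the digits of l. The Frobenius power j is general because removing the last
  digit replaces \<open>x ^ (p ^ j)\<close> by \<open>x ^ (p ^ Suc j)\<close>; the last digit itself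
  counts additive factors \<open>x ^ (p ^ j)\<close>.\<close>

lemma fun_degree_le_power:
  fixes x :: "'a::comm_ring_1"
  assumes p: "Factorial_Ring.prime p" "CHAR('a) = p"
  shows "fun_degree_le (digit_sum p l) (\<lambda>x :: 'a. (x ^ (p ^ j)) ^ l)"
proof (induction l arbitrary: j rule: less_induct)
  case (less l)
  show ?case
  proof (cases "l = 0")
    case True
    thus ?thesis by (simp add: fun_degree_le_const)
  next
    case False
    have p2: "p \<ge> 2" using p(1) by (rule prime_ge_2_nat)
    have step: "fun_degree_le (m + i) (\<lambda>x :: 'a. h x * (x ^ (p ^ j)) ^ i)" if "fun_degree_le m h" for h m i
    proof (induction i)
      case (Suc i)
      have "fun_degree_le (Suc (m + i)) (\<lambda>x :: 'a. (h x * (x ^ (p ^ j)) ^ i) * x ^ (p ^ j))"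
        by (intro fun_degree_le_mult_additive Suc freshmans_dream') (use p in auto)
      thus ?case by (simp add: mult_ac)
    qed (use that in simp)
    have "fun_degree_le (digit_sum p (l div p)) (\<lambda>x :: 'a. (x ^ (p ^ Suc j)) ^ (l div p))"
      by (rule less.IH) (use p2 False in auto)
    from step[OF this, of "l mod p"]
    have "fun_degree_le (digit_sum p l) (\<lambda>x :: 'a. (x ^ (p ^ Suc j)) ^ (l div p) * (x ^ (p ^ j)) ^ (l mod p))"
      using digit_sum_rec[OF p2, of l] False by (simp add: add.commute)
    also have "(\<lambda>x :: 'a. (x ^ (p ^ Suc j)) ^ (l div p) * (x ^ (p ^ j)) ^ (l mod p)) = (\<lambda>x. (x ^ (p ^ j)) ^ l)"
    proof
      fix x :: 'a
      have "(x ^ (p ^ Suc j)) ^ (l div p) = (x ^ (p ^ j)) ^ (p * (l div p))"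
        by (simp add: power_mult[symmetric] mult_ac)
      thus "(x ^ (p ^ Suc j)) ^ (l div p) * (x ^ (p ^ j)) ^ (l mod p) = (x ^ (p ^ j)) ^ l"
        by (simp flip: power_add)
    qed
    finally show ?thesis .
  qed
qed

lemma fun_degree_le_poly:
  fixes g :: "'a::comm_ring_1 poly"
  assumes p: "Factorial_Ring.prime p" "CHAR('a) = p"
    and g: "\<And>l. Polynomial.coeff g l \<noteq> 0 \<Longrightarrow> digit_sum p l \<le> s"
  shows "fun_degree_le s (poly g)"
proof -
  have "fun_degree_le s (\<lambda>x. \<Sum>l\<le>Polynomial.degree g. Polynomial.coeff g l * x ^ l)"
  proof (rule fun_degree_le_sum)
    fix l
    show "fun_degree_le s (\<lambda>x. Polynomial.coeff g l * x ^ l)"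
    proof (cases "Polynomial.coeff g l = 0")
      case True
      thus ?thesis by (simp add: fun_degree_le_const)
    next
      case False
      have "fun_degree_le s (\<lambda>x :: 'a. x ^ l)"
        using fun_degree_le_mono[OF fun_degree_le_power[OF p, of l 0] g[OF False]] by simp
      thus ?thesis by (intro fun_degree_le_additive[of "\<lambda>y. Polynomial.coeff g l * y"]) (simp add: algebra_simps)
    qed
  qed
  thus ?thesis by (simp add: poly_altdef[abs_def])
qed

subsection \<open>Traces and additive characters of finite fields\<close>

text \<open>In an algebraically closed field, and for N a positive power of the prime
  characteristic, this is the subfield with N elements. The base field, its extensions and F_q all
  appear in this form.\<close>

definition fixed_field :: "nat \<Rightarrow> 'a::field set" where
  "fixed_field N = {c. c ^ N = c}"

lemma proots_alg_closed:
  fixes h :: "'a::alg_closed_field poly"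
  assumes "h \<noteq> 0"
  shows "h = Polynomial.smult (Polynomial.lead_coeff h) (\<Prod>a\<in>#proots h. [:- a, 1:])"
    and "size (proots h) = Polynomial.degree h"
proof -
  obtain A where A: "size A = Polynomial.degree h"
      "h = Polynomial.smult (Polynomial.lead_coeff h) (\<Prod>a\<in>#A. [:- a, 1:])"
    using alg_closed_imp_factorization[OF assms] by blast
  have "proots (\<Prod>a\<in>#A. [:- a, 1:]) = A"
  proof (induction A)
    case (add a A)
    have "(\<Prod>a\<in>#A. [:- a, 1:]) \<noteq> 0" by (auto simp: prod_mset_zero_iff)
    thus ?case using add by (simp add: proots_mult del: mult_pCons_left)
  qed auto
  hence "proots h = A" using assms by (subst A(2)) simp
  with A show "h = Polynomial.smult (Polynomial.lead_coeff h) (\<Prod>a\<in>#proots h. [:- a, 1:])"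
    and "size (proots h) = Polynomial.degree h" by auto
qed

text \<open>The polynomial X^N - X has derivative -1, hence N simple roots.\<close>

lemma card_fixed_field:
  assumes p: "Factorial_Ring.prime p" "CHAR('a::alg_closed_field) = p" and r: "r \<ge> 1"
  shows "card (fixed_field (p ^ r) :: 'a set) = p ^ r"
proof -
  define N where "N = p ^ r"
  have N: "N > 1" unfolding N_def using prime_gt_1_nat[OF p(1)] r by (intro one_less_power) auto
  define h where "h = Polynomial.monom (1::'a) N - Polynomial.monom 1 1"
  have root: "poly h c = c ^ N - c" for c by (simp add: h_def poly_monom)
  have "Polynomial.coeff h N = 1" using N by (simp add: h_def)
  hence h0: "h \<noteq> 0" by auto
  have deg: "Polynomial.degree h = N"
  proof (rule antisym)
    show "Polynomial.degree h \<le> N"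
      unfolding h_def using N degree_monom_le[of "1::'a" N] degree_monom_le[of "1::'a" 1]
      by (intro degree_diff_le) auto
    show "N \<le> Polynomial.degree h" using \<open>Polynomial.coeff h N = 1\<close> by (intro le_degree) simp
  qed
  have "of_nat N = (0 :: 'a)"
    using p(2) r of_nat_CHAR[where 'a='a] unfolding N_def by (simp add: power_0_left)
  hence der: "poly (pderiv h) c = -1" for c
    by (simp add: h_def pderiv_diff pderiv_monom poly_monom)
  have ord: "Polynomial.order c h = 1" if "poly h c = 0" for c
  proof -
    have "Polynomial.order c h \<noteq> 0" using that h0 by (simp add: order_root)
    moreover have "\<not> 2 \<le> Polynomial.order c h"
    proof
      assume "2 \<le> Polynomial.order c h"
      hence "[:- c, 1:] ^ 2 dvd h" using order_1[of c h] power_le_dvd by blast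
      then obtain k where "h = [:- c, 1:] ^ 2 * k" by (elim dvdE)
      hence "h = [:- c, 1:] * ([:- c, 1:] * k)" by (simp only: power2_eq_square mult.assoc)
      hence "poly (pderiv h) c = 0" by (simp add: pderiv_mult del: mult_pCons_left)
      thus False using der[of c] by simp
    qed
    ultimately show ?thesis by linarith
  qed
  have "N = size (proots h)" using proots_alg_closed(2)[OF h0] deg by simp
  also have "\<dots> = (\<Sum>c\<in>{c. poly h c = 0}. count (proots h) c)"
    using h0 by (simp add: size_multiset_overloaded_eq)
  also have "\<dots> = card {c. poly h c = 0}" using h0 ord by simp
  also have "{c. poly h c = 0} = fixed_field N" by (auto simp: root fixed_field_def)
  finally show ?thesis by (simp add: N_def)
qed

lemma finite_fixed_field:
  assumes "Factorial_Ring.prime p" "CHAR('a::alg_closed_field) = p" "r \<ge> 1"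
  shows "finite (fixed_field (p ^ r) :: 'a set)"
  using card_fixed_field[OF assms] prime_gt_0_nat[OF assms(1)] by (intro card_ge_0_finite) simp

lemma fixed_field_closed:
  fixes x y :: "'a::field"
  assumes p: "Factorial_Ring.prime p" "CHAR('a) = p"
    and "x \<in> fixed_field (p ^ r)" "y \<in> fixed_field (p ^ r)"
  shows "x + y \<in> fixed_field (p ^ r)" "x - y \<in> fixed_field (p ^ r)" "- x \<in> fixed_field (p ^ r)"
    "x * y \<in> fixed_field (p ^ r)" "x ^ n \<in> fixed_field (p ^ r)" "inverse x \<in> fixed_field (p ^ r)"
proof -
  have F: "(a + b) ^ (p ^ r) = a ^ (p ^ r) + b ^ (p ^ r)" for a b :: 'a
    by (rule freshmans_dream') (use p in auto)
  have d: "x - y \<in> fixed_field (p ^ r)" if "x \<in> fixed_field (p ^ r)" "y \<in> fixed_field (p ^ r)" for x y :: 'a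
    using F[of "x - y" y] that by (simp add: fixed_field_def eq_diff_eq)
  show "x - y \<in> fixed_field (p ^ r)" using d assms by blast
  have "(0 :: 'a) \<in> fixed_field (p ^ r)" using prime_gt_0_nat[OF p(1)] by (simp add: fixed_field_def)
  from d[OF this assms(3)] show "- x \<in> fixed_field (p ^ r)" by simp
  show "x + y \<in> fixed_field (p ^ r)" using assms F by (simp add: fixed_field_def)
  show "x * y \<in> fixed_field (p ^ r)" using assms by (simp add: fixed_field_def power_mult_distrib)
  show "inverse x \<in> fixed_field (p ^ r)" using assms by (simp add: fixed_field_def power_inverse)
  show "x ^ n \<in> fixed_field (p ^ r)" using assms
    by (simp add: fixed_field_def) (metis power_mult mult.commute)
qed

lemma fixed_field_0_1:
  assumes "Factorial_Ring.prime p"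
  shows "0 \<in> fixed_field (p ^ r)" "1 \<in> fixed_field (p ^ r)"
  using prime_gt_0_nat[OF assms] by (auto simp: fixed_field_def)

lemma fixed_field_sum:
  fixes f :: "'b \<Rightarrow> 'a::field"
  assumes p: "Factorial_Ring.prime p" "CHAR('a) = p"
    and "\<And>i. i \<in> A \<Longrightarrow> f i \<in> fixed_field (p ^ r)"
  shows "sum f A \<in> fixed_field (p ^ r)"
  using assms(3)
  by (induction A rule: infinite_finite_induct) (auto intro: fixed_field_closed[OF p] fixed_field_0_1[OF p(1)])

lemma fixed_field_of_nat:
  assumes p: "Factorial_Ring.prime p" "CHAR('a::field) = p"
  shows "(of_nat n :: 'a) \<in> fixed_field (p ^ r)"
  by (induction n) (auto intro: fixed_field_closed[OF p] fixed_field_0_1[OF p(1)])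

lemma add_subgroup_fixed_field:
  assumes p: "Factorial_Ring.prime p" "CHAR('a::field) = p"
  shows "add_subgroup (fixed_field (p ^ r) :: 'a set)"
  unfolding add_subgroup_def using fixed_field_closed(1,2)[OF p] fixed_field_0_1[OF p(1)] by blast

lemma fixed_field_poly:
  fixes g :: "'a::field poly"
  assumes p: "Factorial_Ring.prime p" "CHAR('a) = p"
    and "\<And>i. Polynomial.coeff g i \<in> fixed_field (p ^ r)" "x \<in> fixed_field (p ^ r)"
  shows "poly g x \<in> fixed_field (p ^ r)"
  unfolding poly_altdef using assms(3,4) by (intro fixed_field_sum[OF p] fixed_field_closed[OF p]) auto

lemma fixed_field_iterate:
  "x \<in> fixed_field N \<Longrightarrow> x ^ (N ^ k) = x"
  by (induction k) (auto simp: fixed_field_def power_mult)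

lemma fixed_field_mono:
  assumes "r dvd n" shows "fixed_field (p ^ r) \<subseteq> fixed_field (p ^ n)"
  using assms fixed_field_iterate[of _ "p ^ r"] by (auto elim!: dvdE simp: power_mult fixed_field_def)

lemma frobenius_inj:
  fixes x y :: "'a::field"
  assumes p: "Factorial_Ring.prime p" "CHAR('a) = p" and "x ^ (p ^ r) = y ^ (p ^ r)"
  shows "x = y"
proof -
  have "(x - y) ^ (p ^ r) + y ^ (p ^ r) = x ^ (p ^ r)"
    using freshmans_dream'[of "p ^ r" r "x - y" y] p by simp
  hence "(x - y) ^ (p ^ r) = 0" using assms(3) by simp
  thus ?thesis by simp
qed

lemma poly_frobenius:
  fixes g :: "'a::field poly"
  assumes p: "Factorial_Ring.prime p" "CHAR('a) = p"
    and g: "\<And>i. Polynomial.coeff g i \<in> fixed_field (p ^ r)"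
  shows "poly g (x ^ (p ^ r)) = poly g x ^ (p ^ r)"
proof -
  have "poly g x ^ (p ^ r) = (\<Sum>i\<le>Polynomial.degree g. (Polynomial.coeff g i * x ^ i) ^ (p ^ r))"
    unfolding poly_altdef by (rule freshmans_dream_sum') (use p in auto)
  also have "\<dots> = poly g (x ^ (p ^ r))"
    unfolding poly_altdef using g
    by (intro sum.cong refl) (simp add: power_mult_distrib fixed_field_def mult.commute flip: power_mult)
  finally show ?thesis ..
qed

lemma prime_field_eq_range:
  assumes p: "Factorial_Ring.prime p" "CHAR('a::alg_closed_field) = p"
  shows "(fixed_field p :: 'a set) = range of_nat"
proof -
  have fin: "finite (fixed_field p :: 'a set)" and c: "card (fixed_field p :: 'a set) = p"
    using finite_fixed_field[OF p, of 1] card_fixed_field[OF p, of 1] by auto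
  have sub: "range of_nat \<subseteq> (fixed_field p :: 'a set)" using fixed_field_of_nat[OF p, of _ 1] by auto
  have "inj_on (of_nat :: nat \<Rightarrow> 'a) {..<p}"
  proof (rule linorder_inj_onI)
    fix i j :: nat assume "i < j" "i \<in> {..<p}" "j \<in> {..<p}"
    thus "(of_nat i :: 'a) \<noteq> of_nat j"
      using p(2) of_nat_eq_iff_char_dvd[OF \<open>i < j\<close>, where 'a='a] by (auto dest!: dvd_imp_le)
  qed auto
  hence "p = card ((of_nat :: nat \<Rightarrow> 'a) ` {..<p})" by (simp add: card_image)
  also have "\<dots> \<le> card (range of_nat :: 'a set)" using finite_subset[OF sub fin] by (intro card_mono) auto
  finally have "range of_nat = (fixed_field p :: 'a set)" using sub fin c by (intro card_seteq) auto
  thus ?thesis ..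
qed

text \<open>The absolute trace, for z in the field with p ^ r elements.\<close>

definition trace_sum :: "nat \<Rightarrow> nat \<Rightarrow> 'a::field \<Rightarrow> 'a" where
  "trace_sum p r z = (\<Sum>i<r. z ^ (p ^ i))"

lemma trace_sum_add:
  fixes y z :: "'a::field"
  assumes p: "Factorial_Ring.prime p" "CHAR('a) = p"
  shows "trace_sum p r (y + z) = trace_sum p r y + trace_sum p r z"
  unfolding trace_sum_def sum.distrib[symmetric]
  by (intro sum.cong refl freshmans_dream') (use p in auto)

lemma trace_sum_power:
  fixes z :: "'a::field"
  assumes p: "Factorial_Ring.prime p" "CHAR('a) = p" and z: "z \<in> fixed_field (p ^ r)"
  shows "trace_sum p r (z ^ (p ^ k)) = trace_sum p r z" "trace_sum p r z ^ (p ^ k) = trace_sum p r z"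
proof -
  have F: "trace_sum p r y ^ (p ^ k) = trace_sum p r (y ^ (p ^ k))" for y :: 'a and k
  proof -
    have "trace_sum p r y ^ (p ^ k) = (\<Sum>i<r. (y ^ (p ^ i)) ^ (p ^ k))"
      unfolding trace_sum_def by (rule freshmans_dream_sum') (use p in auto)
    thus ?thesis unfolding trace_sum_def by (simp add: mult.commute flip: power_mult)
  qed
  have one: "trace_sum p r (y ^ p) = trace_sum p r y" if "y \<in> fixed_field (p ^ r)" for y :: 'a
  proof -
    have "trace_sum p r (y ^ p) = (\<Sum>i<r. y ^ (p ^ Suc i))"
      unfolding trace_sum_def by (simp flip: power_mult)
    also have "\<dots> = (\<Sum>i<Suc r. y ^ (p ^ i)) - y" by (simp only: sum.lessThan_Suc_shift) simp
    also have "\<dots> = trace_sum p r y" using that by (simp add: trace_sum_def fixed_field_def)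
    finally show ?thesis .
  qed
  show 1: "trace_sum p r (z ^ (p ^ k)) = trace_sum p r z"
  proof (induction k)
    case (Suc k)
    have "trace_sum p r ((z ^ (p ^ k)) ^ p) = trace_sum p r (z ^ (p ^ k))"
      by (rule one) (rule fixed_field_closed(5)[OF p z z])
    thus ?case using Suc by (simp add: mult.commute flip: power_mult)
  qed auto
  show "trace_sum p r z ^ (p ^ k) = trace_sum p r z" using F 1 by simp
qed

lemma trace_sum_in_prime_field:
  fixes z :: "'a::alg_closed_field"
  assumes p: "Factorial_Ring.prime p" "CHAR('a) = p" and z: "z \<in> fixed_field (p ^ r)"
  shows "trace_sum p r z \<in> (range of_nat :: 'a set)"
  using trace_sum_power(2)[OF p z, of 1] prime_field_eq_range[OF p] by (auto simp: fixed_field_def)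

text \<open>Transitivity of the trace: for z in the field with p ^ (t k) elements, the inner sum is
  the relative trace to the field with p ^ t elements.\<close>

lemma trace_sum_tower:
  fixes z :: "'a::field"
  assumes p: "Factorial_Ring.prime p" "CHAR('a) = p"
  shows "trace_sum p (t * k) z = trace_sum p t (\<Sum>j<k. z ^ ((p ^ t) ^ j))"
proof -
  have "trace_sum p t (\<Sum>j<k. z ^ ((p ^ t) ^ j)) = (\<Sum>i<t. \<Sum>j<k. (z ^ ((p ^ t) ^ j)) ^ (p ^ i))"
    unfolding trace_sum_def by (intro sum.cong refl freshmans_dream_sum') (use p in auto)
  also have "\<dots> = (\<Sum>j<k. \<Sum>i<t. z ^ (p ^ (j * t + i)))"
    by (subst sum.swap) (simp add: power_add mult.commute flip: power_mult)
  also have "\<dots> = (\<Sum>j<k. \<Sum>i\<in>{j * t..<j * t + t}. z ^ (p ^ i))"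
  proof (rule sum.cong)
    fix j
    show "(\<Sum>i<t. z ^ (p ^ (j * t + i))) = (\<Sum>i\<in>{j * t..<j * t + t}. z ^ (p ^ i))"
      by (rule sum.reindex_bij_witness[of _ "\<lambda>i. i - j * t" "\<lambda>i. j * t + i"]) auto
  qed simp
  also have "\<dots> = (\<Sum>i<k * t. z ^ (p ^ i))" by (rule sum.nat_group)
  finally show ?thesis by (simp add: trace_sum_def mult.commute)
qed

text \<open>The trace is a nonzero polynomial of degree at most p ^ (r - 1), too small to vanish at
  p ^ r elements.\<close>

lemma trace_sum_nontrivial:
  assumes p: "Factorial_Ring.prime p" "CHAR('a::alg_closed_field) = p" and r: "r \<ge> 1"
  shows "\<exists>z :: 'a. z \<in> fixed_field (p ^ r) \<and> trace_sum p r z \<noteq> 0"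
proof (rule ccontr)
  assume "\<not> ?thesis"
  hence *: "trace_sum p r z = 0" if "z \<in> fixed_field (p ^ r)" for z :: 'a using that by blast
  define h where "h = (\<Sum>i<r. Polynomial.monom (1::'a) (p ^ i))"
  have ev: "poly h z = trace_sum p r z" for z by (simp add: h_def trace_sum_def poly_sum poly_monom)
  have p1: "p > 1" using prime_gt_1_nat[OF p(1)] .
  have "Polynomial.coeff h (p ^ (r - 1)) = (\<Sum>i<r. if i = r - 1 then 1 else 0)"
    unfolding h_def coeff_sum using p1 by (intro sum.cong refl) (auto simp: coeff_monom)
  also have "\<dots> = 1" using r by simp
  finally have h0: "h \<noteq> 0" by auto
  have "Polynomial.degree h \<le> p ^ (r - 1)" unfolding h_def
  proof (intro degree_sum_le)
    fix i assume "i \<in> {..<r}"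
    hence "p ^ i \<le> p ^ (r - 1)" using p1 by (intro power_increasing) auto
    thus "Polynomial.degree (Polynomial.monom (1::'a) (p ^ i)) \<le> p ^ (r - 1)"
      using degree_monom_le order_trans by blast
  qed auto
  have "p ^ r = card (fixed_field (p ^ r) :: 'a set)" using card_fixed_field[OF p r] by simp
  also have "\<dots> \<le> card {z. poly h z = 0}"
    using * by (intro card_mono poly_roots_finite h0) (auto simp: ev)
  also have "\<dots> \<le> Polynomial.degree h" by (rule card_poly_roots_bound[OF h0])
  also have "\<dots> \<le> p ^ (r - 1)" by fact
  also have "\<dots> < p ^ r" using p1 r by (intro power_strict_increasing) auto
  finally show False by simp
qed

text \<open>The additive character of the prime field sending 1 to \<open>\<omega>\<close>. An
  element is known only as some \<open>of_nat i\<close>; when \<open>\<omega> ^ p = 1\<close>, every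
  such i yields the same value.\<close>

definition prime_char :: "complex \<Rightarrow> 'a::field \<Rightarrow> complex" where
  "prime_char \<omega> z = \<omega> ^ (LEAST i. of_nat i = z)"

lemma prime_char_of_nat:
  assumes p: "Factorial_Ring.prime p" "CHAR('a::field) = p" and w: "\<omega> ^ p = 1"
  shows "prime_char \<omega> (of_nat n :: 'a) = \<omega> ^ n"
proof -
  define i where "i = (LEAST i. of_nat i = (of_nat n :: 'a))"
  have "of_nat i = (of_nat n :: 'a)" unfolding i_def by (rule LeastI) simp
  moreover have "i \<le> n" unfolding i_def by (rule Least_le) simp
  ultimately have "p dvd n - i"
    using of_nat_eq_iff_char_dvd[of i n, where 'a='a] p(2) by (cases "i = n") auto
  then obtain k where "n - i = p * k" by (elim dvdE)
  hence "n = i + p * k" using \<open>i \<le> n\<close> by simp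
  hence "\<omega> ^ n = \<omega> ^ i" using w by (simp add: power_add power_mult)
  thus ?thesis by (simp add: prime_char_def i_def)
qed

lemma prime_char_add:
  fixes x y :: "'a::field"
  assumes p: "Factorial_Ring.prime p" "CHAR('a) = p" and w: "\<omega> ^ p = 1"
    and "x \<in> range of_nat" "y \<in> range of_nat"
  shows "prime_char \<omega> (x + y :: 'a) = prime_char \<omega> x * prime_char \<omega> y"
proof -
  obtain i j where ij: "x = of_nat i" "y = of_nat j" using assms(4,5) by auto
  have "x + y = of_nat (i + j)" by (simp add: ij)
  thus ?thesis using prime_char_of_nat[OF p w] ij by (simp only: power_add)
qed

lemma prime_char_0:
  assumes p: "Factorial_Ring.prime p" "CHAR('a::field) = p" and w: "\<omega> ^ p = 1"
  shows "prime_char \<omega> (0 :: 'a) = 1"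
  using prime_char_of_nat[OF assms, of 0] by simp

lemma prime_char_neq_1:
  fixes x :: "'a::field"
  assumes p: "Factorial_Ring.prime p" "CHAR('a) = p" and w: "\<omega> ^ p = 1" "\<omega> \<noteq> 1"
    and x: "x \<in> range of_nat" "x \<noteq> 0"
  shows "prime_char \<omega> (x :: 'a) \<noteq> 1"
proof
  assume eq: "prime_char \<omega> x = 1"
  obtain i where i: "x = of_nat i" using x by auto
  have "\<not> p dvd i" using x i p(2) by (auto simp: of_nat_eq_0_iff_char_dvd)
  hence "coprime i p" using prime_imp_coprime_nat[OF p(1)] by (simp add: coprime_commute)
  moreover have "i \<noteq> 0" using x i by (cases i) auto
  ultimately obtain j y where j: "i * j = p * y + 1" using bezout_nat[of i p] by auto
  have "\<omega> = \<omega> ^ (p * y + 1)" using w by (simp add: power_mult)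
  also have "\<dots> = (\<omega> ^ i) ^ j" by (simp only: j[symmetric] power_mult)
  also have "\<omega> ^ i = 1" using eq prime_char_of_nat[OF p w(1)] i by simp
  finally show False using w by simp
qed

definition trace_char :: "nat \<Rightarrow> complex \<Rightarrow> nat \<Rightarrow> 'a::field \<Rightarrow> complex" where
  "trace_char p \<omega> r z = prime_char \<omega> (trace_sum p r z)"

lemma trace_char_add:
  fixes x y :: "'a::alg_closed_field"
  assumes p: "Factorial_Ring.prime p" "CHAR('a) = p" and w: "\<omega> ^ p = 1"
    and "x \<in> fixed_field (p ^ r)" "y \<in> fixed_field (p ^ r)"
  shows "trace_char p \<omega> r (x + y :: 'a) = trace_char p \<omega> r x * trace_char p \<omega> r y"
  unfolding trace_char_def trace_sum_add[OF p]
  by (intro prime_char_add[OF p w] trace_sum_in_prime_field[OF p] assms)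

lemma trace_char_0:
  assumes p: "Factorial_Ring.prime p" "CHAR('a::field) = p" and w: "\<omega> ^ p = 1"
  shows "trace_char p \<omega> r (0 :: 'a) = 1"
proof -
  have "trace_sum p r (0::'a) = 0"
    using prime_gt_0_nat[OF p(1)] by (simp add: trace_sum_def power_0_left)
  thus ?thesis using prime_char_0[OF p w] by (simp add: trace_char_def)
qed

lemma trace_char_nontrivial:
  fixes u :: "'a::alg_closed_field"
  assumes p: "Factorial_Ring.prime p" "CHAR('a) = p" and w: "\<omega> ^ p = 1" "\<omega> \<noteq> 1"
    and r: "r \<ge> 1" and u: "u \<in> fixed_field (p ^ r)" "(u :: 'a) \<noteq> 0"
  obtains c where "c \<in> fixed_field (p ^ r)" "trace_char p \<omega> r (u * c) \<noteq> 1"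
proof -
  obtain z :: 'a where z: "z \<in> fixed_field (p ^ r)" "trace_sum p r z \<noteq> 0"
    using trace_sum_nontrivial[OF p r] by blast
  have "trace_char p \<omega> r (u * (inverse u * z)) \<noteq> 1"
    using u z prime_char_neq_1[OF p w trace_sum_in_prime_field[OF p z(1)] z(2)]
    by (simp add: trace_char_def flip: mult.assoc)
  moreover have "inverse u * z \<in> fixed_field (p ^ r)"
    by (rule fixed_field_closed(4)[OF p fixed_field_closed(6)[OF p u(1) u(1)] z(1)])
  ultimately show thesis using that by blast
qed

text \<open>Translation by g permutes G and multiplies the sum by \<open>\<chi> g\<close>.\<close>

lemma char_sum_zero:
  fixes \<chi> :: "'a::ab_group_add \<Rightarrow> complex"
  assumes G: "add_subgroup G" and \<chi>: "\<And>x y. x \<in> G \<Longrightarrow> y \<in> G \<Longrightarrow> \<chi> (x + y) = \<chi> x * \<chi> y"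
    and g: "g \<in> G" "\<chi> g \<noteq> 1"
  shows "(\<Sum>x\<in>G. \<chi> x) = 0"
proof -
  have "(\<Sum>x\<in>G. \<chi> x) = (\<Sum>x\<in>G. \<chi> (x + g))"
    using G g by (intro sum.reindex_bij_witness[of _ "\<lambda>x. x + g" "\<lambda>x. x - g"]) (auto simp: add_subgroup_def)
  also have "\<dots> = (\<Sum>x\<in>G. \<chi> x) * \<chi> g" using \<chi> g(1) by (simp add: sum_distrib_right)
  finally have "(\<Sum>x\<in>G. \<chi> x) * (\<chi> g - 1) = 0" by (simp add: algebra_simps)
  thus ?thesis using g(2) by simp
qed

subsection \<open>The L-series of an additive character of a polynomial\<close>

definition psum :: "nat \<Rightarrow> 'a::field poly \<Rightarrow> 'a" where
  "psum l h = (\<Sum>a\<in>#proots h. a ^ l)"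

text \<open>Roots count with multiplicity, so products of polynomials go to sums. An additive
  character of this value is thus completely multiplicative in h, which is what an L-series
  needs.\<close>

definition root_sum :: "'a::field poly \<Rightarrow> 'a poly \<Rightarrow> 'a" where
  "root_sum g h = (\<Sum>a\<in>#proots h. poly g a)"

definition monics :: "'a::field set \<Rightarrow> nat \<Rightarrow> 'a poly set" where
  "monics B n = {h. Polynomial.lead_coeff h = 1 \<and> Polynomial.degree h = n \<and> (\<forall>i. Polynomial.coeff h i \<in> B)}"

text \<open>The logarithmic derivative of a product of factors 1 - a T is a sum of geometric
  series.\<close>

lemma newton_fps:
  fixes A :: "'a::field multiset"
  defines "E \<equiv> (\<lambda>A. \<Prod>a\<in>#A. 1 - fps_const a * fps_X)"
  shows "- (fps_X * fps_deriv (E A)) = E A * Abs_fps (\<lambda>n. if n = 0 then 0 else \<Sum>a\<in>#A. a ^ n)"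
proof (induction A)
  case empty
  have "Abs_fps (\<lambda>n. if n = 0 then 0 else \<Sum>a\<in>#{#}. a ^ n :: 'a) = 0" by (rule fps_ext) simp
  thus ?case by (simp add: E_def)
next
  case (add b A)
  define S where "S = (\<lambda>A. Abs_fps (\<lambda>n. if n = 0 then 0 else \<Sum>a\<in>#A. a ^ n :: 'a))"
  define s where "s = Abs_fps (\<lambda>n. if n = 0 then 0 else b ^ n)"
  have s: "(1 - fps_const b * fps_X) * s = fps_const b * fps_X"
  proof (rule fps_ext)
    fix n
    show "((1 - fps_const b * fps_X) * s) $ n = (fps_const b * fps_X) $ n"
      by (cases n) (auto simp: s_def left_diff_distrib mult.assoc fps_X_nth)
  qed
  have SE: "S (add_mset b A) = s + S A" by (rule fps_ext) (simp add: S_def s_def)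
  have EE: "E (add_mset b A) = (1 - fps_const b * fps_X) * E A" by (simp add: E_def)
  have IH: "fps_X * fps_deriv (E A) = - (E A * S A)" using add unfolding S_def by (metis minus_minus)
  have "- (fps_X * fps_deriv (E (add_mset b A))) =
      fps_const b * fps_X * E A - (1 - fps_const b * fps_X) * (fps_X * fps_deriv (E A))"
    unfolding EE by (simp add: algebra_simps)
  also have "\<dots> = E A * ((1 - fps_const b * fps_X) * s) + (1 - fps_const b * fps_X) * (E A * S A)"
    unfolding s IH by (simp add: algebra_simps)
  also have "\<dots> = E (add_mset b A) * S (add_mset b A)" unfolding EE SE by (simp add: algebra_simps)
  finally show ?case by (simp add: S_def)
qed

text \<open>The reversed polynomial is the product of the 1 - a T over the roots, so
  \<open>e i\<close> is the i-th elementary symmetric function with its sign.\<close>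

lemma newton_identity:
  fixes h :: "'a::alg_closed_field poly"
  assumes h: "Polynomial.lead_coeff h = 1" and n: "n \<ge> 1"
  defines "e \<equiv> Polynomial.coeff (reflect_poly h)"
  shows "psum n h = - of_nat n * e n - (\<Sum>i\<in>{1..<n}. e i * psum (n - i) h)"
proof -
  define A where "A = proots h"
  have h0: "h \<noteq> 0" using h by auto
  have "h = Polynomial.smult (Polynomial.lead_coeff h) (\<Prod>a\<in>#A. [:- a, 1:])"
    unfolding A_def by (rule proots_alg_closed[OF h0])
  hence hA: "h = (\<Prod>a\<in>#A. [:- a, 1:])" using h by simp
  have lin: "fps_of_poly (reflect_poly [:- a, 1:]) = 1 - fps_const a * fps_X" for a :: 'a
  proof (rule fps_ext)
    fix n show "fps_of_poly (reflect_poly [:- a, 1:]) $ n = (1 - fps_const a * fps_X) $ n"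
      by (cases n; cases "n - 1") (auto simp: coeff_reflect_poly fps_X_def)
  qed
  have "fps_of_poly (reflect_poly (\<Prod>a\<in>#B. [:- a, 1:])) = (\<Prod>a\<in>#B. 1 - fps_const a * fps_X)" for B :: "'a multiset"
    by (induction B) (simp_all add: reflect_poly_mult fps_of_poly_mult lin del: mult_pCons_left)
  hence E: "fps_of_poly (reflect_poly h) = (\<Prod>a\<in>#A. 1 - fps_const a * fps_X)" by (subst hA) simp
  have "- (fps_X * fps_deriv (fps_of_poly (reflect_poly h))) $ n =
      (fps_of_poly (reflect_poly h) * Abs_fps (\<lambda>n. if n = 0 then 0 else \<Sum>a\<in>#A. a ^ n)) $ n"
    unfolding E newton_fps[symmetric] by simp
  moreover have "(fps_X * fps_deriv F) $ n = of_nat n * F $ n" for F :: "'a fps" by (cases n) auto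
  ultimately have "- (of_nat n * e n) = (\<Sum>i = 0..n. e i * (if n - i = 0 then 0 else psum (n - i) h))"
    unfolding psum_def A_def[symmetric] by (simp add: fps_mult_nth[of "fps_of_poly (reflect_poly h)"] e_def)
  also have "\<dots> = (\<Sum>i\<in>insert 0 {1..<n}. e i * (if n - i = 0 then 0 else psum (n - i) h))"
    by (rule sum.mono_neutral_right) (use n in auto)
  also have "\<dots> = e 0 * psum n h + (\<Sum>i\<in>{1..<n}. e i * (if n - i = 0 then 0 else psum (n - i) h))"
    using n by simp
  also have "(\<Sum>i\<in>{1..<n}. e i * (if n - i = 0 then 0 else psum (n - i) h)) = (\<Sum>i\<in>{1..<n}. e i * psum (n - i) h)"
    by (rule sum.cong) auto
  also have "e 0 = 1" using h by (simp add: e_def)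
  finally show ?thesis by (simp add: algebra_simps)
qed

text \<open>The roots may lie outside the field, but Newton's identities build their power sums from
  the coefficients by ring operations, without division.\<close>

lemma psum_in_fixed_field:
  fixes h :: "'a::alg_closed_field poly"
  assumes p: "Factorial_Ring.prime p" "CHAR('a) = p" and h: "h \<in> monics (fixed_field (p ^ r)) n"
  shows "psum l h \<in> fixed_field (p ^ r)"
proof (induction l rule: less_induct)
  case (less l)
  have e: "Polynomial.coeff (reflect_poly h) i \<in> fixed_field (p ^ r)" for i
    using h fixed_field_0_1[OF p(1)] by (auto simp: coeff_reflect_poly monics_def)
  show ?case
  proof (cases "l = 0")
    case True
    have "psum l h = of_nat (size (proots h))" unfolding True psum_def by (simp add: sum_mset_constant)
    thus ?thesis using fixed_field_of_nat[OF p] by simp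
  next
    case False
    hence "psum l h = - of_nat l * Polynomial.coeff (reflect_poly h) l
        - (\<Sum>i\<in>{1..<l}. Polynomial.coeff (reflect_poly h) i * psum (l - i) h)"
      using h by (intro newton_identity) (auto simp: monics_def)
    moreover have "(\<Sum>i\<in>{1..<l}. Polynomial.coeff (reflect_poly h) i * psum (l - i) h) \<in> fixed_field (p ^ r)"
      by (rule fixed_field_sum[OF p], rule fixed_field_closed(4)[OF p e], rule less) auto
    moreover have "- of_nat l * Polynomial.coeff (reflect_poly h) l \<in> fixed_field (p ^ r)"
      by (rule fixed_field_closed(4)[OF p _ e], rule fixed_field_closed(3)[OF p]) (rule fixed_field_of_nat[OF p])+
    ultimately show ?thesis using fixed_field_closed(2)[OF p] by simp
  qed
qed

lemma root_sum_psum: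
  "root_sum g h = (\<Sum>l\<le>Polynomial.degree g. Polynomial.coeff g l * psum l h)"
proof -
  have "(\<Sum>a\<in>#A. poly g a) = (\<Sum>l\<le>Polynomial.degree g. Polynomial.coeff g l * (\<Sum>a\<in>#A. a ^ l))" for A
    by (induction A) (simp_all add: poly_altdef sum.distrib algebra_simps)
  thus ?thesis by (simp add: root_sum_def psum_def)
qed

lemma root_sum_in_fixed_field:
  fixes h :: "'a::alg_closed_field poly"
  assumes p: "Factorial_Ring.prime p" "CHAR('a) = p" and h: "h \<in> monics (fixed_field (p ^ r)) n"
    and g: "\<And>i. Polynomial.coeff g i \<in> fixed_field (p ^ r)"
  shows "root_sum g h \<in> fixed_field (p ^ r)"
  unfolding root_sum_psum
  by (intro fixed_field_sum[OF p] fixed_field_closed(4)[OF p] g psum_in_fixed_field[OF p h])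

lemma root_sum_mult:
  "h \<noteq> 0 \<Longrightarrow> k \<noteq> 0 \<Longrightarrow> root_sum g (h * k) = root_sum g h + root_sum g k"
  by (simp add: root_sum_def proots_mult)

text \<open>The coefficient of X^(n-d) is, up to sign, the d-th elementary symmetric function of the
  roots. It enters no power sum of index below d, and the one of index d with the factor -
  d.\<close>

lemma root_sum_add_monom:
  fixes h :: "'a::alg_closed_field poly" and c :: 'a
  assumes h: "Polynomial.lead_coeff h = 1" "Polynomial.degree h = n"
    and d: "d = Polynomial.degree g" "1 \<le> d" "d \<le> n"
  defines "h' \<equiv> h + Polynomial.monom c (n - d)"
  shows "Polynomial.lead_coeff h' = 1" "Polynomial.degree h' = n"
    "root_sum g h' = root_sum g h - Polynomial.coeff g d * of_nat d * c"
proof -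
  have "Polynomial.degree (Polynomial.monom c (n - d)) < n"
    using degree_monom_le[of c "n - d"] d by linarith
  thus deg: "Polynomial.degree h' = n" using h unfolding h'_def by (simp add: degree_add_eq_left)
  have "Polynomial.coeff h' n = Polynomial.coeff h n" using d by (simp add: h'_def)
  thus lc: "Polynomial.lead_coeff h' = 1" using h deg by simp
  have e: "Polynomial.coeff (reflect_poly h') i = Polynomial.coeff (reflect_poly h) i + (if i = d then c else 0)"
    if "i \<le> d" for i
    using that d h deg by (auto simp: coeff_reflect_poly h'_def)
  have same: "psum l h' = psum l h" if "l < d" for l
    using that
  proof (induction l rule: less_induct)
    case (less l)
    show ?case
    proof (cases "l = 0")
      case True
      have "h \<noteq> 0" "h' \<noteq> 0" using h lc by auto
      thus ?thesis unfolding True psum_def by (simp add: sum_mset_constant proots_alg_closed h deg)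
    next
      case False
      have "(\<Sum>i\<in>{1..<l}. Polynomial.coeff (reflect_poly h') i * psum (l - i) h') =
          (\<Sum>i\<in>{1..<l}. Polynomial.coeff (reflect_poly h) i * psum (l - i) h)"
        using less e by (intro sum.cong) auto
      thus ?thesis using newton_identity[OF lc, of l] newton_identity[OF h(1), of l] False e[of l] less.prems by simp
    qed
  qed
  have "(\<Sum>i\<in>{1..<d}. Polynomial.coeff (reflect_poly h') i * psum (d - i) h') =
      (\<Sum>i\<in>{1..<d}. Polynomial.coeff (reflect_poly h) i * psum (d - i) h)"
    using same e by (intro sum.cong) auto
  hence pd': "psum d h' = - of_nat d * (Polynomial.coeff (reflect_poly h) d + c)
      - (\<Sum>i\<in>{1..<d}. Polynomial.coeff (reflect_poly h) i * psum (d - i) h)"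
    using newton_identity[OF lc, of d] d(2) e[of d] by simp
  have pd: "psum d h' = psum d h - of_nat d * c"
    unfolding pd' newton_identity[OF h(1) d(2)] by (simp add: algebra_simps)
  have dd: "{..Polynomial.degree g} = insert d {..<d}" using d by auto
  have low: "(\<Sum>l<d. Polynomial.coeff g l * psum l h') = (\<Sum>l<d. Polynomial.coeff g l * psum l h)"
    using same by (intro sum.cong) auto
  thus "root_sum g h' = root_sum g h - Polynomial.coeff g d * of_nat d * c"
    unfolding root_sum_psum dd by (simp add: pd low right_diff_distrib mult.assoc)
qed

text \<open>The coefficient of T^n in the L-series of the character: monic polynomials of degree n
  are the effective divisors of degree n on the affine line.\<close>

definition monic_char_sum :: "nat \<Rightarrow> complex \<Rightarrow> nat \<Rightarrow> 'a::field poly \<Rightarrow> nat \<Rightarrow> complex" where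
  "monic_char_sum p \<omega> t g n = (\<Sum>h\<in>monics (fixed_field (p ^ t)) n. trace_char p \<omega> t (root_sum g h))"

text \<open>Adding c X^(n-d) permutes the monic polynomials of degree n and multiplies each term by
  the character at \<open>u * c\<close>, where u is - d times the leading coefficient of g. Since p
  does not divide d, u is nonzero, so some c makes this factor differ from 1.\<close>

lemma monic_char_sum_eq_0:
  fixes g :: "'a::alg_closed_field poly"
  assumes p: "Factorial_Ring.prime p" "CHAR('a) = p" and w: "\<omega> ^ p = 1" "\<omega> \<noteq> 1" and t: "t \<ge> 1"
    and g: "\<And>i. Polynomial.coeff g i \<in> fixed_field (p ^ t)"
    and d: "d = Polynomial.degree g" "1 \<le> d" "\<not> p dvd d" "d \<le> n"
  shows "monic_char_sum p \<omega> t g n = 0"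
proof -
  define B where "B = (fixed_field (p ^ t) :: 'a set)"
  define u where "u = - (Polynomial.coeff g d * of_nat d)"
  have "(of_nat d :: 'a) \<noteq> 0" using d(3) p(2) by (simp add: of_nat_eq_0_iff_char_dvd)
  moreover have "Polynomial.coeff g d \<noteq> 0" using d by auto
  ultimately have u: "u \<noteq> 0" "u \<in> fixed_field (p ^ t)"
    unfolding u_def using fixed_field_closed(4)[OF p g fixed_field_of_nat[OF p]]
    by (auto intro: fixed_field_closed(3)[OF p])
  obtain c where c: "c \<in> fixed_field (p ^ t)" "trace_char p \<omega> t (u * c) \<noteq> 1"
    using trace_char_nontrivial[OF p w t u(2,1)] .
  have mem: "h + Polynomial.monom b (n - d) \<in> monics B n" if "h \<in> monics B n" "b \<in> B" for h b
    using that root_sum_add_monom(1,2)[of h n d g b] d fixed_field_closed(1)[OF p] unfolding B_def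
    by (auto simp: monics_def)
  have mc: "- c \<in> B" using c(1) fixed_field_closed(3)[OF p] by (auto simp: B_def)
  have "monic_char_sum p \<omega> t g n = (\<Sum>h\<in>monics B n. trace_char p \<omega> t (root_sum g (h + Polynomial.monom c (n - d))))"
    unfolding monic_char_sum_def B_def[symmetric]
  proof (rule sum.reindex_bij_witness[of _ "\<lambda>h. h + Polynomial.monom c (n - d)" "\<lambda>h. h + Polynomial.monom (- c) (n - d)"])
    fix h assume "h \<in> monics B n"
    thus "h + Polynomial.monom (- c) (n - d) \<in> monics B n" "h + Polynomial.monom c (n - d) \<in> monics B n"
      using mem mc c(1) by (auto simp: B_def)
  qed (simp_all add: add.assoc flip: minus_monom)
  also have "\<dots> = (\<Sum>h\<in>monics B n. trace_char p \<omega> t (u * c) * trace_char p \<omega> t (root_sum g h))"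
  proof (rule sum.cong)
    fix h assume h: "h \<in> monics B n"
    hence "Polynomial.lead_coeff h = 1" "Polynomial.degree h = n" by (auto simp: monics_def)
    from root_sum_add_monom(3)[OF this d(1,2,4), of c]
    have "root_sum g (h + Polynomial.monom c (n - d)) = u * c + root_sum g h" by (simp add: u_def)
    moreover have "root_sum g h \<in> fixed_field (p ^ t)"
      using root_sum_in_fixed_field[OF p _ g] h by (auto simp: B_def)
    ultimately show "trace_char p \<omega> t (root_sum g (h + Polynomial.monom c (n - d))) =
        trace_char p \<omega> t (u * c) * trace_char p \<omega> t (root_sum g h)"
      using trace_char_add[OF p w(1) fixed_field_closed(4)[OF p u(2) c(1)]] by simp
  qed simp
  also have "\<dots> = trace_char p \<omega> t (u * c) * monic_char_sum p \<omega> t g n"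
    by (simp add: monic_char_sum_def B_def sum_distrib_left)
  finally have "(trace_char p \<omega> t (u * c) - 1) * monic_char_sum p \<omega> t g n = 0" by (simp add: algebra_simps)
  thus ?thesis using c(2) by simp
qed

section \<open>Frobenius and conjugate roots\<close>

definition frob_poly :: "nat \<Rightarrow> 'a::field poly \<Rightarrow> 'a poly" where
  "frob_poly N h = map_poly (\<lambda>c. c ^ N) h"

lemma coeff_frob_poly: "N > 0 \<Longrightarrow> Polynomial.coeff (frob_poly N h) i = Polynomial.coeff h i ^ N"
  by (simp add: frob_poly_def coeff_map_poly)

lemma frob_poly_mult:
  fixes h k :: "'a::field poly"
  assumes p: "Factorial_Ring.prime p" "CHAR('a) = p"
  shows "frob_poly (p ^ r) (h * k) = frob_poly (p ^ r) h * frob_poly (p ^ r) k"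
proof (rule poly_eqI)
  fix n
  have pos: "p ^ r > 0" using prime_gt_0_nat[OF p(1)] by simp
  have "(\<Sum>i\<le>n. Polynomial.coeff h i * Polynomial.coeff k (n - i)) ^ (p ^ r) =
      (\<Sum>i\<le>n. (Polynomial.coeff h i * Polynomial.coeff k (n - i)) ^ (p ^ r))"
    by (rule freshmans_dream_sum') (use p in auto)
  thus "Polynomial.coeff (frob_poly (p ^ r) (h * k)) n = Polynomial.coeff (frob_poly (p ^ r) h * frob_poly (p ^ r) k) n"
    by (simp add: coeff_frob_poly[OF pos] coeff_mult power_mult_distrib)
qed

lemma frob_poly_power_prod:
  fixes h :: "'a::field poly"
  assumes p: "Factorial_Ring.prime p" "CHAR('a) = p"
  shows "frob_poly (p ^ r) (h ^ n) = frob_poly (p ^ r) h ^ n"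
    "frob_poly (p ^ r) (\<Prod>i\<in>I. f i :: 'a poly) = (\<Prod>i\<in>I. frob_poly (p ^ r) (f i))"
proof -
  have 1: "frob_poly (p ^ r) 1 = (1 :: 'a poly)" by (simp add: frob_poly_def)
  show "frob_poly (p ^ r) (h ^ n) = frob_poly (p ^ r) h ^ n"
    by (induction n) (simp_all add: 1 frob_poly_mult[OF p])
  show "frob_poly (p ^ r) (\<Prod>i\<in>I. f i :: 'a poly) = (\<Prod>i\<in>I. frob_poly (p ^ r) (f i))"
    by (induction I rule: infinite_finite_induct) (simp_all add: 1 frob_poly_mult[OF p])
qed

lemma frob_poly_linear:
  fixes a :: "'a::field"
  assumes p: "Factorial_Ring.prime p" "CHAR('a) = p"
  shows "frob_poly (p ^ r) [:- a, 1:] = [:- (a ^ (p ^ r)), 1:]"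
proof -
  have pos: "p ^ r > 0" using prime_gt_0_nat[OF p(1)] by simp
  have "(- a + a) ^ (p ^ r) = (- a) ^ (p ^ r) + a ^ (p ^ r)" by (rule freshmans_dream') (use p in auto)
  hence "(- a) ^ (p ^ r) + a ^ (p ^ r) = 0" using prime_gt_0_nat[OF p(1)] by (simp add: power_0_left)
  hence "(- a) ^ (p ^ r) = - (a ^ (p ^ r))" by (simp only: eq_neg_iff_add_eq_0)
  thus ?thesis using pos by (simp add: frob_poly_def map_poly_pCons)
qed

lemma frob_poly_eq_iff:
  "N > 0 \<Longrightarrow> frob_poly N h = h \<longleftrightarrow> (\<forall>i. Polynomial.coeff h i \<in> fixed_field N)"
  by (simp add: poly_eq_iff coeff_frob_poly fixed_field_def)

text \<open>Frobenius fixes h and sends X - b to X - b^(p^r), so multiplicities cannot drop along an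
  orbit.\<close>

lemma order_frobenius:
  fixes h :: "'a::field poly"
  assumes p: "Factorial_Ring.prime p" "CHAR('a) = p" and h: "h \<noteq> 0" "frob_poly (p ^ r) h = h"
  shows "Polynomial.order a h \<le> Polynomial.order (a ^ ((p ^ r) ^ j)) h"
proof (induction j)
  case (Suc j)
  define b where "b = a ^ ((p ^ r) ^ j)"
  obtain k where k: "h = [:- b, 1:] ^ Polynomial.order b h * k" using order_1[of b h] by (elim dvdE)
  have "frob_poly (p ^ r) h = [:- (b ^ (p ^ r)), 1:] ^ Polynomial.order b h * frob_poly (p ^ r) k"
    by (subst k) (simp only: frob_poly_mult[OF p] frob_poly_power_prod[OF p] frob_poly_linear[OF p])
  hence "h = [:- (b ^ (p ^ r)), 1:] ^ Polynomial.order b h * frob_poly (p ^ r) k" by (simp only: h(2))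
  hence "[:- (b ^ (p ^ r)), 1:] ^ Polynomial.order b h dvd h" by (metis dvd_triv_left)
  hence "Polynomial.order b h \<le> Polynomial.order (b ^ (p ^ r)) h" using h(1) order_divides by blast
  also have "b ^ (p ^ r) = a ^ ((p ^ r) ^ Suc j)" by (simp add: b_def mult.commute flip: power_mult)
  finally show ?case using Suc b_def by simp
qed auto

text \<open>For a in the field with N^k elements, the characteristic polynomial of a over the field
  with N elements, that is, a power of the minimal polynomial.\<close>

definition conj_poly :: "nat \<Rightarrow> 'a::field \<Rightarrow> nat \<Rightarrow> 'a poly" where
  "conj_poly N a k = (\<Prod>j<k. [:- (a ^ (N ^ j)), 1:])"

lemma conj_poly_basic:
  shows "Polynomial.lead_coeff (conj_poly N a k) = 1" "conj_poly N a k \<noteq> 0"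
    "Polynomial.degree (conj_poly N a k) = k"
    "proots (conj_poly N a k) = image_mset (\<lambda>j. a ^ (N ^ j)) (mset_set {..<k})"
proof -
  show lc: "Polynomial.lead_coeff (conj_poly N a k) = 1"
    unfolding conj_poly_def by (simp add: lead_coeff_prod)
  thus nz: "conj_poly N a k \<noteq> 0" by auto
  show "proots (conj_poly N a k) = image_mset (\<lambda>j. a ^ (N ^ j)) (mset_set {..<k})"
  proof (induction k)
    case (Suc k)
    have "(\<Prod>j<k. [:- (a ^ (N ^ j)), 1:]) \<noteq> 0" by (simp add: prod_zero_iff)
    thus ?case using Suc
      by (simp add: conj_poly_def lessThan_Suc proots_mult del: mult_pCons_left mult_pCons_right)
  qed (simp add: conj_poly_def)
  show "Polynomial.degree (conj_poly N a k) = k"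
    unfolding conj_poly_def by (subst degree_prod_eq_sum_degree) auto
qed

lemma conj_poly_in_monics:
  fixes a :: "'a::field"
  assumes p: "Factorial_Ring.prime p" "CHAR('a) = p" and a: "a \<in> fixed_field ((p ^ t) ^ k)"
  shows "conj_poly (p ^ t) a k \<in> monics (fixed_field (p ^ t)) k"
proof -
  have pos: "p ^ t > 0" using prime_gt_0_nat[OF p(1)] by simp
  have "frob_poly (p ^ t) (conj_poly (p ^ t) a k) = (\<Prod>j<k. [:- (a ^ ((p ^ t) ^ Suc j)), 1:])"
    unfolding conj_poly_def frob_poly_power_prod[OF p] frob_poly_linear[OF p]
    by (simp add: mult.commute flip: power_mult)
  also have "\<dots> = conj_poly (p ^ t) a k"
  proof (cases k)
    case (Suc m)
    have "(\<Prod>j<Suc m. [:- (a ^ ((p ^ t) ^ Suc j)), 1:]) =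
        (\<Prod>j<m. [:- (a ^ ((p ^ t) ^ Suc j)), 1:]) * [:- a, 1:]"
      using a Suc by (simp add: fixed_field_def)
    also have "\<dots> = (\<Prod>j<Suc m. [:- (a ^ ((p ^ t) ^ j)), 1:])"
      by (subst prod.lessThan_Suc_shift) (simp add: mult.commute del: mult_pCons_left mult_pCons_right)
    finally show ?thesis by (simp add: Suc conj_poly_def del: mult_pCons_left mult_pCons_right prod.lessThan_Suc)
  qed (simp add: conj_poly_def)
  finally show ?thesis using frob_poly_eq_iff[OF pos] conj_poly_basic by (auto simp: monics_def)
qed

lemma monic_dvd_iff_proots:
  fixes h k :: "'a::alg_closed_field poly"
  assumes "Polynomial.lead_coeff k = 1" "h \<noteq> 0"
  shows "k dvd h \<longleftrightarrow> proots k \<subseteq># proots h"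
proof
  assume "k dvd h"
  then obtain m where m: "h = k * m" by (elim dvdE)
  have "k \<noteq> 0" "m \<noteq> 0" using m assms by auto
  thus "proots k \<subseteq># proots h" by (simp add: m proots_mult)
next
  assume sub: "proots k \<subseteq># proots h"
  have "k \<noteq> 0" using assms by auto
  from proots_alg_closed(1)[OF this] have "k = (\<Prod>a\<in>#proots k. [:- a, 1:])" using assms by simp
  also have "\<dots> dvd (\<Prod>a\<in>#proots h. [:- a, 1:])"
    by (intro prod_mset_subset_imp_dvd image_mset_subseteq_mono sub)
  also have "\<dots> dvd Polynomial.smult (Polynomial.lead_coeff h) \<dots>" by (simp add: dvd_smult)
  also have "\<dots> = h" using proots_alg_closed(1)[OF assms(2)] ..
  finally show "k dvd h" .
qed

text \<open>In the finite set Y two members of the orbit must agree, and injectivity of Frobenius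
  cancels what they have in common. The period m is the degree of a over the field with p ^ t
  elements.\<close>

lemma frobenius_period:
  fixes a :: "'a::field"
  assumes p: "Factorial_Ring.prime p" "CHAR('a) = p" and fin: "finite Y" "\<And>j. a ^ ((p ^ t) ^ j) \<in> Y"
  obtains m where "m \<ge> 1" "\<And>k. a \<in> fixed_field ((p ^ t) ^ k) \<longleftrightarrow> m dvd k"
    "\<And>i j. a ^ ((p ^ t) ^ i) = a ^ ((p ^ t) ^ j) \<Longrightarrow> i mod m = j mod m"
proof -
  define R where "R = p ^ t"
  have cancel: "a ^ (R ^ (j - i)) = a" if "a ^ (R ^ i) = a ^ (R ^ j)" "i \<le> j" for i j
  proof -
    have "(a ^ (R ^ (j - i))) ^ (p ^ (t * i)) = a ^ (R ^ j)"
      using that(2) by (simp add: R_def flip: power_mult power_add)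
        (metis diff_add_inverse2 le_add_diff_inverse2 distrib_left mult.commute)
    also have "\<dots> = a ^ (p ^ (t * i))" using that(1) by (simp add: R_def power_mult)
    finally show ?thesis by (rule frobenius_inj[OF p])
  qed
  have "\<not> inj (\<lambda>j. a ^ (R ^ j))"
    using fin finite_imageD[of "\<lambda>j. a ^ (R ^ j)" "UNIV :: nat set"] finite_subset[of "range (\<lambda>j. a ^ (R ^ j))" Y]
    unfolding R_def by auto
  then obtain i j where "i < j" "a ^ (R ^ i) = a ^ (R ^ j)"
    by (metis (mono_tags, lifting) injI linorder_neqE_nat)
  hence ex: "\<exists>m\<ge>1. a ^ (R ^ m) = a" using cancel[of i j] by (intro exI[of _ "j - i"]) auto
  define m where "m = (LEAST m. m \<ge> 1 \<and> a ^ (R ^ m) = a)"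
  have m: "m \<ge> 1" "a ^ (R ^ m) = a" using LeastI_ex[OF ex] unfolding m_def by auto
  have least: "r = 0" if "a ^ (R ^ r) = a" "r < m" for r
    using not_less_Least[of r "\<lambda>m. m \<ge> 1 \<and> a ^ (R ^ m) = a"] that unfolding m_def by (cases r) auto
  have mult: "a ^ (R ^ (m * k)) = a" for k
  proof (induction k)
    case (Suc k)
    have "a ^ (R ^ (m * Suc k)) = (a ^ (R ^ m)) ^ (R ^ (m * k))" by (simp add: power_add power_mult)
    thus ?case using Suc m by simp
  qed auto
  have iff: "a ^ (R ^ k) = a \<longleftrightarrow> m dvd k" for k
  proof
    assume k: "a ^ (R ^ k) = a"
    have "a ^ (R ^ k) = (a ^ (R ^ (m * (k div m)))) ^ (R ^ (k mod m))"
      by (simp flip: power_mult power_add)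
    hence "a ^ (R ^ (k mod m)) = a" using mult k by simp
    hence "k mod m = 0" using m(1) by (intro least) auto
    thus "m dvd k" by auto
  qed (use mult in auto)
  show thesis
  proof
    show "a \<in> fixed_field ((p ^ t) ^ k) \<longleftrightarrow> m dvd k" for k using iff by (simp add: fixed_field_def R_def)
    fix i j assume ij: "a ^ ((p ^ t) ^ i) = a ^ ((p ^ t) ^ j)"
    show "i mod m = j mod m"
    proof (cases "i \<le> j")
      case True
      hence "m dvd j - i" using cancel[of i j] ij iff by (simp add: R_def)
      thus ?thesis using True by (metis mod_eq_dvd_iff_nat)
    next
      case False
      hence "m dvd i - j" using cancel[of j i] ij iff by (simp add: R_def)
      thus ?thesis using False by (metis mod_eq_dvd_iff_nat nat_le_linear)
    qed
  qed (use m in auto)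
qed

text \<open>Let m be the degree of a. Only for multiples k = m i does a lie in the extension of
  degree k. The conjugate polynomial is then the i-th power of the minimal polynomial, which divides
  h exactly for i up to the multiplicity of a.\<close>

lemma card_conj_dvd_root:
  fixes h :: "'a::alg_closed_field poly"
  assumes p: "Factorial_Ring.prime p" "CHAR('a) = p" and h: "h \<in> monics (fixed_field (p ^ t)) n"
    and a: "poly h a = 0"
  shows "card {k\<in>{1..n}. a \<in> fixed_field ((p ^ t) ^ k) \<and> conj_poly (p ^ t) a k dvd h} = Polynomial.order a h"
proof -
  define R where "R = p ^ t"
  have pos: "p ^ t > 0" using prime_gt_0_nat[OF p(1)] by simp
  have h0: "h \<noteq> 0" using h by (auto simp: monics_def)
  have fr: "frob_poly (p ^ t) h = h" using h frob_poly_eq_iff[OF pos] by (auto simp: monics_def)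
  have ord: "Polynomial.order a h \<le> Polynomial.order (a ^ (R ^ j)) h" for j
    unfolding R_def by (rule order_frobenius[OF p h0 fr])
  have "Polynomial.order a h \<noteq> 0" using a h0 by (simp add: order_root)
  hence "poly h (a ^ (R ^ j)) = 0" for j using ord[of j] h0 by (simp add: order_root)
  then obtain m where m: "m \<ge> 1" "\<And>k. a \<in> fixed_field (R ^ k) \<longleftrightarrow> m dvd k"
      "\<And>i j. a ^ (R ^ i) = a ^ (R ^ j) \<Longrightarrow> i mod m = j mod m"
    using frobenius_period[OF p poly_roots_finite[OF h0], of a t] unfolding R_def by auto
  have cnt: "count (proots (conj_poly R a k)) b = card {j\<in>{..<k}. a ^ (R ^ j) = b}" for k b
    unfolding conj_poly_basic by (simp add: count_image_mset Int_def conj_commute)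
  have "{k\<in>{1..n}. a \<in> fixed_field (R ^ k) \<and> conj_poly R a k dvd h} = (\<lambda>i. m * i) ` {1..Polynomial.order a h}"
  proof (intro Set.set_eqI iffI)
    fix k assume "k \<in> {k\<in>{1..n}. a \<in> fixed_field (R ^ k) \<and> conj_poly R a k dvd h}"
    hence k: "k \<ge> 1" "m dvd k" "conj_poly R a k dvd h" using m(2) by auto
    obtain i where i: "k = m * i" using k(2) by (elim dvdE)
    have "a ^ (R ^ (m * i')) = a" for i' using m(2)[of "m * i'"] by (simp add: fixed_field_def)
    hence "(\<lambda>i'. m * i') ` {..<i} \<subseteq> {j\<in>{..<k}. a ^ (R ^ j) = a}" using m(1) i by auto
    hence "card ((\<lambda>i'. m * i') ` {..<i}) \<le> count (proots (conj_poly R a k)) a"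
      unfolding cnt by (intro card_mono) auto
    also have "card ((\<lambda>i'. m * i') ` {..<i}) = i" using m(1) by (subst card_image) (auto simp: inj_on_def)
    also have "count (proots (conj_poly R a k)) a \<le> count (proots h) a"
      using k(3) monic_dvd_iff_proots[OF _ h0] conj_poly_basic(1) by (intro mset_subset_eq_count) blast
    finally have "i \<le> Polynomial.order a h" using h0 by simp
    moreover have "1 \<le> i" using i k(1) by (cases i) auto
    ultimately show "k \<in> (\<lambda>i. m * i) ` {1..Polynomial.order a h}"
      using i by (intro image_eqI[of _ _ i]) auto
  next
    fix k assume "k \<in> (\<lambda>i. m * i) ` {1..Polynomial.order a h}"
    then obtain i where "k = m * i" "i \<in> {1..Polynomial.order a h}" by (elim imageE)
    hence i: "k = m * i" "1 \<le> i" "i \<le> Polynomial.order a h" by auto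
    have "count (proots (conj_poly R a k)) b \<le> count (proots h) b" for b
    proof (cases "\<exists>j0. b = a ^ (R ^ j0)")
      case True
      then obtain j0 where j0: "b = a ^ (R ^ j0)" by blast
      \<comment> \<open>Indices of equal conjugates agree modulo m, so each block of m consecutive
        indices holds at most one of them.\<close>
      have "inj_on (\<lambda>j. j div m) {j\<in>{..<k}. a ^ (R ^ j) = b}"
      proof (rule inj_onI)
        fix x y assume xy: "x \<in> {j\<in>{..<k}. a ^ (R ^ j) = b}" "y \<in> {j\<in>{..<k}. a ^ (R ^ j) = b}" "x div m = y div m"
        hence "x mod m = y mod m" using m(3) by auto
        thus "x = y" using xy(3) by (metis div_mult_mod_eq)
      qed
      moreover have "(\<lambda>j. j div m) ` {j\<in>{..<k}. a ^ (R ^ j) = b} \<subseteq> {..<i}"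
        using m(1) by (auto simp: i less_mult_imp_div_less mult.commute)
      ultimately have "card {j\<in>{..<k}. a ^ (R ^ j) = b} \<le> card {..<i}"
        by (intro card_inj_on_le) auto
      also have "\<dots> \<le> Polynomial.order b h" using i ord[of j0] j0 by simp
      finally show ?thesis using h0 by (simp add: cnt)
    next
      case False
      hence "{j\<in>{..<k}. a ^ (R ^ j) = b} = {}" by auto
      thus ?thesis by (simp only: cnt card.empty)
    qed
    hence "proots (conj_poly R a k) \<subseteq># proots h" by (rule mset_subset_eqI)
    hence dvd: "conj_poly R a k dvd h" using monic_dvd_iff_proots[OF _ h0] conj_poly_basic(1) by blast
    hence "k \<le> n" using dvd_imp_degree_le[OF dvd h0] h by (simp add: conj_poly_basic monics_def)
    moreover have "k \<ge> 1" using i m(1) by simp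
    ultimately show "k \<in> {k\<in>{1..n}. a \<in> fixed_field (R ^ k) \<and> conj_poly R a k dvd h}"
      using dvd m(2) i by auto
  qed
  moreover have "inj_on (\<lambda>i. m * i) {1..Polynomial.order a h}" using m(1) by (auto simp: inj_on_def)
  ultimately show ?thesis unfolding R_def by (simp add: card_image)
qed

text \<open>Counting the pairs (k, a) root by root gives the multiplicities, with sum n. It is the
  analogue of summing the von Mangoldt function over divisors, and takes the place of a
  factorization of h into irreducible polynomials.\<close>

lemma card_conj_dvd:
  fixes h :: "'a::alg_closed_field poly"
  assumes p: "Factorial_Ring.prime p" "CHAR('a) = p" and t: "t \<ge> 1"
    and h: "h \<in> monics (fixed_field (p ^ t)) n"
  shows "(\<Sum>k\<in>{1..n}. card {a\<in>fixed_field ((p ^ t) ^ k). conj_poly (p ^ t) a k dvd h}) = n"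
proof -
  define Z where "Z = {a. poly h a = 0}"
  have h0: "h \<noteq> 0" using h by (auto simp: monics_def)
  hence finZ: "finite Z" unfolding Z_def by (rule poly_roots_finite)
  have root: "poly h a = 0" if "conj_poly (p ^ t) a k dvd h" "k \<ge> 1" for a k
  proof -
    have "poly (conj_poly (p ^ t) a k) a = 0"
      using that(2) unfolding conj_poly_def poly_prod by (intro prod_zero) (auto intro!: bexI[of _ 0])
    thus ?thesis using that(1) by (auto elim!: dvdE)
  qed
  have "(\<Sum>k\<in>{1..n}. card {a\<in>fixed_field ((p ^ t) ^ k). conj_poly (p ^ t) a k dvd h}) =
      (\<Sum>k\<in>{1..n}. \<Sum>a\<in>Z. if a \<in> fixed_field ((p ^ t) ^ k) \<and> conj_poly (p ^ t) a k dvd h then 1 else 0)"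
  proof (rule sum.cong)
    fix k assume k: "k \<in> {1..n}"
    have "{a\<in>fixed_field ((p ^ t) ^ k). conj_poly (p ^ t) a k dvd h} =
        {a\<in>Z. a \<in> fixed_field ((p ^ t) ^ k) \<and> conj_poly (p ^ t) a k dvd h}"
      using root[of _ k] k by (auto simp: Z_def)
    thus "card {a\<in>fixed_field ((p ^ t) ^ k). conj_poly (p ^ t) a k dvd h} =
        (\<Sum>a\<in>Z. if a \<in> fixed_field ((p ^ t) ^ k) \<and> conj_poly (p ^ t) a k dvd h then 1 else 0)"
      using finZ by (simp add: sum.If_cases Int_def)
  qed simp
  also have "\<dots> = (\<Sum>a\<in>Z. card {k\<in>{1..n}. a \<in> fixed_field ((p ^ t) ^ k) \<and> conj_poly (p ^ t) a k dvd h})"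
    by (subst sum.swap) (simp add: sum.If_cases Int_def)
  also have "\<dots> = (\<Sum>a\<in>Z. Polynomial.order a h)"
    by (intro sum.cong refl card_conj_dvd_root[OF p h]) (simp add: Z_def)
  also have "\<dots> = size (proots h)" using h0 by (simp add: size_multiset_overloaded_eq Z_def)
  also have "\<dots> = n" using proots_alg_closed(2)[OF h0] h by (simp add: monics_def)
  finally show ?thesis .
qed

lemma finite_monics:
  assumes "finite B" shows "finite (monics B n)"
proof -
  have "monics B n \<subseteq> Poly ` {xs. set xs \<subseteq> B \<and> length xs \<le> Suc n}"
  proof
    fix h assume h: "h \<in> monics B n"
    have "set (coeffs h) \<subseteq> B" using h by (auto simp: monics_def coeffs_def)
    moreover have "length (coeffs h) \<le> Suc n" using h by (auto simp: monics_def coeffs_def)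
    ultimately show "h \<in> Poly ` {xs. set xs \<subseteq> B \<and> length xs \<le> Suc n}"
      by (intro image_eqI[of _ _ "coeffs h"]) auto
  qed
  thus ?thesis using finite_lists_length_le[OF assms] finite_subset by blast
qed

section \<open>The recursion for the L-series\<close>

definition field_char_sum :: "nat \<Rightarrow> complex \<Rightarrow> nat \<Rightarrow> 'a::field poly \<Rightarrow> complex" where
  "field_char_sum p \<omega> r g = (\<Sum>a\<in>fixed_field (p ^ r). trace_char p \<omega> r (poly g a))"

text \<open>The multiples of the conjugate polynomial c are the c h with h monic of degree n - k,
  and root sums are additive. The root sum of c is the relative trace of g(a), so its character is
  that of g(a) in the larger field.\<close>

lemma sum_over_multiples_of_conj_poly:
  fixes g :: "'a::alg_closed_field poly"
  assumes p: "Factorial_Ring.prime p" "CHAR('a) = p" and w: "\<omega> ^ p = 1"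
    and g: "\<And>i. Polynomial.coeff g i \<in> fixed_field (p ^ t)"
    and k: "k \<le> n" and a: "a \<in> fixed_field (p ^ (t * k))"
  shows "(\<Sum>h\<in>{h\<in>monics (fixed_field (p ^ t)) n. conj_poly (p ^ t) a k dvd h}. trace_char p \<omega> t (root_sum g h)) =
    trace_char p \<omega> (t * k) (poly g a) * monic_char_sum p \<omega> t g (n - k)"
proof -
  define B where "B = (fixed_field (p ^ t) :: 'a set)"
  define c where "c = conj_poly (p ^ t) a k"
  have pos: "p ^ t > 0" using prime_gt_0_nat[OF p(1)] by simp
  have cm: "c \<in> monics B k" unfolding c_def B_def using a by (intro conj_poly_in_monics[OF p]) (simp add: power_mult)
  have c0: "c \<noteq> 0" and lc: "Polynomial.lead_coeff c = 1" and dc: "Polynomial.degree c = k"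
    unfolding c_def by (rule conj_poly_basic)+
  have fr: "frob_poly (p ^ t) h = h \<longleftrightarrow> (\<forall>i. Polynomial.coeff h i \<in> B)" for h :: "'a poly"
    unfolding B_def by (rule frob_poly_eq_iff[OF pos])
  have "root_sum g c = (\<Sum>j<k. poly g (a ^ ((p ^ t) ^ j)))"
    unfolding root_sum_def c_def conj_poly_basic by (simp add: image_mset.compositionality sum_unfold_sum_mset o_def)
  also have "\<dots> = (\<Sum>j<k. poly g a ^ ((p ^ t) ^ j))"
  proof (rule sum.cong)
    fix j
    have "Polynomial.coeff g i \<in> fixed_field (p ^ (t * j))" for i
      using g fixed_field_mono[of t "t * j" p] by auto
    from poly_frobenius[OF p this] show "poly g (a ^ ((p ^ t) ^ j)) = poly g a ^ ((p ^ t) ^ j)"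
      by (simp add: power_mult)
  qed simp
  finally have tr: "trace_char p \<omega> t (root_sum g c) = trace_char p \<omega> (t * k) (poly g a)"
    by (simp add: trace_char_def trace_sum_tower[OF p])
  have "(\<Sum>h\<in>{h\<in>monics B n. c dvd h}. trace_char p \<omega> t (root_sum g h)) =
      (\<Sum>h\<in>monics B (n - k). trace_char p \<omega> t (root_sum g (c * h)))"
  proof (rule sum.reindex_bij_witness[of _ "\<lambda>h. c * h" "\<lambda>h. h div c"])
    fix h assume h: "h \<in> {h\<in>monics B n. c dvd h}"
    then obtain m where m: "h = c * m" by (auto elim: dvdE)
    have hn: "Polynomial.lead_coeff h = 1" "Polynomial.degree h = n" "frob_poly (p ^ t) h = h"
      using h fr by (auto simp: monics_def)
    have m0: "m \<noteq> 0" using m hn by auto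
    \<comment> \<open>Frobenius fixes the product and c; cancelling c shows that it fixes the
      cofactor, which therefore has coefficients in the base field.\<close>
    have "c * frob_poly (p ^ t) m = c * m"
      using hn(3) fr[of c] cm unfolding m frob_poly_mult[OF p] by (auto simp: monics_def)
    hence "frob_poly (p ^ t) m = m" using c0 by simp
    moreover have "Polynomial.lead_coeff m = 1" using hn(1) lc unfolding m by (simp add: lead_coeff_mult)
    moreover have "Polynomial.degree m = n - k" using hn(2) m0 c0 dc unfolding m by (simp add: degree_mult_eq)
    ultimately show "h div c \<in> monics B (n - k)" using c0 m fr by (simp add: monics_def)
    show "c * (h div c) = h" using m c0 by simp
    thus "trace_char p \<omega> t (root_sum g (c * (h div c))) = trace_char p \<omega> t (root_sum g h)" by simp
  next
    fix h assume h: "h \<in> monics B (n - k)"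
    have hn: "Polynomial.lead_coeff h = 1" "Polynomial.degree h = n - k" "frob_poly (p ^ t) h = h"
      using h fr by (auto simp: monics_def)
    have h0: "h \<noteq> 0" using hn by auto
    show "c * h div c = h" using c0 by simp
    have "frob_poly (p ^ t) (c * h) = c * h"
      using hn(3) fr[of c] cm unfolding frob_poly_mult[OF p] by (auto simp: monics_def)
    moreover have "Polynomial.lead_coeff (c * h) = 1" using hn lc by (simp add: lead_coeff_mult)
    moreover have "Polynomial.degree (c * h) = n" using hn c0 h0 dc k by (simp add: degree_mult_eq)
    ultimately show "c * h \<in> {h\<in>monics B n. c dvd h}" using fr by (simp add: monics_def)
  qed
  also have "\<dots> = (\<Sum>h\<in>monics B (n - k). trace_char p \<omega> t (root_sum g c) * trace_char p \<omega> t (root_sum g h))"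
  proof (rule sum.cong)
    fix h assume h: "h \<in> monics B (n - k)"
    hence "h \<noteq> 0" by (auto simp: monics_def)
    thus "trace_char p \<omega> t (root_sum g (c * h)) = trace_char p \<omega> t (root_sum g c) * trace_char p \<omega> t (root_sum g h)"
      unfolding root_sum_mult[OF c0 \<open>h \<noteq> 0\<close>] using h cm unfolding B_def
      by (intro trace_char_add[OF p w] root_sum_in_fixed_field[OF p _ g])
  qed simp
  finally have "(\<Sum>h\<in>{h\<in>monics B n. c dvd h}. trace_char p \<omega> t (root_sum g h)) =
      trace_char p \<omega> (t * k) (poly g a) * monic_char_sum p \<omega> t g (n - k)"
    unfolding tr monic_char_sum_def B_def[symmetric] by (simp only: sum_distrib_left)
  thus ?thesis by (simp only: c_def B_def)
qed

text \<open>The factor n is replaced by the number of pairs (k, a) from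
  \<open>card_conj_dvd\<close>, and the sums are interchanged. For generating series this reads T A'
  = A S, with S the series of the sums over the extensions.\<close>

lemma monic_char_sum_rec:
  fixes g :: "'a::alg_closed_field poly"
  assumes p: "Factorial_Ring.prime p" "CHAR('a) = p" and w: "\<omega> ^ p = 1" and t: "t \<ge> 1"
    and g: "\<And>i. Polynomial.coeff g i \<in> fixed_field (p ^ t)"
  shows "of_nat n * monic_char_sum p \<omega> t g n =
    (\<Sum>k\<in>{1..n}. field_char_sum p \<omega> (t * k) g * monic_char_sum p \<omega> t g (n - k))"
proof -
  define M where "M = monics (fixed_field (p ^ t) :: 'a set) n"
  define Y where "Y = (\<lambda>h. trace_char p \<omega> t (root_sum g h))"
  define D where "D = (\<lambda>k (a :: 'a) h. conj_poly (p ^ t) a k dvd h)"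
  have finM: "finite M" unfolding M_def by (intro finite_monics finite_fixed_field[OF p t])
  have finB: "finite (fixed_field (p ^ (t * k)) :: 'a set)" if "k \<ge> 1" for k
    using t that by (intro finite_fixed_field[OF p]) simp
  have "of_nat n * monic_char_sum p \<omega> t g n = (\<Sum>h\<in>M. of_nat n * Y h)"
    by (simp add: monic_char_sum_def M_def Y_def sum_distrib_left)
  also have "\<dots> = (\<Sum>h\<in>M. \<Sum>k\<in>{1..n}. \<Sum>a\<in>fixed_field (p ^ (t * k)). if D k a h then Y h else 0)"
  proof (rule sum.cong)
    fix h assume "h \<in> M"
    hence "(\<Sum>k\<in>{1..n}. card {a\<in>fixed_field (p ^ (t * k)). D k a h}) = n"
      using card_conj_dvd[OF p t, of h n] by (simp add: M_def D_def power_mult)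
    hence "(\<Sum>k\<in>{1..n}. of_nat (card {a\<in>fixed_field (p ^ (t * k)). D k a h})) = (of_nat n :: complex)"
      by (simp only: of_nat_sum[symmetric])
    hence "of_nat n * Y h = (\<Sum>k\<in>{1..n}. of_nat (card {a\<in>fixed_field (p ^ (t * k)). D k a h})) * Y h"
      by (simp only:)
    also have "\<dots> = (\<Sum>k\<in>{1..n}. \<Sum>a\<in>fixed_field (p ^ (t * k)). if D k a h then Y h else 0)"
      unfolding sum_distrib_right
      using finB by (intro sum.cong refl) (simp add: sum.If_cases Int_def)
    finally show "of_nat n * Y h = (\<Sum>k\<in>{1..n}. \<Sum>a\<in>fixed_field (p ^ (t * k)). if D k a h then Y h else 0)" .
  qed simp
  also have "\<dots> = (\<Sum>k\<in>{1..n}. \<Sum>a\<in>fixed_field (p ^ (t * k)). \<Sum>h\<in>M. if D k a h then Y h else 0)"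
    by (subst sum.swap, intro sum.cong refl, rule sum.swap)
  also have "\<dots> = (\<Sum>k\<in>{1..n}. \<Sum>a\<in>fixed_field (p ^ (t * k)).
      trace_char p \<omega> (t * k) (poly g a) * monic_char_sum p \<omega> t g (n - k))"
  proof (intro sum.cong refl)
    fix k and a :: 'a assume ka: "k \<in> {1..n}" "a \<in> fixed_field (p ^ (t * k))"
    have "(\<Sum>h\<in>M. if D k a h then Y h else 0) = (\<Sum>h\<in>{h\<in>M. D k a h}. Y h)"
      using finM by (simp add: sum.inter_filter)
    also have "\<dots> = trace_char p \<omega> (t * k) (poly g a) * monic_char_sum p \<omega> t g (n - k)"
      unfolding M_def D_def Y_def using ka by (intro sum_over_multiples_of_conj_poly[OF p w g]) auto
    finally show "(\<Sum>h\<in>M. if D k a h then Y h else 0) =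
        trace_char p \<omega> (t * k) (poly g a) * monic_char_sum p \<omega> t g (n - k)" .
  qed
  finally show ?thesis by (simp add: field_char_sum_def sum_distrib_right)
qed

text \<open>A has the coefficients \<open>monic_char_sum\<close>; entry k of its logarithmic
  derivative is the character sum over the extension of degree k + 1.\<close>

theorem artin_schreier_L_polynomial:
  fixes g :: "'a::alg_closed_field poly"
  assumes p: "Factorial_Ring.prime p" "CHAR('a) = p" and w: "\<omega> ^ p = 1" "\<omega> \<noteq> 1" and t: "t \<ge> 1"
    and g: "\<And>i. Polynomial.coeff g i \<in> fixed_field (p ^ t)"
    and d: "d = Polynomial.degree g" "1 \<le> d" "\<not> p dvd d"
  shows "\<exists>A :: complex fps. A $ 0 = 1 \<and> (\<forall>n\<ge>d. A $ n = 0) \<and>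
     fps_deriv A = A * Abs_fps (\<lambda>k. field_char_sum p \<omega> (t * Suc k) g)"
proof (intro exI conjI allI impI)
  define A where "A = Abs_fps (monic_char_sum p \<omega> t g)"
  have "monics (fixed_field (p ^ t)) 0 = {1 :: 'a poly}"
  proof (intro equalityI subsetI)
    fix h :: "'a poly" assume "h \<in> monics (fixed_field (p ^ t)) 0"
    thus "h \<in> {1}" by (auto simp: monics_def elim!: degree_eq_zeroE)
  next
    fix h :: "'a poly" assume "h \<in> {1}"
    moreover have "Polynomial.coeff (1 :: 'a poly) i \<in> fixed_field (p ^ t)" for i
      using fixed_field_0_1[OF p(1)] by (cases i) (auto simp: one_pCons)
    ultimately show "h \<in> monics (fixed_field (p ^ t)) 0" by (auto simp: monics_def)
  qed
  thus "A $ 0 = 1" using trace_char_0[OF p w(1)] by (simp add: A_def monic_char_sum_def root_sum_def)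
  show "A $ n = 0" if "n \<ge> d" for n
    using monic_char_sum_eq_0[OF p w t g d that] by (simp add: A_def)
  show "fps_deriv A = A * Abs_fps (\<lambda>k. field_char_sum p \<omega> (t * Suc k) g)"
  proof (rule fps_ext)
    fix n
    have "fps_deriv A $ n = of_nat (Suc n) * monic_char_sum p \<omega> t g (Suc n)" by (simp add: A_def)
    also have "\<dots> = (\<Sum>k\<in>{1..Suc n}. field_char_sum p \<omega> (t * k) g * monic_char_sum p \<omega> t g (Suc n - k))"
      by (rule monic_char_sum_rec[OF p w(1) t g])
    also have "\<dots> = (\<Sum>i\<in>{0..n}. monic_char_sum p \<omega> t g i * field_char_sum p \<omega> (t * Suc (n - i)) g)"
      by (rule sum.reindex_bij_witness[of _ "\<lambda>i. Suc (n - i)" "\<lambda>k. Suc n - k"]) (auto simp: Suc_diff_le)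
    also have "\<dots> = (A * Abs_fps (\<lambda>k. field_char_sum p \<omega> (t * Suc k) g)) $ n"
      by (simp add: fps_mult_nth A_def)
    finally show "fps_deriv A $ n = (A * Abs_fps (\<lambda>k. field_char_sum p \<omega> (t * Suc k) g)) $ n" .
  qed
qed

subsection \<open>The affine point count\<close>

text \<open>Additive Hilbert 90. Let k be the intersection of K with F_q, whatever the relation
  between u and r. The map b -> b^q - b on K has kernel k and its image lies in the annihilator Z of
  k under the trace pairing. Since \<open>card k * card Z = card K\<close>, the image is all of Z,
  and the right-hand side is \<open>card k\<close> on Z and 0 elsewhere.\<close>

lemma artin_schreier_fibre_count:
  fixes c :: "'a::alg_closed_field"
  assumes p: "Factorial_Ring.prime p" "CHAR('a) = p" and w: "\<omega> ^ p = 1" "\<omega> \<noteq> 1" and r: "r \<ge> 1"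
    and c: "c \<in> fixed_field (p ^ r)"
  shows "of_nat (card {b\<in>fixed_field (p ^ r). b ^ (p ^ u) - b = c}) =
     (\<Sum>\<beta>\<in>{\<beta>\<in>fixed_field (p ^ r). \<beta> ^ (p ^ u) = \<beta>}. trace_char p \<omega> r (\<beta> * c))"
proof -
  define K where "K = (fixed_field (p ^ r) :: 'a set)"
  define k where "k = {\<beta>\<in>K. \<beta> ^ (p ^ u) = \<beta>}"
  define \<phi> where "\<phi> = (\<lambda>b :: 'a. b ^ (p ^ u) - b)"
  define \<psi> where "\<psi> = (trace_char p \<omega> r :: 'a \<Rightarrow> complex)"
  have closed: "x + y \<in> K" "x - y \<in> K" "x * y \<in> K" "x ^ n \<in> K" if "x \<in> K" "y \<in> K" for x y n
    using fixed_field_closed[OF p, of x r y] that by (auto simp: K_def)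
  have finK: "finite K" and cardK: "card K = p ^ r"
    using finite_fixed_field[OF p r] card_fixed_field[OF p r] by (auto simp: K_def)
  have F: "(x + y) ^ (p ^ u) = x ^ (p ^ u) + y ^ (p ^ u)" for x y :: 'a
    by (rule freshmans_dream') (use p in auto)
  have Fd: "(x - y) ^ (p ^ u) = x ^ (p ^ u) - y ^ (p ^ u)" for x y :: 'a
    using F[of "x - y" y] by (simp add: eq_diff_eq)
  have \<psi>add: "\<psi> (x + y) = \<psi> x * \<psi> y" if "x \<in> K" "y \<in> K" for x y
    using trace_char_add[OF p w(1)] that unfolding \<psi>_def K_def by blast
  have K0: "0 \<in> K" using fixed_field_0_1[OF p(1)] by (simp add: K_def)
  have k0: "0 \<in> k" using K0 prime_gt_0_nat[OF p(1)] by (simp add: k_def)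
  have subk: "add_subgroup k"
    unfolding add_subgroup_def using k0 closed F Fd by (auto simp: k_def)
  have subK: "add_subgroup K" unfolding K_def by (rule add_subgroup_fixed_field[OF p])
  have fink: "finite k" using finK by (simp add: k_def)
  have kpos: "card k > 0" using k0 fink by (auto simp: card_gt_0_iff)
  have \<phi>K: "\<phi> b \<in> K" if "b \<in> K" for b using closed that by (simp add: \<phi>_def)
  have fib: "card {b\<in>K. \<phi> b = \<phi> b0} = card k" if b0: "b0 \<in> K" for b0
  proof -
    have "bij_betw (\<lambda>\<beta>. \<beta> + b0) k {b\<in>K. \<phi> b = \<phi> b0}"
    proof (rule bij_betw_byWitness[of _ "\<lambda>b. b - b0"])
      show "(\<lambda>\<beta>. \<beta> + b0) ` k \<subseteq> {b\<in>K. \<phi> b = \<phi> b0}"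
        using closed b0 F by (auto simp: k_def \<phi>_def)
      show "(\<lambda>b. b - b0) ` {b\<in>K. \<phi> b = \<phi> b0} \<subseteq> k"
      proof
        fix x assume "x \<in> (\<lambda>b. b - b0) ` {b\<in>K. \<phi> b = \<phi> b0}"
        then obtain b where b: "b \<in> K" "\<phi> b = \<phi> b0" "x = b - b0" by blast
        have "b ^ (p ^ u) - b0 ^ (p ^ u) = b - b0" using b(2) by (simp add: \<phi>_def algebra_simps)
        thus "x \<in> k" using closed(2)[OF b(1) b0] by (simp add: k_def b(3) Fd)
      qed
    qed auto
    thus ?thesis by (simp add: bij_betw_same_card)
  qed
  define Z where "Z = {c\<in>K. \<forall>\<beta>\<in>k. \<psi> (\<beta> * c) = 1}"
  have WZ: "\<phi> ` K \<subseteq> Z"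
  proof
    fix x assume "x \<in> \<phi> ` K"
    then obtain b where b: "b \<in> K" "x = \<phi> b" by auto
    have "\<psi> (\<beta> * x) = 1" if \<beta>: "\<beta> \<in> k" for \<beta>
    proof -
      have "\<beta> * b \<in> K" using \<beta> b closed by (auto simp: k_def)
      \<comment> \<open>As \<beta>^q = \<beta>, the product \<beta> x is v^q - v for v = \<beta> b,
        and v^q and v have the same trace.\<close>
      have "\<beta> * x + \<beta> * b = (\<beta> * b) ^ (p ^ u)"
        using \<beta> by (simp add: b(2) \<phi>_def k_def power_mult_distrib algebra_simps)
      hence "trace_sum p r (\<beta> * x) + trace_sum p r (\<beta> * b) = trace_sum p r ((\<beta> * b) ^ (p ^ u))"
        by (metis trace_sum_add[OF p])
      also have "\<dots> = trace_sum p r (\<beta> * b)" using trace_sum_power(1)[OF p] \<open>\<beta> * b \<in> K\<close> by (simp add: K_def)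
      finally show ?thesis using prime_char_0[OF p w(1)] by (simp add: \<psi>_def trace_char_def)
    qed
    thus "x \<in> Z" using \<phi>K b by (simp add: Z_def)
  qed
  have T: "(\<Sum>\<beta>\<in>k. \<psi> (\<beta> * x)) = (if x \<in> Z then of_nat (card k) else 0)" if x: "x \<in> K" for x
  proof (cases "x \<in> Z")
    case False
    then obtain \<beta> where \<beta>: "\<beta> \<in> k" "\<psi> (\<beta> * x) \<noteq> 1" using x by (auto simp: Z_def)
    have "(\<Sum>\<beta>\<in>k. \<psi> (\<beta> * x)) = 0"
      by (rule char_sum_zero[where \<chi> = "\<lambda>\<beta>. \<psi> (\<beta> * x)", OF subk _ \<beta>])
        (use x closed \<psi>add in \<open>auto simp: k_def distrib_right\<close>)
    thus ?thesis using False by simp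
  qed (simp add: Z_def)
  \<comment> \<open>Double counting by orthogonality: the inner sum over k detects Z, the one over K
    detects \<beta> = 0.\<close>
  have "of_nat (card k * card Z) = (\<Sum>x\<in>K. \<Sum>\<beta>\<in>k. \<psi> (\<beta> * x))"
  proof -
    have "Z \<subseteq> K" by (auto simp: Z_def)
    hence "(\<Sum>x\<in>K. if x \<in> Z then of_nat (card k) else 0) = (of_nat (card k * card Z) :: complex)"
      using finK by (simp add: sum.If_cases Int_absorb1 mult.commute)
    thus ?thesis using T by simp
  qed
  also have "\<dots> = (\<Sum>\<beta>\<in>k. \<Sum>x\<in>K. \<psi> (\<beta> * x))" by (rule sum.swap)
  also have "\<dots> = (\<Sum>\<beta>\<in>k. if \<beta> = 0 then of_nat (card K) else 0)"
  proof (rule sum.cong)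
    fix \<beta> assume \<beta>: "\<beta> \<in> k"
    show "(\<Sum>x\<in>K. \<psi> (\<beta> * x)) = (if \<beta> = 0 then of_nat (card K) else 0)"
    proof (cases "\<beta> = 0")
      case True
      thus ?thesis using trace_char_0[OF p w(1)] by (simp add: \<psi>_def)
    next
      case False
      have \<beta>K: "\<beta> \<in> K" using \<beta> by (simp add: k_def)
      obtain y where "y \<in> K" "\<psi> (\<beta> * y) \<noteq> 1"
        using trace_char_nontrivial[OF p w r _ False] \<beta>K unfolding K_def \<psi>_def by blast
      hence "(\<Sum>x\<in>K. \<psi> (\<beta> * x)) = 0"
        using \<beta>K closed \<psi>add
        by (intro char_sum_zero[where \<chi> = "\<lambda>x. \<psi> (\<beta> * x)", OF subK, of y]) (auto simp: distrib_left)
      thus ?thesis using False by simp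
    qed
  qed simp
  also have "\<dots> = of_nat (card K)" using k0 fink by simp
  finally have "card k * card Z = card K" by (simp only: of_nat_eq_iff)
  moreover have "card K = card (\<phi> ` K) * card k"
  proof -
    have "card K = (\<Sum>x\<in>\<phi> ` K. card {b\<in>K. \<phi> b = x})"
      using sum.image_gen[OF finK, of "\<lambda>_. 1::nat" \<phi>] by simp
    also have "\<dots> = (\<Sum>x\<in>\<phi> ` K. card k)" by (rule sum.cong) (auto simp: fib)
    finally show ?thesis by simp
  qed
  ultimately have "card Z = card (\<phi> ` K)" using kpos by (simp add: mult.commute)
  moreover have "finite Z" using finK by (simp add: Z_def)
  ultimately have ZW: "Z = \<phi> ` K" using WZ by (metis card_subset_eq)
  have "of_nat (card {b\<in>K. \<phi> b = c}) = (\<Sum>\<beta>\<in>k. \<psi> (\<beta> * c))"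
  proof (cases "c \<in> \<phi> ` K")
    case True
    thus ?thesis using T[of c] ZW fib \<phi>K by auto
  next
    case False
    hence e: "{b\<in>K. \<phi> b = c} = {}" by auto
    have "(\<Sum>\<beta>\<in>k. \<psi> (\<beta> * c)) = 0" using False T[of c] ZW c by (simp add: K_def)
    thus ?thesis by (simp only: e card.empty of_nat_0)
  qed
  thus ?thesis by (simp only: K_def k_def \<phi>_def \<psi>_def)
qed

definition affine_count :: "nat \<Rightarrow> nat \<Rightarrow> nat \<Rightarrow> 'a::field poly \<Rightarrow> nat" where
  "affine_count p r q f =
     card {(a, b). a \<in> fixed_field (p ^ r) \<and> b \<in> fixed_field (p ^ r) \<and> b ^ q - b = poly f a}"

lemma affine_count_char_sum:
  fixes f :: "'a::alg_closed_field poly"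
  assumes p: "Factorial_Ring.prime p" "CHAR('a) = p" and w: "\<omega> ^ p = 1" "\<omega> \<noteq> 1" and r: "r \<ge> 1"
    and f: "\<And>i. Polynomial.coeff f i \<in> fixed_field (p ^ r)"
  shows "of_int (int (affine_count p r (p ^ u) f) - int (p ^ r)) =
     (\<Sum>\<beta>\<in>{\<beta>\<in>fixed_field (p ^ u) - {0}. \<beta> \<in> fixed_field (p ^ r)}. field_char_sum p \<omega> r (Polynomial.smult \<beta> f))"
proof -
  define K where "K = (fixed_field (p ^ r) :: 'a set)"
  define k where "k = {\<beta>\<in>K. \<beta> ^ (p ^ u) = \<beta>}"
  have finK: "finite K" and cardK: "card K = p ^ r"
    using finite_fixed_field[OF p r] card_fixed_field[OF p r] by (auto simp: K_def)
  have k0: "0 \<in> k" "finite k"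
    using fixed_field_0_1[OF p(1)] prime_gt_0_nat[OF p(1)] finK by (auto simp: k_def K_def)
  have "{(a, b). a \<in> K \<and> b \<in> K \<and> b ^ (p ^ u) - b = poly f a} = (SIGMA a:K. {b\<in>K. b ^ (p ^ u) - b = poly f a})"
    by auto
  hence "affine_count p r (p ^ u) f = (\<Sum>a\<in>K. card {b\<in>K. b ^ (p ^ u) - b = poly f a})"
    unfolding affine_count_def K_def[symmetric] using finK by (simp add: card_SigmaI)
  hence "of_nat (affine_count p r (p ^ u) f) =
      (\<Sum>a\<in>K. of_nat (card {b\<in>K. b ^ (p ^ u) - b = poly f a}) :: complex)" by simp
  also have "\<dots> = (\<Sum>a\<in>K. \<Sum>\<beta>\<in>k. trace_char p \<omega> r (\<beta> * poly f a))"
  proof (rule sum.cong)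
    fix a assume "a \<in> K"
    hence "poly f a \<in> fixed_field (p ^ r)" using fixed_field_poly[OF p f] by (simp add: K_def)
    from artin_schreier_fibre_count[OF p w r this, of u]
    show "of_nat (card {b\<in>K. b ^ (p ^ u) - b = poly f a}) = (\<Sum>\<beta>\<in>k. trace_char p \<omega> r (\<beta> * poly f a))"
      by (simp add: K_def k_def)
  qed simp
  also have "\<dots> = (\<Sum>\<beta>\<in>k. field_char_sum p \<omega> r (Polynomial.smult \<beta> f))"
    by (subst sum.swap) (simp add: field_char_sum_def K_def)
  \<comment> \<open>The term \<beta> = 0 is the number of points of the affine line.\<close>
  also have "\<dots> = field_char_sum p \<omega> r (Polynomial.smult 0 f) +
      (\<Sum>\<beta>\<in>k - {0}. field_char_sum p \<omega> r (Polynomial.smult \<beta> f))"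
    using k0 by (rule sum.remove[rotated])
  also have "field_char_sum p \<omega> r (Polynomial.smult 0 f) = of_nat (p ^ r)"
    using trace_char_0[OF p w(1), of r] cardK by (simp add: field_char_sum_def K_def)
  also have "k - {0} = {\<beta>\<in>fixed_field (p ^ u) - {0}. \<beta> \<in> fixed_field (p ^ r)}"
    by (auto simp: k_def K_def fixed_field_def)
  finally show ?thesis by simp
qed

section \<open>Divisibility of the affine point count\<close>

definition zeta :: "nat \<Rightarrow> complex" where "zeta p = cis (2 * pi / real p)"

lemma zeta_power_eq_1:
  assumes "p > 0" shows "zeta p ^ n = 1 \<longleftrightarrow> p dvd n"
proof -
  have "zeta p ^ n = exp (2 * of_real pi * \<i> * of_nat n / of_nat p)"
    unfolding zeta_def by (subst Complex.DeMoivre, subst cis_conv_exp, rule arg_cong[of _ _ exp]) (simp add: mult_ac)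
  thus ?thesis using complex_root_unity_eq_1[of p n] assms by simp
qed

text \<open>Summation over all nontrivial p-th roots of unity turns character values into integers,
  so that divisibility can be discussed without cyclotomic integers.\<close>

lemma sum_prime_chars:
  fixes z :: "'a::field"
  assumes p: "Factorial_Ring.prime p" "CHAR('a) = p" and z: "z \<in> range of_nat"
  shows "(\<Sum>j\<in>{1..<p}. prime_char (zeta p ^ j) z) = of_int (int p * (if z = 0 then 1 else 0) - 1)"
proof -
  have p0: "p > 0" using prime_gt_0_nat[OF p(1)] .
  obtain i where i: "z = of_nat i" using z by auto
  have pc: "prime_char (zeta p ^ j) z = (zeta p ^ i) ^ j" for j
  proof -
    have "(zeta p ^ j) ^ p = 1" using zeta_power_eq_1[OF p0, of "j * p"] by (simp add: power_mult)
    from prime_char_of_nat[OF p this, of i] show ?thesis by (simp add: i mult.commute flip: power_mult)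
  qed
  have "(\<Sum>j<p. (zeta p ^ i) ^ j) = of_int (int p * (if z = 0 then 1 else 0))"
  proof (cases "z = 0")
    case True
    hence "p dvd i" using i p(2) by (simp add: of_nat_eq_0_iff_char_dvd)
    hence "zeta p ^ i = 1" using zeta_power_eq_1[OF p0] by simp
    thus ?thesis using True by simp
  next
    case False
    hence "\<not> p dvd i" using i p(2) by (auto simp: of_nat_eq_0_iff_char_dvd)
    hence "zeta p ^ i \<noteq> 1" using zeta_power_eq_1[OF p0] by simp
    moreover have "(zeta p ^ i) ^ p = 1" using zeta_power_eq_1[OF p0, of "i * p"] by (simp add: power_mult)
    ultimately show ?thesis using False by (simp add: geometric_sum)
  qed
  moreover have "{..<p} = insert 0 {1..<p}" using p0 by auto
  ultimately show ?thesis by (simp add: pc algebra_simps)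
qed

text \<open>The character formula for the count holds for every nontrivial root of unity, with the
  same left-hand side. Adding the p - 1 instances gives p - 1 times the deviation as a sum of
  integers \<open>E \<beta>\<close>, each controlled by \<open>zero_count_dvd\<close>; and p - 1 is
  prime to p.\<close>

lemma affine_count_dvd:
  fixes f :: "'a::alg_closed_field poly"
  assumes p: "Factorial_Ring.prime p" "CHAR('a) = p" and r: "r \<ge> 1"
    and f: "\<And>i. Polynomial.coeff f i \<in> fixed_field (p ^ r)"
    and s: "s \<ge> 1" "\<And>l. Polynomial.coeff f l \<noteq> 0 \<Longrightarrow> digit_sum p l \<le> s" "s * k < r"
  shows "int p ^ Suc k dvd int (affine_count p r (p ^ u) f) - int (p ^ r)"
proof -
  define K where "K = (fixed_field (p ^ r) :: 'a set)"
  define D where "D = int (affine_count p r (p ^ u) f) - int (p ^ r)"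
  define k' where "k' = {\<beta>\<in>fixed_field (p ^ u) - {0 :: 'a}. \<beta> \<in> K}"
  define E where "E = (\<lambda>\<beta>. int (p * card {a\<in>K. trace_sum p r (\<beta> * poly f a) = 0}) - int (p ^ r))"
  have p0: "p > 0" and p1: "p > 1" using prime_gt_0_nat[OF p(1)] prime_gt_1_nat[OF p(1)] .
  have finK: "finite K" and cardK: "card K = p ^ r"
    using finite_fixed_field[OF p r] card_fixed_field[OF p r] by (auto simp: K_def)
  have tr: "trace_sum p r (\<beta> * poly f a) \<in> range of_nat" if "\<beta> \<in> K" "a \<in> K" for \<beta> a
    using that fixed_field_poly[OF p f] fixed_field_closed(4)[OF p] unfolding K_def
    by (intro trace_sum_in_prime_field[OF p]) blast
  have "of_int (int (p - 1) * D) = (\<Sum>j\<in>{1..<p}. of_int D :: complex)"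
    using p1 by simp
  also have "\<dots> = (\<Sum>j\<in>{1..<p}. \<Sum>\<beta>\<in>k'. field_char_sum p (zeta p ^ j) r (Polynomial.smult \<beta> f))"
  proof (rule sum.cong)
    fix j assume j: "j \<in> {1..<p}"
    hence "\<not> p dvd j" by (auto dest: dvd_imp_le)
    hence w: "(zeta p ^ j) ^ p = 1" "zeta p ^ j \<noteq> 1"
      using zeta_power_eq_1[OF p0, of "j * p"] zeta_power_eq_1[OF p0, of j] by (auto simp: power_mult)
    show "of_int D = (\<Sum>\<beta>\<in>k'. field_char_sum p (zeta p ^ j) r (Polynomial.smult \<beta> f))"
      unfolding D_def k'_def K_def by (rule affine_count_char_sum[OF p w r f])
  qed simp
  also have "\<dots> = (\<Sum>\<beta>\<in>k'. \<Sum>j\<in>{1..<p}. field_char_sum p (zeta p ^ j) r (Polynomial.smult \<beta> f))" by (rule sum.swap)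
  also have "\<dots> = (\<Sum>\<beta>\<in>k'. of_int (E \<beta>))"
  proof (rule sum.cong)
    fix \<beta> assume \<beta>: "\<beta> \<in> k'"
    have "(\<Sum>j\<in>{1..<p}. field_char_sum p (zeta p ^ j) r (Polynomial.smult \<beta> f)) =
        (\<Sum>a\<in>K. \<Sum>j\<in>{1..<p}. prime_char (zeta p ^ j) (trace_sum p r (\<beta> * poly f a)))"
      unfolding field_char_sum_def trace_char_def K_def by (subst sum.swap) simp
    also have "\<dots> = (\<Sum>a\<in>K. of_int (int p * (if trace_sum p r (\<beta> * poly f a) = 0 then 1 else 0) - 1))"
      using \<beta> by (intro sum.cong refl sum_prime_chars[OF p] tr) (auto simp: k'_def)
    also have "\<dots> = of_int (\<Sum>a\<in>K. int p * (if trace_sum p r (\<beta> * poly f a) = 0 then 1 else 0) - 1)"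
      by (simp only: of_int_sum)
    also have "(\<Sum>a\<in>K. int p * (if trace_sum p r (\<beta> * poly f a) = 0 then 1 else 0) - 1) = E \<beta>"
      using finK cardK by (simp add: E_def sum_subtractf sum.If_cases Int_def conj_commute flip: sum_distrib_left)
    finally show "(\<Sum>j\<in>{1..<p}. field_char_sum p (zeta p ^ j) r (Polynomial.smult \<beta> f)) = of_int (E \<beta>)" .
  qed simp
  also have "\<dots> = of_int (\<Sum>\<beta>\<in>k'. E \<beta>)" by simp
  finally have eq: "int (p - 1) * D = (\<Sum>\<beta>\<in>k'. E \<beta>)" by (simp only: of_int_eq_iff)
  have "int p ^ Suc k dvd E \<beta>" if \<beta>: "\<beta> \<in> k'" for \<beta>
  proof -
    define g where "g = (\<lambda>a. trace_sum p r (poly (Polynomial.smult \<beta> f) a))"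
    have "fun_degree_le s (poly (Polynomial.smult \<beta> f))"
      by (rule fun_degree_le_poly[OF p]) (use s(2) in auto)
    hence "fun_degree_le s g" unfolding g_def
      by (intro fun_degree_le_additive[of "trace_sum p r"] trace_sum_add[OF p])
    moreover have "g ` K \<subseteq> range of_nat" using tr \<beta> by (auto simp: g_def k'_def)
    ultimately have "p ^ Suc k dvd p * card {x\<in>K. g x = 0}"
      using zero_count_dvd[OF p, of K r s g k] add_subgroup_fixed_field[OF p, of r] cardK s by (simp add: K_def)
    hence "int p ^ Suc k dvd int (p * card {x\<in>K. g x = 0})" by (metis int_dvd_int_iff of_nat_power)
    moreover have "Suc k \<le> r"
    proof -
      have "k \<le> s * k" using s(1) by (cases s) auto
      from le_less_trans[OF this s(3)] show ?thesis by (rule Suc_leI)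
    qed
    hence "int p ^ Suc k dvd int (p ^ r)" by (metis le_imp_power_dvd of_nat_power)
    ultimately show ?thesis unfolding E_def g_def poly_smult by (rule dvd_diff)
  qed
  hence "int p ^ Suc k dvd int (p - 1) * D" unfolding eq by (intro dvd_sum)
  moreover have "coprime (int p ^ Suc k) (int (p - 1))"
  proof -
    have "coprime p (p - 1)" using p0 by (metis coprime_diff_one_right_nat)
    thus ?thesis by (simp add: coprime_power_left_iff)
  qed
  ultimately show ?thesis unfolding D_def by (simp add: coprime_dvd_mult_right_iff)
qed

section \<open>Grouping the characters by Frobenius orbits\<close>

lemma field_char_sum_frobenius:
  fixes f :: "'a::alg_closed_field poly"
  assumes p: "Factorial_Ring.prime p" "CHAR('a) = p" and r: "r \<ge> 1" "s dvd r"
    and f: "\<And>i. Polynomial.coeff f i \<in> fixed_field (p ^ s)" and \<beta>: "\<beta> \<in> fixed_field (p ^ r)"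
  shows "field_char_sum p \<omega> r (Polynomial.smult (\<beta> ^ ((p ^ s) ^ i)) f) = field_char_sum p \<omega> r (Polynomial.smult \<beta> f)"
proof -
  define K where "K = (fixed_field (p ^ r) :: 'a set)"
  define N where "N = (p ^ s) ^ i"
  have N: "N = p ^ (s * i)" by (simp add: N_def power_mult)
  have finK: "finite K" using finite_fixed_field[OF p r(1)] by (simp add: K_def)
  have "inj_on (\<lambda>a. a ^ N) K" unfolding N using frobenius_inj[OF p] by (intro inj_onI) blast
  moreover have "(\<lambda>a. a ^ N) ` K \<subseteq> K" using fixed_field_closed(5)[OF p] by (auto simp: K_def)
  \<comment> \<open>Replacing a by a^N permutes K. As this power fixes the coefficients of f, it
    turns the values of \<beta>^N f into N-th powers of the values of \<beta> f, which have the same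
    trace.\<close>
  ultimately have img: "(\<lambda>a. a ^ N) ` K = K" using finK by (metis endo_inj_surj)
  have fi: "Polynomial.coeff f j \<in> fixed_field (p ^ (s * i))" "Polynomial.coeff f j \<in> fixed_field (p ^ r)" for j
    using f fixed_field_mono[of s "s * i" p] fixed_field_mono[OF r(2), of p] by auto
  have "field_char_sum p \<omega> r (Polynomial.smult (\<beta> ^ N) f) = (\<Sum>a\<in>(\<lambda>a. a ^ N) ` K. trace_char p \<omega> r (\<beta> ^ N * poly f a))"
    by (simp only: img) (simp add: field_char_sum_def K_def)
  also have "\<dots> = (\<Sum>a\<in>K. trace_char p \<omega> r (\<beta> ^ N * poly f (a ^ N)))"
    by (subst sum.reindex) (use \<open>inj_on (\<lambda>a. a ^ N) K\<close> in auto)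
  also have "\<dots> = (\<Sum>a\<in>K. trace_char p \<omega> r (\<beta> * poly f a))"
  proof (rule sum.cong)
    fix a assume "a \<in> K"
    hence m: "\<beta> * poly f a \<in> fixed_field (p ^ r)"
      using fixed_field_closed(4)[OF p \<beta> fixed_field_poly[OF p fi(2)]] by (simp add: K_def)
    have "poly f (a ^ N) = poly f a ^ N" unfolding N by (rule poly_frobenius[OF p fi(1)])
    hence "\<beta> ^ N * poly f (a ^ N) = (\<beta> * poly f a) ^ N" by (simp add: power_mult_distrib)
    thus "trace_char p \<omega> r (\<beta> ^ N * poly f (a ^ N)) = trace_char p \<omega> r (\<beta> * poly f a)"
      using trace_sum_power(1)[OF p m, of "s * i"] by (simp add: trace_char_def N)
  qed simp
  finally show ?thesis by (simp add: N_def field_char_sum_def K_def)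
qed

text \<open>Chain rule: the logarithmic derivative of A(T^m) is m T^(m-1) D(T^m). Entry n belongs to
  the power sum of index n + 1, so m has to divide \<open>Suc n\<close>.\<close>

lemma log_deriv_compose_power:
  fixes A D :: "'a::field fps"
  assumes A: "fps_deriv A = A * D" and m: "m \<ge> 1"
  shows "fps_deriv (A oo fps_X ^ m) = (A oo fps_X ^ m) *
     Abs_fps (\<lambda>n. if m dvd Suc n then of_nat m * D $ (Suc n div m - 1) else 0)"
proof -
  have z: "(fps_X ^ m :: 'a fps) $ 0 = 0" using m by (simp add: fps_X_power_nth)
  have "fps_deriv (fps_X ^ m :: 'a fps) = fps_const (of_nat m) * fps_X ^ (m - 1)"
    using fps_deriv_power'[of "fps_X :: 'a fps" m] by (simp add: fps_of_nat)
  hence "fps_deriv (A oo fps_X ^ m) = (A oo fps_X ^ m) * ((D oo fps_X ^ m) * (fps_const (of_nat m) * fps_X ^ (m - 1)))"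
    by (simp add: fps_compose_deriv[OF z] A fps_compose_mult_distrib[OF z] mult.assoc)
  also have "(D oo fps_X ^ m) * (fps_const (of_nat m) * fps_X ^ (m - 1)) =
      Abs_fps (\<lambda>n. if m dvd Suc n then of_nat m * D $ (Suc n div m - 1) else 0)"
  proof (rule fps_ext)
    fix n
    have eq: "(D oo fps_X ^ m) * (fps_const (of_nat m) * fps_X ^ (m - 1)) =
        fps_const (of_nat m) * (fps_X ^ (m - 1) * (D oo fps_X ^ m))" by (simp add: mult_ac)
    have e: "((D oo fps_X ^ m) * (fps_const (of_nat m) * fps_X ^ (m - 1))) $ n =
        of_nat m * (if n < m - 1 then 0 else (D oo fps_X ^ m) $ (n - (m - 1)))"
      unfolding eq by (simp add: fps_X_power_mult_nth)
    show "((D oo fps_X ^ m) * (fps_const (of_nat m) * fps_X ^ (m - 1))) $ n =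
        Abs_fps (\<lambda>n. if m dvd Suc n then of_nat m * D $ (Suc n div m - 1) else 0) $ n"
    proof (cases "m dvd Suc n")
      case True
      then obtain j where j: "Suc n = m * j" by (elim dvdE)
      hence "j \<ge> 1" by (cases j) auto
      hence "n - (m - 1) = m * (j - 1)" "\<not> n < m - 1"
        using j m by (auto simp: algebra_simps diff_mult_distrib2) (metis Suc_leI Suc_pred le_add1 less_Suc_eq_le mult.commute mult_le_mono1 mult_1 not_less One_nat_def)+
      thus ?thesis using j m e by (simp add: fps_nth_compose_X_power)
    next
      case False
      have "\<not> m dvd n - (m - 1)" if "\<not> n < m - 1"
      proof
        assume "m dvd n - (m - 1)"
        hence "m dvd (n - (m - 1)) + m" by simp
        also have "(n - (m - 1)) + m = Suc n" using that m by simp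
        finally show False using False by blast
      qed
      thus ?thesis using False e by (auto simp: fps_nth_compose_X_power)
    qed
  qed
  finally show ?thesis .
qed

text \<open>
  Each Frobenius orbit of size \<open>m\<close> contributes one series in \<open>T ^ m\<close>, a polynomial.
\<close>
lemma frobenius_stable_L_polynomial:
  fixes f :: "'a::alg_closed_field poly"
  assumes p: "Factorial_Ring.prime p" "CHAR('a) = p" and w: "\<omega> ^ p = 1" "\<omega> \<noteq> 1" and s: "s \<ge> 1"
    and f: "\<And>i. Polynomial.coeff f i \<in> fixed_field (p ^ s)"
    and d: "1 \<le> Polynomial.degree f" "\<not> p dvd Polynomial.degree f"
    and V: "finite V" "0 \<notin> V" "\<And>\<beta>. \<beta> \<in> V \<Longrightarrow> \<beta> ^ (p ^ s) \<in> V"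
  shows "\<exists>P :: complex fps. P $ 0 = 1 \<and> (\<exists>N. \<forall>n>N. P $ n = 0) \<and>
    fps_deriv P = P * Abs_fps (\<lambda>n. \<Sum>\<beta>\<in>{\<beta>\<in>V. \<beta> \<in> fixed_field (p ^ (s * Suc n))}.
       field_char_sum p \<omega> (s * Suc n) (Polynomial.smult \<beta> f))"
  using V
proof (induction "card V" arbitrary: V rule: less_induct)
  case less
  show ?case
  proof (cases "V = {}")
    case True
    have "Abs_fps (\<lambda>n. 0 :: complex) = 0" by (rule fps_ext) simp
    thus ?thesis using True by (intro exI[of _ 1]) auto
  next
    case False
    then obtain \<beta> where \<beta>: "\<beta> \<in> V" by blast
    define R where "R = p ^ s"
    have orbV: "\<gamma> ^ (R ^ j) \<in> V" if "\<gamma> \<in> V" for j \<gamma>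
    proof (induction j)
      case (Suc j)
      have "(\<gamma> ^ (R ^ j)) ^ R \<in> V" unfolding R_def using Suc less.prems(3) by (simp add: R_def)
      thus ?case by (simp add: mult.commute flip: power_mult)
    qed (use that in simp)
    obtain m where m: "m \<ge> 1" "\<And>k. \<beta> \<in> fixed_field (R ^ k) \<longleftrightarrow> m dvd k"
        "\<And>i j. \<beta> ^ (R ^ i) = \<beta> ^ (R ^ j) \<Longrightarrow> i mod m = j mod m"
      using frobenius_period[OF p less.prems(1), of \<beta> s] orbV[OF \<beta>] unfolding R_def by blast
    define Orb where "Orb = (\<lambda>i. \<beta> ^ (R ^ i)) ` {..<m}"
    have inj: "inj_on (\<lambda>i. \<beta> ^ (R ^ i)) {..<m}"
      using m(3) by (intro inj_onI) fastforce
    have cardO: "card Orb = m" unfolding Orb_def using inj by (simp add: card_image)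
    have OV: "Orb \<subseteq> V" using orbV \<beta> by (auto simp: Orb_def)
    have finO: "finite Orb" by (simp add: Orb_def)
    have inO: "\<beta> ^ (R ^ j) \<in> Orb" for j
    proof -
      have "\<beta> ^ (R ^ (m * (j div m))) = \<beta>" using m(2)[of "m * (j div m)"] by (simp add: fixed_field_def)
      hence "\<beta> ^ (R ^ (m * (j div m) + j mod m)) = \<beta> ^ (R ^ (j mod m))"
        by (simp only: power_add power_mult)
      hence "\<beta> ^ (R ^ j) = \<beta> ^ (R ^ (j mod m))" by simp
      thus ?thesis using m(1) unfolding Orb_def by (intro image_eqI[of _ _ "j mod m"]) auto
    qed
    have stable: "\<gamma> ^ (p ^ s) \<in> V - Orb" if \<gamma>: "\<gamma> \<in> V - Orb" for \<gamma>
    proof -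
      have "\<gamma> ^ (p ^ s) \<notin> Orb"
      proof
        assume "\<gamma> ^ (p ^ s) \<in> Orb"
        then obtain i where i: "\<gamma> ^ (p ^ s) = \<beta> ^ (R ^ i)" by (auto simp: Orb_def)
        have "\<beta> ^ (R ^ m) = \<beta>" using m(2)[of m] by (simp add: fixed_field_def)
        hence "\<beta> ^ (R ^ i) = \<beta> ^ (R ^ (m + i))" by (simp only: power_add power_mult)
        \<comment> \<open>Going once around the orbit makes the exponent positive, so that one
          Frobenius can be cancelled.\<close>
        also have "m + i = (m - 1 + i) + 1" using m(1) by simp
        also have "\<beta> ^ (R ^ (m - 1 + i + 1)) = (\<beta> ^ (R ^ (m - 1 + i))) ^ (p ^ s)"
          by (simp add: R_def mult.commute flip: power_mult)
        finally have "\<gamma> = \<beta> ^ (R ^ (m - 1 + i))" using i frobenius_inj[OF p] by metis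
        thus False using inO \<gamma> by auto
      qed
      thus ?thesis using less.prems(3) \<gamma> by auto
    qed
    have "V - Orb \<subset> V" using \<beta> inO[of 0] by auto
    hence lt: "card (V - Orb) < card V" by (rule psubset_card_mono[OF less.prems(1)])
    have "finite (V - Orb)" "0 \<notin> V - Orb" using less.prems by auto
    from less.hyps[OF lt this stable] obtain P :: "complex fps" and N where P: "P $ 0 = 1" "\<And>n. n > N \<Longrightarrow> P $ n = 0"
      "fps_deriv P = P * Abs_fps (\<lambda>n. \<Sum>\<beta>\<in>{\<beta>\<in>V - Orb. \<beta> \<in> fixed_field (p ^ (s * Suc n))}.
         field_char_sum p \<omega> (s * Suc n) (Polynomial.smult \<beta> f))"
      by blast
    have \<beta>0: "\<beta> \<noteq> 0" using \<beta> less.prems by auto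
    have \<beta>m: "\<beta> \<in> fixed_field (p ^ (s * m))" using m(2)[of m] by (simp add: R_def power_mult)
    have fm: "Polynomial.coeff (Polynomial.smult \<beta> f) i \<in> fixed_field (p ^ (s * m))" for i
      using fixed_field_closed(4)[OF p \<beta>m] f fixed_field_mono[of s "s * m" p] by auto
    have dm: "Polynomial.degree f = Polynomial.degree (Polynomial.smult \<beta> f)" using \<beta>0 by simp
    have "s * m \<ge> 1" using s m(1) by simp
    from artin_schreier_L_polynomial[OF p w this fm dm d] obtain A :: "complex fps" where A: "A $ 0 = 1"
      "\<And>n. n \<ge> Polynomial.degree f \<Longrightarrow> A $ n = 0"
      "fps_deriv A = A * Abs_fps (\<lambda>k. field_char_sum p \<omega> (s * m * Suc k) (Polynomial.smult \<beta> f))"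
      by blast
    \<comment> \<open>A belongs to \<beta> f over the field with p ^ (s m) elements, which contains
      \<beta>. The orbit contributes m equal sums, exactly in the degrees divisible by m; the same
      factor m arises from differentiating T^m.\<close>
    define E where "E = Abs_fps (\<lambda>n. if m dvd Suc n then of_nat m * field_char_sum p \<omega> (s * Suc n) (Polynomial.smult \<beta> f) else 0)"
    define C where "C = A oo fps_X ^ m"
    have "(\<lambda>n. if m dvd Suc n then of_nat m * Abs_fps (\<lambda>k. field_char_sum p \<omega> (s * m * Suc k) (Polynomial.smult \<beta> f)) $ (Suc n div m - 1) else 0)
       = (\<lambda>n. if m dvd Suc n then of_nat m * field_char_sum p \<omega> (s * Suc n) (Polynomial.smult \<beta> f) else 0)"
    proof
      fix n
      have "s * m * Suc (Suc n div m - 1) = s * Suc n" if "m dvd Suc n"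
      proof -
        have "Suc n div m > 0" using that m(1) by (metis Suc_neq_Zero dvd_div_eq_0_iff gr0I)
        hence "Suc (Suc n div m - 1) = Suc n div m" by simp
        thus ?thesis using that by (metis dvd_mult_div_cancel mult.assoc)
      qed
      thus "(if m dvd Suc n then of_nat m * Abs_fps (\<lambda>k. field_char_sum p \<omega> (s * m * Suc k) (Polynomial.smult \<beta> f)) $ (Suc n div m - 1) else 0)
        = (if m dvd Suc n then of_nat m * field_char_sum p \<omega> (s * Suc n) (Polynomial.smult \<beta> f) else 0)"
        by (simp only: fps_nth_Abs_fps cong: if_cong) 
    qed
    hence C': "fps_deriv C = C * E"
      unfolding C_def E_def log_deriv_compose_power[OF A(3) m(1)] by (simp only:)
    have C0: "C $ 0 = 1" using A(1) by (simp add: C_def fps_nth_compose_X_power)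
    have CN: "C $ n = 0" if "n > m * Polynomial.degree f" for n
    proof (cases "m dvd n")
      case True
      then obtain j where "n = m * j" by (elim dvdE)
      thus ?thesis using that m(1) A(2)[of j] by (simp add: C_def fps_nth_compose_X_power)
    qed (simp add: C_def fps_nth_compose_X_power)
    have split: "(\<Sum>\<gamma>\<in>{\<gamma>\<in>V. \<gamma> \<in> fixed_field (p ^ (s * Suc n))}. field_char_sum p \<omega> (s * Suc n) (Polynomial.smult \<gamma> f)) =
       (\<Sum>\<gamma>\<in>{\<gamma>\<in>V - Orb. \<gamma> \<in> fixed_field (p ^ (s * Suc n))}. field_char_sum p \<omega> (s * Suc n) (Polynomial.smult \<gamma> f)) + E $ n" for n
    proof -
      have iff: "\<beta> ^ (R ^ i) \<in> fixed_field (p ^ (s * Suc n)) \<longleftrightarrow> m dvd Suc n" for i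
      proof -
        have 1: "(\<beta> ^ (R ^ i)) ^ (p ^ (s * Suc n)) = (\<beta> ^ (R ^ Suc n)) ^ (p ^ (s * i))"
          unfolding R_def power_mult[symmetric] by (rule arg_cong[OF mult.commute])
        have 2: "\<beta> ^ (R ^ i) = \<beta> ^ (p ^ (s * i))" by (simp only: R_def power_mult)
        have "\<beta> ^ (R ^ i) \<in> fixed_field (p ^ (s * Suc n)) \<longleftrightarrow> (\<beta> ^ (R ^ Suc n)) ^ (p ^ (s * i)) = \<beta> ^ (p ^ (s * i))"
          unfolding fixed_field_def mem_Collect_eq by (rule arg_cong2[of _ _ _ _ "(=)", OF 1 2])
        also have "\<dots> \<longleftrightarrow> \<beta> ^ (R ^ Suc n) = \<beta>"
          by (rule iffI, erule frobenius_inj[OF p], erule arg_cong)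
        also have "\<dots> \<longleftrightarrow> m dvd Suc n" using m(2)[of "Suc n"] by (simp add: fixed_field_def)
        finally show ?thesis .
      qed
      have "(\<Sum>\<gamma>\<in>{\<gamma>\<in>Orb. \<gamma> \<in> fixed_field (p ^ (s * Suc n))}. field_char_sum p \<omega> (s * Suc n) (Polynomial.smult \<gamma> f)) = E $ n"
      proof (cases "m dvd Suc n")
        case True
        have "{\<gamma>\<in>Orb. \<gamma> \<in> fixed_field (p ^ (s * Suc n))} = Orb" using iff True by (auto simp: Orb_def)
        moreover have "field_char_sum p \<omega> (s * Suc n) (Polynomial.smult \<gamma> f) = field_char_sum p \<omega> (s * Suc n) (Polynomial.smult \<beta> f)"
          if \<gamma>: "\<gamma> \<in> Orb" for \<gamma>
        proof -
          obtain i where "\<gamma> = \<beta> ^ (R ^ i)" using \<gamma> unfolding Orb_def by blast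
          moreover have "\<beta> \<in> fixed_field (p ^ (s * Suc n))" using iff[of 0] True by simp
          ultimately show ?thesis using field_char_sum_frobenius[OF p _ _ f, of "s * Suc n" \<beta> \<omega> i] s by (simp add: R_def)
        qed
        ultimately show ?thesis using True cardO by (simp add: E_def)
      next
        case False
        hence "{\<gamma>\<in>Orb. \<gamma> \<in> fixed_field (p ^ (s * Suc n))} = {}" using iff by (auto simp: Orb_def)
        thus ?thesis using False by (simp only: sum.empty) (simp add: E_def)
      qed
      moreover have "{\<gamma>\<in>V. \<gamma> \<in> fixed_field (p ^ (s * Suc n))} =
         {\<gamma>\<in>V - Orb. \<gamma> \<in> fixed_field (p ^ (s * Suc n))} \<union> {\<gamma>\<in>Orb. \<gamma> \<in> fixed_field (p ^ (s * Suc n))}"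
        using OV by auto
      ultimately show ?thesis
        using less.prems(1) finO by (simp only:) (subst sum.union_disjoint, auto)
    qed
    have "fps_deriv (P * C) = (P * C) * Abs_fps (\<lambda>n. \<Sum>\<beta>\<in>{\<beta>\<in>V. \<beta> \<in> fixed_field (p ^ (s * Suc n))}.
       field_char_sum p \<omega> (s * Suc n) (Polynomial.smult \<beta> f))"
    proof -
      have "Abs_fps (\<lambda>n. \<Sum>\<beta>\<in>{\<beta>\<in>V. \<beta> \<in> fixed_field (p ^ (s * Suc n))}. field_char_sum p \<omega> (s * Suc n) (Polynomial.smult \<beta> f))
        = Abs_fps (\<lambda>n. \<Sum>\<beta>\<in>{\<beta>\<in>V - Orb. \<beta> \<in> fixed_field (p ^ (s * Suc n))}. field_char_sum p \<omega> (s * Suc n) (Polynomial.smult \<beta> f)) + E"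
        by (rule fps_ext) (simp only: fps_nth_Abs_fps fps_add_nth split)
      thus ?thesis by (simp only: fps_deriv_mult P(3) C') (simp add: algebra_simps)
    qed
    moreover have "(P * C) $ n = 0" if "n > N + m * Polynomial.degree f" for n
    proof -
      have "P $ i * C $ (n - i) = 0" if "i \<le> n" for i
        using that \<open>n > _\<close> P(2)[of i] CN[of "n - i"] by (cases "i > N") auto
      hence "(\<Sum>i = 0..n. P $ i * C $ (n - i)) = 0" by (intro sum.neutral) auto
      thus ?thesis by (simp add: fps_mult_nth)
    qed
    ultimately show ?thesis using P(1) C0 by (intro exI[of _ "P * C"]) auto
  qed
qed

lemma log_deriv_unique:
  fixes A B D :: "'a::field_char_0 fps"
  assumes "fps_deriv A = A * D" "fps_deriv B = B * D" "A $ 0 = 1" "B $ 0 = 1"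
  shows "A = B"
proof (rule fps_ext)
  fix n show "A $ n = B $ n"
  proof (induction n rule: less_induct)
    case (less n)
    show ?case
    proof (cases n)
      case (Suc m)
      have "of_nat (Suc m) * A $ Suc m = of_nat (Suc m) * B $ Suc m"
        unfolding log_deriv_coeff[OF assms(1)] log_deriv_coeff[OF assms(2)]
        using less Suc by (intro sum.cong) auto
      thus ?thesis unfolding Suc by (metis mult_left_cancel of_nat_neq_0)
    qed (use assms in simp)
  qed
qed

text \<open>L and the complex series P have the same logarithmic derivative and constant term 1, so
  they agree and L inherits the finite degree of P. The valuations then come from
  \<open>affine_count_dvd\<close> through the Graeffe argument.\<close>

theorem L_coeff_valuation:
  fixes f :: "'a::alg_closed_field poly" and L :: "rat fps"
  assumes p: "Factorial_Ring.prime p" "CHAR('a) = p" and s: "s \<ge> 1" and u: "u \<ge> 1"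
    and f: "\<And>i. Polynomial.coeff f i \<in> fixed_field (p ^ s)"
    and d: "1 \<le> Polynomial.degree f" "\<not> p dvd Polynomial.degree f"
    and \<sigma>: "\<sigma> \<ge> 1" "\<And>l. Polynomial.coeff f l \<noteq> 0 \<Longrightarrow> digit_sum p l \<le> \<sigma>"
    and L: "L $ 0 = 1"
      "fps_deriv L = L * Abs_fps (\<lambda>n. of_int (int (affine_count p (s * Suc n) (p ^ u) f) - int (p ^ (s * Suc n))))"
  shows "vge p (real n * (real s / real \<sigma>)) (L $ n)"
proof -
  define S where "S = (\<lambda>n. int (affine_count p (s * Suc n) (p ^ u) f) - int (p ^ (s * Suc n)))"
  have p0: "p > 0" and p1: "p > 1" using prime_gt_0_nat[OF p(1)] prime_gt_1_nat[OF p(1)] .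
  have "\<not> p dvd 1" using p1 by simp
  hence w: "zeta p ^ p = 1" "zeta p \<noteq> 1" using zeta_power_eq_1[OF p0, of p] zeta_power_eq_1[OF p0, of 1] by auto
  have fn: "Polynomial.coeff f i \<in> fixed_field (p ^ (s * Suc n))" for i n
    using f fixed_field_mono[of s "s * Suc n" p] by auto
  have sn: "s * Suc n \<ge> 1" for n using s by simp
  define V where "V = fixed_field (p ^ u) - {0 :: 'a}"
  have V: "finite V" "0 \<notin> V" "\<And>\<beta>. \<beta> \<in> V \<Longrightarrow> \<beta> ^ (p ^ s) \<in> V"
    using finite_fixed_field[OF p u] fixed_field_closed(5)[OF p] by (auto simp: V_def)
  obtain P :: "complex fps" and N where P: "P $ 0 = 1" "\<And>n. n > N \<Longrightarrow> P $ n = 0"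
    "fps_deriv P = P * Abs_fps (\<lambda>n. \<Sum>\<beta>\<in>{\<beta>\<in>V. \<beta> \<in> fixed_field (p ^ (s * Suc n))}.
       field_char_sum p (zeta p) (s * Suc n) (Polynomial.smult \<beta> f))"
    using frobenius_stable_L_polynomial[OF p w s f d V] by blast
  have "(\<lambda>n. \<Sum>\<beta>\<in>{\<beta>\<in>V. \<beta> \<in> fixed_field (p ^ (s * Suc n))}.
       field_char_sum p (zeta p) (s * Suc n) (Polynomial.smult \<beta> f)) = (\<lambda>n. of_int (S n))"
    unfolding S_def V_def by (rule ext, rule affine_count_char_sum[OF p w sn fn, symmetric])
  hence P': "fps_deriv P = P * Abs_fps (\<lambda>n. of_int (S n))" using P(3) by simp
  define C where "C = Abs_fps (\<lambda>n. of_rat (L $ n) :: complex)"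
  have "fps_deriv C = C * Abs_fps (\<lambda>n. of_int (S n))"
  proof (rule fps_ext)
    fix n
    have "of_rat (of_nat (Suc n) * L $ Suc n) = (of_rat (\<Sum>i\<le>n. L $ i * of_int (S (n - i))) :: complex)"
      using log_deriv_coeff[OF L(2), of n] by (simp only: S_def fps_nth_Abs_fps)
    thus "fps_deriv C $ n = (C * Abs_fps (\<lambda>n. of_int (S n))) $ n"
      by (simp add: C_def fps_mult_nth of_rat_sum of_rat_mult atLeast0AtMost of_rat_add)
  qed
  hence "C = P" by (rule log_deriv_unique[OF _ P']) (simp_all add: C_def L P)
  hence Lz: "L $ n = 0" if "n > N" for n
    using P(2)[OF that] by (metis C_def fps_nth_Abs_fps of_rat_eq_0_iff)
  have val: "vge p (real (Suc n) * (real s / real \<sigma>)) (of_int (S n))" for n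
  proof -
    define r where "r = s * Suc n"
    have r1: "r \<ge> 1" using sn by (simp add: r_def)
    \<comment> \<open>The largest k with \<sigma> k < r, so that k + 1 is the ceiling of r /
      \<sigma>.\<close>
    define k where "k = (r - 1) div \<sigma>"
    have "\<sigma> * k < r" using r1 times_div_less_eq_dividend[of \<sigma> "r - 1"] unfolding k_def by linarith
    hence "int p ^ Suc k dvd S n"
      unfolding S_def r_def by (intro affine_count_dvd[OF p sn fn \<sigma>]) auto
    hence "vge p (real (Suc k)) (of_int (S n))" by (rule vge_of_int[OF p(1)])
    moreover have "real (Suc n) * (real s / real \<sigma>) \<le> real (Suc k)"
    proof -
      have "r - 1 < \<sigma> * Suc k" unfolding k_def using \<sigma>(1) by (metis dividend_less_times_div mult_Suc_right add.commute not_less_eq_eq One_nat_def less_eq_Suc_le)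
      hence "r \<le> \<sigma> * Suc k" using r1 by linarith
      hence "real r \<le> real \<sigma> * real (Suc k)" by (metis of_nat_le_iff of_nat_mult)
      thus ?thesis using \<sigma>(1) by (simp add: r_def field_simps)
    qed
    ultimately show ?thesis by (rule vge_mono)
  qed
  have "slope_datum p N (real s / real \<sigma>) L"
    unfolding slope_datum_def using L Lz val by (auto simp: S_def)
  thus ?thesis by (rule coeff_valuation_of_power_sums[OF p(1)])
qed

subsection \<open>Existence of valuation rings\<close>

definition is_subring :: "'a::comm_ring_1 set \<Rightarrow> bool" where
  "is_subring S \<longleftrightarrow> 1 \<in> S \<and> (\<forall>a\<in>S. \<forall>b\<in>S. a + b \<in> S \<and> a - b \<in> S \<and> a * b \<in> S)"

lemma is_subringD:
  assumes "is_subring S"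
  shows "1 \<in> S" "0 \<in> S" "a \<in> S \<Longrightarrow> b \<in> S \<Longrightarrow> a + b \<in> S" "a \<in> S \<Longrightarrow> b \<in> S \<Longrightarrow> a - b \<in> S"
    "a \<in> S \<Longrightarrow> b \<in> S \<Longrightarrow> a * b \<in> S" "a \<in> S \<Longrightarrow> - a \<in> S" "a \<in> S \<Longrightarrow> a ^ n \<in> S"
proof -
  show 1: "1 \<in> S" using assms by (simp add: is_subring_def)
  have "1 - 1 \<in> S" using assms 1 unfolding is_subring_def by blast
  thus 0: "0 \<in> S" by simp
  show "a \<in> S \<Longrightarrow> b \<in> S \<Longrightarrow> a + b \<in> S" "a \<in> S \<Longrightarrow> b \<in> S \<Longrightarrow> a - b \<in> S"
    "a \<in> S \<Longrightarrow> b \<in> S \<Longrightarrow> a * b \<in> S" using assms by (auto simp: is_subring_def)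
  have "a \<in> S \<Longrightarrow> 0 - a \<in> S" using assms 0 unfolding is_subring_def by blast
  thus "a \<in> S \<Longrightarrow> - a \<in> S" by simp
  show "a \<in> S \<Longrightarrow> a ^ n \<in> S" by (induction n) (use assms 1 in \<open>auto simp: is_subring_def\<close>)
qed

lemma is_subring_sum:
  assumes "is_subring S" "\<And>i. i \<in> A \<Longrightarrow> f i \<in> S"
  shows "sum f A \<in> S"
  using assms(2) by (induction A rule: infinite_finite_induct) (auto intro: is_subringD[OF assms(1)])

lemma subring_iff_is_subring:
  fixes S :: "'a::field set"
  shows "subring S ring_of_type_algebra \<longleftrightarrow> is_subring S"
proof -
  interpret F: field "ring_of_type_algebra :: 'a ring" by (rule field_from_type_algebra)
  have neg: "\<ominus>\<^bsub>ring_of_type_algebra\<^esub> a = - a" for a :: 'a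
    by (rule F.minus_equality) (simp_all add: ring_of_type_algebra_def)
  show ?thesis
  proof
    assume S: "subring S ring_of_type_algebra"
    have add: "a + b \<in> S" and mul: "a * b \<in> S" if "a \<in> S" "b \<in> S" for a b
      using subringE(6,7)[OF S] that by (auto simp: ring_of_type_algebra_def)
    have minus: "- a \<in> S" if "a \<in> S" for a
      using subringE(5)[OF S that] by (simp add: neg)
    have one: "1 \<in> S" using subringE(3)[OF S] by (simp add: ring_of_type_algebra_def)
    have sub: "a - b \<in> S" if "a \<in> S" "b \<in> S" for a b
      using add[OF that(1) minus[OF that(2)]] by simp
    show "is_subring S" unfolding is_subring_def by (intro conjI ballI one add sub mul)
  next
    assume S: "is_subring S"
    show "subring S ring_of_type_algebra"
    proof (rule F.subringI)
      show "S \<subseteq> carrier ring_of_type_algebra" by (simp add: ring_of_type_algebra_def)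
      show "\<one>\<^bsub>ring_of_type_algebra\<^esub> \<in> S" using is_subringD(1)[OF S] by (simp add: ring_of_type_algebra_def)
      fix a assume a: "a \<in> S"
      show "\<ominus>\<^bsub>ring_of_type_algebra\<^esub> a \<in> S" unfolding neg by (rule is_subringD(6)[OF S a])
      fix b assume b: "b \<in> S"
      show "a \<otimes>\<^bsub>ring_of_type_algebra\<^esub> b \<in> S" "a \<oplus>\<^bsub>ring_of_type_algebra\<^esub> b \<in> S"
        using is_subringD[OF S] a b by (auto simp: ring_of_type_algebra_def)
    qed
  qed
qed

definition adjoin :: "'a::comm_ring_1 set \<Rightarrow> 'a \<Rightarrow> 'a set" where
  "adjoin S w = {poly P w | P. \<forall>i. Polynomial.coeff P i \<in> S}"

lemma adjoin_subring:
  assumes S: "is_subring S"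
  shows "is_subring (adjoin S w)" "S \<subseteq> adjoin S w" "w \<in> adjoin S w"
proof -
  have mem: "poly P w \<in> adjoin S w" if "\<forall>i. Polynomial.coeff P i \<in> S" for P
    using that by (auto simp: adjoin_def)
  have const: "a \<in> adjoin S w" if "a \<in> S" for a
  proof -
    have "\<forall>i. Polynomial.coeff [:a:] i \<in> S" using that is_subringD(2)[OF S] by (auto simp: coeff_pCons split: nat.splits)
    from mem[OF this] show ?thesis by simp
  qed
  thus "S \<subseteq> adjoin S w" by blast
  have "\<forall>i. Polynomial.coeff [:0, 1:] i \<in> S"
    using is_subringD(1,2)[OF S] by (auto simp: coeff_pCons split: nat.splits)
  from mem[OF this] show "w \<in> adjoin S w" by simp
  show "is_subring (adjoin S w)"
    unfolding is_subring_def
  proof (intro conjI ballI)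
    show "1 \<in> adjoin S w" using const is_subringD(1)[OF S] by blast
    fix a b assume "a \<in> adjoin S w" "b \<in> adjoin S w"
    then obtain P R where PR: "a = poly P w" "b = poly R w"
      "\<forall>i. Polynomial.coeff P i \<in> S" "\<forall>i. Polynomial.coeff R i \<in> S" by (auto simp: adjoin_def)
    have "poly (P + R) w \<in> adjoin S w" "poly (P - R) w \<in> adjoin S w" "poly (P * R) w \<in> adjoin S w"
      by (intro mem allI, simp add: PR is_subringD[OF S])
        (intro mem allI, simp add: PR is_subringD[OF S], intro mem allI,
         simp add: coeff_mult, intro is_subring_sum[OF S] is_subringD(5)[OF S], simp_all add: PR)
    thus "a + b \<in> adjoin S w" "a - b \<in> adjoin S w" "a * b \<in> adjoin S w" by (simp_all add: PR)
  qed
qed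

lemma adjoin_subset:
  assumes "is_subring T" "S \<subseteq> T" "w \<in> T"
  shows "adjoin S w \<subseteq> T"
proof
  fix a assume "a \<in> adjoin S w"
  then obtain P where P: "a = poly P w" "\<forall>i. Polynomial.coeff P i \<in> S" by (auto simp: adjoin_def)
  show "a \<in> T" unfolding P(1) poly_altdef
    by (intro is_subring_sum[OF assms(1)] is_subringD(5,7)[OF assms(1)] assms(3)) (use P assms in auto)
qed

text \<open>
  The degree-lowering step in the proof of Chevalley's extension theorem.
\<close>
lemma chevalley_step:
  fixes M :: "'a::field set"
  assumes M: "is_subring M" and unit: "\<And>b. b \<in> M \<Longrightarrow> inverse (1 - z * b) \<in> M" and z: "inverse z \<notin> M" "z \<in> M"
    and w: "w \<noteq> 0"
    and P: "\<forall>i. Polynomial.coeff P i \<in> (\<lambda>a. z * a) ` M" "Polynomial.degree P \<le> n" "poly P w = 1"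
    and R: "\<forall>i. Polynomial.coeff R i \<in> (\<lambda>a. z * a) ` M" "Polynomial.degree R \<le> m" "poly R (inverse w) = 1"
    and mn: "m \<le> n"
  shows "\<exists>P'. (\<forall>i. Polynomial.coeff P' i \<in> (\<lambda>a. z * a) ` M) \<and> Polynomial.degree P' < n \<and> poly P' w = 1"
proof -
  define J where "J = (\<lambda>a. z * a) ` M"
  have J0: "0 \<in> J" using is_subringD(2)[OF M] unfolding J_def by force
  have Jadd: "a + b \<in> J" "a - b \<in> J" if ab: "a \<in> J" "b \<in> J" for a b
  proof -
    obtain a' b' where "a' \<in> M" "b' \<in> M" "a = z * a'" "b = z * b'" using ab unfolding J_def by blast
    thus "a + b \<in> J" "a - b \<in> J" unfolding J_def
      using is_subringD(3,4)[OF M, of a' b'] by (auto simp flip: distrib_left right_diff_distrib)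
  qed
  have JM: "c * a \<in> J" if ac: "a \<in> J" "c \<in> M" for a c
  proof -
    obtain a' where "a' \<in> M" "a = z * a'" using ac unfolding J_def by blast
    hence "c * a = z * (c * a')" "c * a' \<in> M" using is_subringD(5)[OF M] ac by (auto simp: mult_ac)
    thus ?thesis unfolding J_def by blast
  qed
  have JsubM: "J \<subseteq> M" using z is_subringD(5)[OF M] by (auto simp: J_def)
  have z0: "z \<noteq> 0" using z is_subringD(2)[OF M] by auto
  have no1: "1 \<notin> J"
  proof
    assume "1 \<in> J"
    then obtain a where "a \<in> M" "1 = z * a" unfolding J_def by blast
    hence "inverse z = a" by (metis inverse_unique)
    thus False using z \<open>a \<in> M\<close> by simp
  qed
  define r where "r = Polynomial.coeff R"
  have r: "r i \<in> J" for i using R(1) by (simp add: r_def J_def)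
  obtain b where b: "b \<in> M" "r 0 = z * b" using r[of 0] by (auto simp: J_def)
  define e where "e = inverse (1 - r 0)"
  have e: "e \<in> M" using unit[OF b(1)] b(2) by (simp add: e_def)
  have ne: "1 - r 0 \<noteq> 0" using no1 r[of 0] by auto
  have sumR: "(\<Sum>i\<le>m. r i * inverse w ^ i) = 1"
    using R(3) unfolding r_def poly_altdef
    by (subst sum.mono_neutral_right[of "{..m}" "{..Polynomial.degree R}"]) (use R(2) in \<open>auto simp: coeff_eq_0\<close>)
  \<comment> \<open>A constant relation would put 1 into z M.\<close>
  have m1: "m \<ge> 1"
  proof (rule ccontr)
    assume "\<not> m \<ge> 1"
    hence "m = 0" by simp
    hence "r 0 = 1" using sumR by simp
    thus False using no1 r[of 0] by simp
  qed
  \<comment> \<open>Multiply R(1/w) = 1 by w^m and solve for w^m, which is possible because 1 - r 0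
    is a unit: w^m = T(w), with T of degree below m and coefficients in z M.\<close>
  define T where "T = (\<Sum>i<m. Polynomial.monom (e * r (m - i)) i)"
  have cT: "Polynomial.coeff T i = (if i < m then e * r (m - i) else 0)" for i
  proof -
    have "Polynomial.coeff T i = (\<Sum>j<m. if j = i then e * r (m - j) else 0)"
      by (simp add: T_def coeff_sum)
    thus ?thesis by simp
  qed
  have "poly T w = e * (\<Sum>i<m. r (m - i) * w ^ i)"
    by (simp add: T_def poly_sum poly_monom sum_distrib_left mult.assoc)
  also have "(\<Sum>i<m. r (m - i) * w ^ i) = (\<Sum>j\<in>{1..m}. r j * w ^ (m - j))"
    by (rule sum.reindex_bij_witness[of _ "\<lambda>j. m - j" "\<lambda>i. m - i"]) auto
  also have "\<dots> = (\<Sum>j\<in>{1..m}. r j * inverse w ^ j) * w ^ m"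
    unfolding sum_distrib_right using w
    by (intro sum.cong) (auto simp: power_diff divide_inverse power_inverse mult_ac)
  also have "(\<Sum>j\<in>{1..m}. r j * inverse w ^ j) = 1 - r 0"
  proof -
    have "{..m} = insert 0 {1..m}" by auto
    thus ?thesis using sumR by (simp add: algebra_simps)
  qed
  finally have Tw: "poly T w = w ^ m" using ne by (simp add: e_def)
  define c where "c = Polynomial.coeff P n"
  \<comment> \<open>The leading term c w^n is replaced by c w^(n-m) T(w), of lower degree.\<close>
  define P' where "P' = P - Polynomial.monom c n + Polynomial.monom c (n - m) * T"
  have cJ: "c \<in> J" using P(1) by (simp add: c_def J_def)
  have "Polynomial.coeff P' i \<in> J" for i
  proof -
    have "Polynomial.coeff P i \<in> J" using P(1) by (simp add: J_def)
    moreover have "Polynomial.coeff (Polynomial.monom c n) i \<in> J" using cJ J0 by simp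
    moreover have "Polynomial.coeff (Polynomial.monom c (n - m) * T) i \<in> J"
    proof -
      have "c * (e * r j) \<in> J" for j using JM[OF r is_subringD(5)[OF M, of c e]] cJ JsubM e by (auto simp: mult.assoc)
      thus ?thesis using J0 by (auto simp: coeff_monom_mult cT)
    qed
    ultimately show ?thesis unfolding P'_def coeff_add coeff_diff using Jadd by blast
  qed
  moreover have "Polynomial.degree P' < n"
  proof -
    have "Polynomial.coeff P' i = 0" if "i \<ge> n" for i
      using that P(2) mn m1 by (auto simp: P'_def c_def coeff_monom_mult cT coeff_eq_0)
    thus ?thesis using mn m1 by (metis degree_lessI le_trans less_eq_Suc_le One_nat_def)
  qed
  moreover have "poly P' w = 1"
    using P(3) Tw mn by (simp add: P'_def poly_monom flip: power_add)
  ultimately show ?thesis unfolding J_def by blast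
qed

text \<open>Zorn's lemma gives a maximal ring M between R and L without 1/z; this condition replaces
  the usual pair of a ring and a prime ideal. By maximality, adjoining any further w makes 1/z a
  polynomial in w, that is, 1 becomes one with coefficients in z M. If this happened for w and for
  1/w, relations of least degree could still be shortened by \<open>chevalley_step\<close>.\<close>

theorem exists_valuation_ring:
  fixes R L :: "'a::field set"
  assumes L: "is_subring L" "\<And>a. a \<in> L \<Longrightarrow> inverse a \<in> L" and R: "is_subring R" "R \<subseteq> L"
    and z: "z \<in> R" "inverse z \<notin> R"
  shows "\<exists>V. is_subring V \<and> R \<subseteq> V \<and> V \<subseteq> L \<and> inverse z \<notin> V \<and> (\<forall>w\<in>L. w \<in> V \<or> inverse w \<in> V)"
proof -
  define \<S> where "\<S> = {S. is_subring S \<and> R \<subseteq> S \<and> S \<subseteq> L \<and> inverse z \<notin> S}"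
  have "\<exists>M\<in>\<S>. \<forall>S\<in>\<S>. M \<subseteq> S \<longrightarrow> S = M"
  proof (rule subset_Zorn_nonempty)
    show "\<S> \<noteq> {}" using R z by (auto simp: \<S>_def)
    fix \<C> assume C: "\<C> \<noteq> {}" "subset.chain \<S> \<C>"
    hence sub: "\<C> \<subseteq> \<S>" and tot: "\<And>S T. S \<in> \<C> \<Longrightarrow> T \<in> \<C> \<Longrightarrow> S \<subseteq> T \<or> T \<subseteq> S"
      by (auto simp: subset.chain_def)
    have "is_subring (\<Union>\<C>)"
      unfolding is_subring_def
    proof (intro conjI ballI)
      obtain S where "S \<in> \<C>" using C by blast
      moreover from this have "1 \<in> S" using sub is_subringD(1) by (auto simp: \<S>_def)
      ultimately show "1 \<in> \<Union>\<C>" by blast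
      fix a b assume "a \<in> \<Union>\<C>" "b \<in> \<Union>\<C>"
      then obtain S T where "a \<in> S" "b \<in> T" "S \<in> \<C>" "T \<in> \<C>" by blast
      then obtain U where U: "a \<in> U" "b \<in> U" "U \<in> \<C>" using tot by blast
      hence "is_subring U" using sub by (auto simp: \<S>_def)
      thus "a + b \<in> \<Union>\<C>" "a - b \<in> \<Union>\<C>" "a * b \<in> \<Union>\<C>" using U is_subringD by blast+
    qed
    thus "\<Union>\<C> \<in> \<S>" using sub C by (auto simp: \<S>_def)
  qed
  then obtain M where M: "M \<in> \<S>" "\<And>S. S \<in> \<S> \<Longrightarrow> M \<subseteq> S \<Longrightarrow> S = M" by blast
  have Mr: "is_subring M" and RM: "R \<subseteq> M" and MsubL: "M \<subseteq> L" and zM: "inverse z \<notin> M"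
    using M(1) by (auto simp: \<S>_def)
  have zinM: "z \<in> M" using z RM by blast
  have z0: "z \<noteq> 0" using zM is_subringD(2)[OF Mr] by auto
  have max: "w \<in> M" if "w \<in> L" "inverse z \<notin> adjoin M w" for w
  proof -
    have "adjoin M w \<in> \<S>"
      using that adjoin_subring[OF Mr, of w] RM adjoin_subset[OF L(1) MsubL that(1)] by (auto simp: \<S>_def)
    thus ?thesis using M(2) adjoin_subring[OF Mr, of w] by blast
  qed
  \<comment> \<open>For s = 1 - z b, suppose that 1/z is a polynomial in 1/s over M. Clearing
    denominators puts s^k / z into M, and s^k is 1 modulo z M, so z would be invertible in
    M.\<close>
  have unit: "inverse (1 - z * b) \<in> M" if b: "b \<in> M" for b
  proof (rule max)
    have sM: "1 - z * b \<in> M" using b zinM is_subringD[OF Mr] by auto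
    thus "inverse (1 - z * b) \<in> L" using MsubL L by blast
    define s where "s = 1 - z * b"
    have pow: "\<exists>b'\<in>M. s ^ k = 1 - z * b'" for k
    proof (induction k)
      case 0
      show ?case using is_subringD(2)[OF Mr] by (intro bexI[of _ 0]) auto
    next
      case (Suc k)
      then obtain b' where b': "b' \<in> M" "s ^ k = 1 - z * b'" by blast
      have "s ^ Suc k = 1 - z * (b + b' - z * b * b')" 
        by (simp only: power_Suc b'(2)) (simp add: s_def algebra_simps)
      moreover have "b + b' - z * b * b' \<in> M" using b b' zinM by (intro is_subringD[OF Mr])
      ultimately show ?case by blast
    qed
    have no: "1 \<noteq> z * a" if "a \<in> M" for a
      using that zM by (metis inverse_unique)
    have s0: "s \<noteq> 0" using no[OF b] by (auto simp: s_def)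
    show "inverse z \<notin> adjoin M (inverse (1 - z * b))"
    proof
      assume "inverse z \<in> adjoin M (inverse (1 - z * b))"
      then obtain P where P: "inverse z = poly P (inverse s)" "\<forall>i. Polynomial.coeff P i \<in> M"
        unfolding adjoin_def s_def by blast
      define k where "k = Polynomial.degree P"
      have "s ^ k * inverse z = (\<Sum>i\<le>k. Polynomial.coeff P i * s ^ (k - i))"
        unfolding P(1) poly_altdef k_def[symmetric] sum_distrib_left using s0
        by (intro sum.cong) (auto simp: power_diff divide_inverse power_inverse mult_ac)
      also have "\<dots> \<in> M"
        by (intro is_subring_sum[OF Mr] is_subringD(5,7)[OF Mr]) (use P sM in \<open>auto simp: s_def\<close>)
      finally have a: "s ^ k * inverse z \<in> M" .
      obtain b' where b': "b' \<in> M" "s ^ k = 1 - z * b'" using pow by blast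
      have "z * (s ^ k * inverse z + b') = s ^ k + z * b'" using z0 by (simp add: field_simps)
      hence "1 = z * (s ^ k * inverse z + b')" using b'(2) by simp
      thus False using no is_subringD(3)[OF Mr a b'(1)] by blast
    qed
  qed
  have val: "w \<in> M \<or> inverse w \<in> M" if wL: "w \<in> L" for w
  proof (rule ccontr)
    assume neg: "\<not> (w \<in> M \<or> inverse w \<in> M)"
    hence w0: "w \<noteq> 0" using is_subringD(2)[OF Mr] by auto
    define Q where "Q = (\<lambda>w n. \<exists>P. (\<forall>i. Polynomial.coeff P i \<in> (\<lambda>a. z * a) ` M) \<and> Polynomial.degree P \<le> n \<and> poly P w = 1)"
    have ex: "\<exists>n. Q v n" if v: "v \<in> L" "v \<notin> M" for v
    proof -
      have "inverse z \<in> adjoin M v" using max[OF v(1)] v(2) by blast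
      then obtain P where P: "inverse z = poly P v" "\<forall>i. Polynomial.coeff P i \<in> M" unfolding adjoin_def by blast
      have "poly (Polynomial.smult z P) v = 1" using z0 P(1)[symmetric] by simp
      moreover have "\<forall>i. Polynomial.coeff (Polynomial.smult z P) i \<in> (\<lambda>a. z * a) ` M"
        using P(2) by (auto intro!: imageI)
      ultimately show ?thesis unfolding Q_def by blast
    qed
    define n where "n = (LEAST n. Q w n)"
    define m where "m = (LEAST n. Q (inverse w) n)"
    have n: "Q w n" unfolding n_def by (rule LeastI_ex, rule ex[OF wL]) (use neg in blast)
    have m: "Q (inverse w) m" unfolding m_def by (rule LeastI_ex, rule ex[OF L(2)[OF wL]]) (use neg in blast)
    have down: "\<exists>k<i. Q v k" if vi: "v \<noteq> 0" "Q v i" "Q (inverse v) j" "j \<le> i" for v i j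
    proof -
      obtain P where P: "\<forall>l. Polynomial.coeff P l \<in> (\<lambda>a. z * a) ` M" "Polynomial.degree P \<le> i" "poly P v = 1"
        using vi(2) unfolding Q_def by blast
      obtain P2 where P2: "\<forall>l. Polynomial.coeff P2 l \<in> (\<lambda>a. z * a) ` M" "Polynomial.degree P2 \<le> j" "poly P2 (inverse v) = 1"
        using vi(3) unfolding Q_def by blast
      show ?thesis using chevalley_step[OF Mr unit zM zinM vi(1) P P2 vi(4)] unfolding Q_def by blast
    qed
    show False
    proof (cases "m \<le> n")
      case True
      then obtain k where "k < n" "Q w k" using down[OF w0 n m] by blast
      thus False unfolding n_def using not_less_Least by blast
    next
      case False
      have "Q (inverse (inverse w)) n" using n by simp
      then obtain k where "k < m" "Q (inverse w) k" using down[of "inverse w" m n] w0 m False by auto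
      thus False unfolding m_def using not_less_Least by blast
    qed
  qed
  show ?thesis using Mr RM MsubL zM val by blast
qed

subsection \<open>Arithmetic in a valuation ring\<close>

definition fraction_closed :: "'a::field set \<Rightarrow> bool" where
  "fraction_closed L \<longleftrightarrow> is_subring L \<and> (\<forall>a\<in>L. inverse a \<in> L)"

lemma valuation_ringD:
  assumes "valuation_ring C L V"
  shows "is_subring V" "C \<subseteq> V" "V \<subseteq> L" "w \<in> L \<Longrightarrow> w \<in> V \<or> inverse w \<in> V"
  using assms by (auto simp: valuation_ring_def subring_iff_is_subring)

lemma valuation_ideal:
  assumes V: "valuation_ring C L V" and L: "fraction_closed L"
  defines "m \<equiv> valuation_ideal V"
  shows "m \<subseteq> V" "0 \<in> m" "1 \<notin> m" "a \<in> m \<Longrightarrow> b \<in> V \<Longrightarrow> a * b \<in> m" "a \<in> m \<Longrightarrow> b \<in> m \<Longrightarrow> a + b \<in> m"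
    "a \<in> m \<Longrightarrow> b \<in> m \<Longrightarrow> a - b \<in> m" "a \<in> V \<Longrightarrow> a \<notin> m \<Longrightarrow> a \<noteq> 0 \<and> inverse a \<in> V"
    "a \<in> L \<Longrightarrow> a \<notin> V \<Longrightarrow> a \<noteq> 0 \<and> inverse a \<in> m"
    "a \<in> V \<Longrightarrow> inverse a \<in> V \<Longrightarrow> a \<noteq> 0 \<Longrightarrow> a \<notin> m"
proof -
  note R = is_subringD[OF valuation_ringD(1)[OF V]]
  show "m \<subseteq> V" "0 \<in> m" "1 \<notin> m" using R by (auto simp: m_def valuation_ideal_def)
  have mult: "a * b \<in> m" if "a \<in> m" "b \<in> V" for a b
  proof (cases "a * b = 0")
    case False
    have "inverse (a * b) \<notin> V"
    proof
      assume "inverse (a * b) \<in> V"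
      hence "b * inverse (a * b) \<in> V" using that R by blast
      also have "b * inverse (a * b) = inverse a" using False by (simp add: field_simps)
      finally show False using False that by (auto simp: m_def valuation_ideal_def)
    qed
    thus ?thesis using that R by (auto simp: m_def valuation_ideal_def)
  qed (use R in \<open>auto simp: m_def valuation_ideal_def\<close>)
  thus "a \<in> m \<Longrightarrow> b \<in> V \<Longrightarrow> a * b \<in> m" by blast
  have add: "a + b \<in> m" if ab: "a \<in> m" "b \<in> m" for a b
  proof (cases "a = 0 \<or> b = 0")
    case False
    have aL: "a \<in> L" "b \<in> L" using ab valuation_ringD(3)[OF V] by (auto simp: m_def valuation_ideal_def)
    have "a * inverse b \<in> L"
      using L aL is_subringD(5) unfolding fraction_closed_def by blast
    hence "a * inverse b \<in> V \<or> inverse (a * inverse b) \<in> V" by (rule valuation_ringD(4)[OF V])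
    thus ?thesis
    proof
      assume "a * inverse b \<in> V"
      hence "b * (a * inverse b + 1) \<in> m" using R by (intro mult ab) auto
      also have "b * (a * inverse b + 1) = a + b" using False by (simp add: algebra_simps)
      finally show ?thesis .
    next
      assume "inverse (a * inverse b) \<in> V"
      hence "a * (inverse (a * inverse b) + 1) \<in> m" using R by (intro mult ab) auto
      also have "a * (inverse (a * inverse b) + 1) = a + b" using False by (simp add: algebra_simps)
      finally show ?thesis .
    qed
  qed (use that in auto)
  thus "a \<in> m \<Longrightarrow> b \<in> m \<Longrightarrow> a + b \<in> m" by blast
  have neg: "- b \<in> m" if "b \<in> m" for b using mult[OF that R(6)[OF R(1)]] by simp
  show "a \<in> m \<Longrightarrow> b \<in> m \<Longrightarrow> a - b \<in> m" using add[of a "- b"] neg[of b] by simp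
  show "a \<in> V \<Longrightarrow> a \<notin> m \<Longrightarrow> a \<noteq> 0 \<and> inverse a \<in> V" by (auto simp: m_def valuation_ideal_def)
  show "a \<noteq> 0 \<and> inverse a \<in> m" if "a \<in> L" "a \<notin> V"
  proof -
    have "a \<noteq> 0" using that R by auto
    thus ?thesis using that valuation_ringD(4)[OF V that(1)] by (auto simp: m_def valuation_ideal_def)
  qed
  show "a \<in> V \<Longrightarrow> inverse a \<in> V \<Longrightarrow> a \<noteq> 0 \<Longrightarrow> a \<notin> m" by (auto simp: m_def valuation_ideal_def)
qed

lemma valuation_ideal_sum:
  assumes V: "valuation_ring C L V" and L: "fraction_closed L" and "\<And>i. i \<in> A \<Longrightarrow> f i \<in> valuation_ideal V"
  shows "sum f A \<in> valuation_ideal V"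
  using assms(3) by (induction A rule: infinite_finite_induct) (auto intro: valuation_ideal[OF V L])

text \<open>If a were outside V, then 1/a would be in the ideal and so would 1, its n-th power times
  a^n. The second claim is similar, with 1/a in V.\<close>

lemma valuation_power:
  assumes V: "valuation_ring C L V" and L: "fraction_closed L" and a: "a \<in> L" and n: "n > 0"
  shows "a ^ n \<in> V \<longleftrightarrow> a \<in> V" "a ^ n \<in> valuation_ideal V \<longleftrightarrow> a \<in> valuation_ideal V"
proof -
  note R = is_subringD[OF valuation_ringD(1)[OF V]]
  note I = valuation_ideal[OF V L]
  obtain k where k: "n = Suc k" using n by (cases n) auto
  have up: "b ^ n \<in> valuation_ideal V" if "b \<in> valuation_ideal V" for b
    unfolding k power_Suc using that I(1) R(7) by (intro I(4)) auto
  show 1: "a ^ n \<in> V \<longleftrightarrow> a \<in> V"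
  proof
    assume an: "a ^ n \<in> V"
    show "a \<in> V"
    proof (rule ccontr)
      assume "a \<notin> V"
      hence "a \<noteq> 0" "inverse a \<in> valuation_ideal V" using I(8) a by auto
      hence "inverse a ^ n * a ^ n \<in> valuation_ideal V" using up an I(4) by blast
      thus False using I(3) \<open>a \<noteq> 0\<close> by (simp flip: power_mult_distrib)
    qed
  qed (use R in auto)
  show "a ^ n \<in> valuation_ideal V \<longleftrightarrow> a \<in> valuation_ideal V"
  proof
    assume an: "a ^ n \<in> valuation_ideal V"
    hence aV: "a \<in> V" using 1 I(1) by blast
    show "a \<in> valuation_ideal V"
    proof (rule ccontr)
      assume "a \<notin> valuation_ideal V"
      hence "a \<noteq> 0" "inverse a \<in> V" using I(7) aV by auto
      hence "a ^ n * inverse a ^ n \<in> valuation_ideal V" using an R(7) by (intro I(4)) auto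
      thus False using I(3) \<open>a \<noteq> 0\<close> by (simp flip: power_mult_distrib)
    qed
  qed (rule up)
qed

text \<open>Equality modulo the group of 1-units: u and v have the same order and the same leading
  coefficient. It serves where a valuation map would be used.\<close>

definition same_lead :: "'a::field set \<Rightarrow> 'a \<Rightarrow> 'a \<Rightarrow> bool" where
  "same_lead V u v \<longleftrightarrow> u \<noteq> 0 \<and> v \<noteq> 0 \<and> u / v - 1 \<in> valuation_ideal V"

lemma same_lead:
  assumes V: "valuation_ring C L V" and L: "fraction_closed L"
  shows "u \<noteq> 0 \<Longrightarrow> same_lead V u u"
    "same_lead V u v \<Longrightarrow> u / v \<in> V \<and> v / u \<in> V"
    "same_lead V u v \<Longrightarrow> same_lead V v u"
    "same_lead V u v \<Longrightarrow> same_lead V u' v' \<Longrightarrow> same_lead V (u * u') (v * v')"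
    "same_lead V u v \<Longrightarrow> same_lead V v w \<Longrightarrow> same_lead V u w"
    "same_lead V u v \<Longrightarrow> same_lead V (u ^ n) (v ^ n)"
    "same_lead V u v \<Longrightarrow> same_lead V (inverse u) (inverse v)"
    "same_lead V u v \<Longrightarrow> e / v \<in> valuation_ideal V \<Longrightarrow> same_lead V (u + e) v"
    "same_lead V u v \<Longrightarrow> u \<in> V \<longleftrightarrow> v \<in> V"
    "same_lead V u v \<Longrightarrow> u \<in> valuation_ideal V \<longleftrightarrow> v \<in> valuation_ideal V"
proof -
  note R = is_subringD[OF valuation_ringD(1)[OF V]]
  note I = valuation_ideal[OF V L]
  define m where "m = valuation_ideal V"
  show refl: "same_lead V u u" if "u \<noteq> 0" for u using that I(2) by (simp add: same_lead_def)
  have unit: "e \<noteq> 0 \<and> e \<in> V \<and> inverse e \<in> V" if "e - 1 \<in> m" for e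
  proof -
    have eV: "e \<in> V" using R(3)[of "e - 1" 1] R(1) that I(1) by (auto simp: m_def)
    have "e \<notin> m"
    proof
      assume "e \<in> m"
      hence "e - (e - 1) \<in> m" using that I(6) unfolding m_def by blast
      thus False using I(3) by (simp add: m_def)
    qed
    thus ?thesis using I(7) eV unfolding m_def by blast
  qed
  show quot: "u / v \<in> V \<and> v / u \<in> V" if "same_lead V u v" for u v
    using that unit[of "u / v"] by (auto simp: same_lead_def m_def inverse_eq_divide)
  have prod1: "e * e' - 1 \<in> m" if "e - 1 \<in> m" "e' - 1 \<in> m" for e e'
  proof -
    have "(e - 1) * e' + (e' - 1) \<in> m" using that unit I(4,5) unfolding m_def by blast
    thus ?thesis by (simp add: algebra_simps)
  qed
  have inv1: "inverse e - 1 \<in> m" if "e - 1 \<in> m" for e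
  proof -
    have "0 - (e - 1) * inverse e \<in> m" using that unit[OF that] I(2,4,6) unfolding m_def by blast
    moreover have "0 - (e - 1) * inverse e = inverse e - 1" using unit[OF that] by (simp add: algebra_simps)
    ultimately show ?thesis by simp
  qed
  show sym: "same_lead V v u" if "same_lead V u v" for u v
    using that inv1[of "u / v"] by (auto simp: same_lead_def m_def)
  show mult: "same_lead V (u * u') (v * v')" if "same_lead V u v" "same_lead V u' v'" for u v u' v'
    using that prod1[of "u / v" "u' / v'"] by (auto simp: same_lead_def m_def)
  show "same_lead V u w" if "same_lead V u v" "same_lead V v w"
    using that prod1[of "u / v" "v / w"] by (auto simp: same_lead_def m_def)
  show "same_lead V (u ^ n) (v ^ n)" if "same_lead V u v"
    by (induction n) (use that in \<open>auto intro: mult refl\<close>)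
  show "same_lead V (inverse u) (inverse v)" if "same_lead V u v"
    using sym[OF that] by (auto simp: same_lead_def divide_inverse mult.commute)
  show "same_lead V (u + e) v" if uv: "same_lead V u v" and e: "e / v \<in> valuation_ideal V"
  proof -
    have "(u / v - 1) + e / v \<in> m" using uv e I(5) unfolding m_def same_lead_def by blast
    moreover have "(u / v - 1) + e / v = (u + e) / v - 1" by (simp add: add_divide_distrib)
    ultimately have *: "(u + e) / v - 1 \<in> m" by simp
    hence "(u + e) / v \<noteq> 0" using unit by blast
    thus ?thesis using * uv by (auto simp: same_lead_def m_def)
  qed
  have V1: "u \<in> V" if "same_lead V u v" "v \<in> V" for u v
  proof -
    have "u = v * (u / v)" using that by (simp add: same_lead_def)
    thus ?thesis using quot[OF that(1)] that(2) R(5) by metis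
  qed
  show "u \<in> V \<longleftrightarrow> v \<in> V" if "same_lead V u v" using V1 that sym by blast
  have M1: "u \<in> m" if "same_lead V u v" "v \<in> m" for u v
  proof -
    have "u = v * (u / v)" using that by (simp add: same_lead_def)
    thus ?thesis using quot[OF that(1)] that(2) I(4) unfolding m_def by metis
  qed
  show "u \<in> valuation_ideal V \<longleftrightarrow> v \<in> valuation_ideal V" if "same_lead V u v"
    using M1 that sym unfolding m_def by blast
qed

subsection \<open>The curve polynomial\<close>

lemma of_polynomial_simps [simp]:
  "of_polynomial 0 = 0" "of_polynomial 1 = 1" "of_polynomial (h + k) = of_polynomial h + of_polynomial k"
  "of_polynomial (h - k) = of_polynomial h - of_polynomial k" "of_polynomial (- h) = - of_polynomial h"
  "of_polynomial (h * k) = of_polynomial h * of_polynomial k"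
  "of_polynomial h = 0 \<longleftrightarrow> h = 0" "of_polynomial h = of_polynomial k \<longleftrightarrow> h = k"
  by (simp_all add: of_polynomial_def)

lemma of_polynomial_power [simp]: "of_polynomial (h ^ n) = of_polynomial h ^ n"
  by (induction n) simp_all

lemma map_poly_hom_mult:
  fixes \<phi> :: "'a::comm_ring_1 \<Rightarrow> 'b::comm_ring_1"
  assumes "\<phi> 0 = 0" "\<And>a b. \<phi> (a + b) = \<phi> a + \<phi> b" "\<And>a b. \<phi> (a * b) = \<phi> a * \<phi> b"
  shows "map_poly \<phi> (H * G) = map_poly \<phi> H * map_poly \<phi> G" "map_poly \<phi> (H + G) = map_poly \<phi> H + map_poly \<phi> G"
proof -
  have "\<phi> (sum f A) = (\<Sum>i\<in>A. \<phi> (f i))" for f :: "nat \<Rightarrow> 'a" and A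
    by (induction A rule: infinite_finite_induct) (auto simp: assms)
  thus "map_poly \<phi> (H * G) = map_poly \<phi> H * map_poly \<phi> G"
    by (intro poly_eqI) (simp add: coeff_map_poly coeff_mult assms)
  show "map_poly \<phi> (H + G) = map_poly \<phi> H + map_poly \<phi> G"
    by (intro poly_eqI) (simp add: coeff_map_poly assms)
qed

text \<open>A polynomial in two variables has \<open>x\<close> as inner and \<open>y\<close> as outer variable.\<close>

definition eval2 :: "'k::finite_field ambient \<Rightarrow> 'k alg_closure poly poly \<Rightarrow> 'k ambient" where
  "eval2 y H = poly (map_poly of_polynomial H) y"

definition eval_at :: "'a::comm_ring_1 \<Rightarrow> 'a \<Rightarrow> 'a poly poly \<Rightarrow> 'a" where
  "eval_at a b H = poly (poly H [:b:]) a"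

lemma eval2_simps [simp]:
  "eval2 y 0 = 0" "eval2 y 1 = 1" "eval2 y (H + G) = eval2 y H + eval2 y G" "eval2 y (H * G) = eval2 y H * eval2 y G"
  "eval2 y (pCons h H) = of_polynomial h + y * eval2 y H" "eval2 y (Polynomial.smult h H) = of_polynomial h * eval2 y H"
  "eval2 y (Polynomial.monom h n) = of_polynomial h * y ^ n"
proof -
  show 0: "eval2 y 0 = 0" and 1: "eval2 y 1 = 1" by (simp_all add: eval2_def)
  show "eval2 y (H + G) = eval2 y H + eval2 y G" "eval2 y (H * G) = eval2 y H * eval2 y G" for H G
    by (simp_all add: eval2_def map_poly_hom_mult)
  show "eval2 y (pCons h H) = of_polynomial h + y * eval2 y H" by (simp add: eval2_def map_poly_pCons)
  show "eval2 y (Polynomial.monom h n) = of_polynomial h * y ^ n" by (simp add: eval2_def map_poly_monom poly_monom)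
  show "eval2 y (Polynomial.smult h H) = of_polynomial h * eval2 y H"
    by (induction H) (simp_all add: eval2_def map_poly_pCons algebra_simps)
qed

lemma eval2_diff [simp]: "eval2 y (H - G) = eval2 y H - eval2 y G"
  using eval2_simps(3)[of y "H - G" G] by simp

lemma eval2_power [simp]: "eval2 y (H ^ n) = eval2 y H ^ n"
  by (induction n) simp_all

lemma eval_at_simps [simp]:
  "eval_at a b 0 = 0" "eval_at a b 1 = 1" "eval_at a b (H + G) = eval_at a b H + eval_at a b G"
  "eval_at a b (H - G) = eval_at a b H - eval_at a b G"
  "eval_at a b (H * G) = eval_at a b H * eval_at a b G" "eval_at a b (H ^ n) = eval_at a b H ^ n"
  "eval_at a b [:h:] = poly h a" "eval_at a b [:0, 1:] = b"
  by (simp_all add: eval_at_def poly_power)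

definition curve_poly :: "nat \<Rightarrow> 'a::comm_ring_1 poly \<Rightarrow> 'a poly poly" where
  "curve_poly q g = Polynomial.monom 1 q - Polynomial.monom 1 1 - [:g:]"

lemma curve_poly_degree:
  fixes g :: "'a::field poly"
  assumes "q \<ge> 2"
  shows "Polynomial.degree (curve_poly q g) = q" "Polynomial.coeff (curve_poly q g) q = 1"
proof -
  show 1: "Polynomial.coeff (curve_poly q g) q = 1"
    using assms by (cases q) (auto simp: curve_poly_def)
  have "Polynomial.coeff (curve_poly q g) i = 0" if "i > q" for i
    using assms that by (cases i) (auto simp: curve_poly_def)
  hence "Polynomial.degree (curve_poly q g) \<le> q" by (intro degree_le) auto
  moreover have "q \<le> Polynomial.degree (curve_poly q g)" using 1 by (intro le_degree) simp
  ultimately show "Polynomial.degree (curve_poly q g) = q" by simp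
qed

lemma eval_curve_poly:
  "eval2 y (curve_poly q g) = y ^ q - y - of_polynomial g"
  "eval_at a b (curve_poly q g) = b ^ q - b - poly g a"
  by (simp_all add: curve_poly_def) (simp add: eval_at_def poly_monom poly_power)

lemma poly_altdef_le:
  fixes P :: "'a::comm_ring_1 poly"
  assumes "Polynomial.degree P \<le> n"
  shows "poly P x = (\<Sum>i\<le>n. Polynomial.coeff P i * x ^ i)"
  unfolding poly_altdef using assms
  by (intro sum.mono_neutral_left) (auto simp: coeff_eq_0)

lemma coeff_pcompose_monom_1:
  fixes c :: "'a::comm_ring_1 poly"
  assumes "q > 0"
  shows "Polynomial.coeff (pcompose c (Polynomial.monom 1 q)) n =
     (if q dvd n then Polynomial.coeff c (n div q) else 0)"
proof (induction c arbitrary: n)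
  case (pCons a c)
  have "Polynomial.coeff (pcompose (pCons a c) (Polynomial.monom 1 q)) n =
      Polynomial.coeff [:a:] n + (if n < q then 0 else Polynomial.coeff (pcompose c (Polynomial.monom 1 q)) (n - q))"
    by (simp add: pcompose_pCons coeff_monom_mult)
  also have "\<dots> = (if q dvd n then Polynomial.coeff (pCons a c) (n div q) else 0)"
  proof (cases "n < q")
    case True
    thus ?thesis using assms by (cases n) (auto dest: dvd_imp_le)
  next
    case False
    then obtain m where m: "n = q + m" by (metis le_Suc_ex not_less)
    have "n \<noteq> 0" using False assms by simp
    hence "Polynomial.coeff [:a:] n = 0" by (cases n) auto
    thus ?thesis using False assms pCons.IH[of m] by (simp add: m)
  qed
  finally show ?case .
qed auto

text \<open>The variables x and y get the weights q and d, their pole orders at infinity.\<close>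

definition weight_subst :: "nat \<Rightarrow> nat \<Rightarrow> 'a::comm_ring_1 \<Rightarrow> 'a poly poly \<Rightarrow> 'a poly" where
  "weight_subst q d z H = poly (map_poly (\<lambda>c. pcompose c (Polynomial.monom 1 q)) H) (Polynomial.monom z d)"

lemma weight_subst_hom:
  "weight_subst q d z (H * G) = weight_subst q d z H * weight_subst q d z G"
  "weight_subst q d z (H + G) = weight_subst q d z H + weight_subst q d z G"
  by (simp_all add: weight_subst_def map_poly_hom_mult pcompose_add pcompose_mult)

text \<open>A monomial x^i y^j goes to a multiple of t^(q i + d j). For j below the y-degree m of H
  the exponent d m is not reached: q would divide m - j, which is positive and less than q.\<close>

lemma weight_subst_coeff:
  fixes H :: "'a::field poly poly"
  assumes q: "q > 0" "coprime d q" "Polynomial.degree H < q" and d: "d \<ge> 1"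
  shows "Polynomial.coeff (weight_subst q d z H) (d * Polynomial.degree H) =
     Polynomial.coeff (Polynomial.lead_coeff H) 0 * z ^ Polynomial.degree H"
proof -
  define m where "m = Polynomial.degree H"
  have "weight_subst q d z H = (\<Sum>j\<le>m. pcompose (Polynomial.coeff H j) (Polynomial.monom 1 q) * Polynomial.monom z d ^ j)"
  proof -
    have "Polynomial.degree (map_poly (\<lambda>c. pcompose c (Polynomial.monom 1 q)) H) \<le> m"
      by (intro degree_le) (auto simp: coeff_map_poly coeff_eq_0 m_def)
    thus ?thesis unfolding weight_subst_def by (subst poly_altdef_le) (auto simp: coeff_map_poly)
  qed
  also have "\<dots> = (\<Sum>j\<le>m. Polynomial.monom (z ^ j) (d * j) * pcompose (Polynomial.coeff H j) (Polynomial.monom 1 q))"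
    by (simp add: monom_power mult.commute)
  finally have "Polynomial.coeff (weight_subst q d z H) (d * m) =
      (\<Sum>j\<le>m. z ^ j * Polynomial.coeff (pcompose (Polynomial.coeff H j) (Polynomial.monom 1 q)) (d * m - d * j))"
    by (simp add: coeff_sum coeff_monom_mult not_less)
  also have "\<dots> = (\<Sum>j\<in>{m}. z ^ j * Polynomial.coeff (pcompose (Polynomial.coeff H j) (Polynomial.monom 1 q)) (d * m - d * j))"
  proof (rule sum.mono_neutral_right)
    show "\<forall>j\<in>{..m} - {m}. z ^ j * Polynomial.coeff (pcompose (Polynomial.coeff H j) (Polynomial.monom 1 q)) (d * m - d * j) = 0"
    proof
      fix j assume j: "j \<in> {..m} - {m}"
      have "\<not> q dvd d * m - d * j"
      proof
        assume "q dvd d * m - d * j"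
        hence "q dvd d * (m - j)" by (simp add: diff_mult_distrib2)
        hence "q dvd m - j" using q(2) by (simp add: coprime_commute coprime_dvd_mult_right_iff)
        thus False using j q(3) by (auto simp: m_def dest!: dvd_imp_le)
      qed
      thus "z ^ j * Polynomial.coeff (pcompose (Polynomial.coeff H j) (Polynomial.monom 1 q)) (d * m - d * j) = 0"
        by (simp add: coeff_pcompose_monom_1[OF q(1)])
    qed
  qed auto
  also have "\<dots> = Polynomial.coeff (Polynomial.coeff H m) 0 * z ^ m"
    using q(1) by (simp add: coeff_pcompose_monom_1[OF q(1)] poly_0_coeff_0)
  finally show ?thesis by (simp add: m_def)
qed

text \<open>
  Substituting \<open>t^q\<close> and \<open>z t^d\<close> for the variables, with \<open>z^q\<close> the leading coefficient of \<open>g\<close>,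
  kills the coefficient of \<open>t^(dq)\<close> in the curve polynomial, but not the top coefficient of
  a factor of smaller degree.
\<close>
lemma curve_poly_no_factor:
  fixes g :: "'a::alg_closed_field poly"
  assumes q: "q \<ge> 2" "coprime (Polynomial.degree g) q" "Polynomial.degree g \<ge> 1"
    and HG: "curve_poly q g = H * G" and deg: "0 < Polynomial.degree H" "Polynomial.degree H < q"
  shows False
proof -
  define d where "d = Polynomial.degree g"
  define M where "M = curve_poly q g"
  have M0: "M \<noteq> 0" using curve_poly_degree[OF q(1), of g] by (auto simp: M_def)
  have HG0: "H \<noteq> 0" "G \<noteq> 0" using M0 HG by (auto simp: M_def)
  have degs: "Polynomial.degree H + Polynomial.degree G = q"
    using degree_mult_eq[OF HG0] curve_poly_degree(1)[OF q(1), of g] HG by simp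
  have "Polynomial.lead_coeff H * Polynomial.lead_coeff G = 1"
    using curve_poly_degree[OF q(1), of g] HG by (metis lead_coeff_mult)
  hence "poly (Polynomial.lead_coeff H) 0 * poly (Polynomial.lead_coeff G) 0 = 1"
    by (metis poly_mult poly_1)
  hence lc: "Polynomial.coeff (Polynomial.lead_coeff H) 0 \<noteq> 0" "Polynomial.coeff (Polynomial.lead_coeff G) 0 \<noteq> 0"
    by (auto simp: poly_0_coeff_0)
  obtain z where z: "z ^ q = Polynomial.lead_coeff g" using nth_root_exists[of q "Polynomial.lead_coeff g"] q by auto
  have z0: "z \<noteq> 0" using z q by (auto simp: power_0_left)
  have big: "d * Polynomial.degree K \<le> Polynomial.degree (weight_subst q d z K) \<and> weight_subst q d z K \<noteq> 0"
    if "Polynomial.degree K < q" "Polynomial.coeff (Polynomial.lead_coeff K) 0 \<noteq> 0" for K :: "'a poly poly"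
  proof -
    have "Polynomial.coeff (weight_subst q d z K) (d * Polynomial.degree K) \<noteq> 0"
      using that q z0 by (subst weight_subst_coeff) (auto simp: d_def)
    thus ?thesis by (auto intro: le_degree)
  qed
  have B: "d * Polynomial.degree H \<le> Polynomial.degree (weight_subst q d z H)" "weight_subst q d z H \<noteq> 0"
      "d * Polynomial.degree G \<le> Polynomial.degree (weight_subst q d z G)" "weight_subst q d z G \<noteq> 0"
    using big[OF deg(2) lc(1)] big[OF _ lc(2)] degs deg by auto
  have W: "weight_subst q d z M = weight_subst q d z H * weight_subst q d z G"
    by (simp add: M_def HG weight_subst_hom)
  \<comment> \<open>The images of the factors have degree at least d times their y-degrees, which
    add up to q. The cancellation at t^(dq) leaves a smaller degree for the product.\<close>
  have "d * q = d * Polynomial.degree H + d * Polynomial.degree G" using degs by (metis distrib_left)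
  also have "\<dots> \<le> Polynomial.degree (weight_subst q d z M)" using B by (simp add: W degree_mult_eq)
  finally have ge: "d * q \<le> Polynomial.degree (weight_subst q d z M)" .
  have WM0: "weight_subst q d z M \<noteq> 0" using B by (simp add: W)
  have "M + (Polynomial.monom 1 1 + [:g:]) = Polynomial.monom 1 q" by (simp add: M_def curve_poly_def)
  hence "weight_subst q d z M + (weight_subst q d z (Polynomial.monom 1 1) + weight_subst q d z [:g:]) =
      weight_subst q d z (Polynomial.monom 1 q)" by (metis weight_subst_hom(2))
  hence Weq: "weight_subst q d z M + (Polynomial.monom z d + pcompose g (Polynomial.monom 1 q)) = Polynomial.monom (z ^ q) (d * q)"
    by (simp add: weight_subst_def map_poly_monom map_poly_pCons poly_monom monom_power pcompose_1)
  have "Polynomial.coeff (weight_subst q d z M) n = 0" if n: "n \<ge> d * q" for n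
  proof -
    have "d * 2 \<le> d * q" using q by (intro mult_le_mono2) auto
    hence "d * 2 \<le> n" using n by (rule order_trans)
    hence "n \<noteq> d" using q(3) by (simp add: d_def)
    moreover have "Polynomial.coeff (pcompose g (Polynomial.monom 1 q)) n = (if n = d * q then z ^ q else 0)"
    proof (cases "q dvd n")
      case True
      then obtain j where j: "n = q * j" by (elim dvdE)
      have "d \<le> j" using n j q(1) by (simp add: mult.commute)
      thus ?thesis using q(1) z by (cases "j = d") (auto simp: coeff_pcompose_monom_1 j d_def coeff_eq_0)
    next
      case False
      thus ?thesis using q(1) by (auto simp: coeff_pcompose_monom_1)
    qed
    ultimately show ?thesis using arg_cong[OF Weq, of "\<lambda>P. Polynomial.coeff P n"] by (simp split: if_splits)
  qed
  from this[OF ge] show False using WM0 by simp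
qed

text \<open>A relation of least y-degree, made primitive, divides the curve polynomial over the
  field of fractions, by pseudo-division. Gauss's lemma turns this into a genuine factor, which
  \<open>curve_poly_no_factor\<close> excludes.\<close>

lemma eval2_eq_0_small_degree:
  fixes g :: "'k::finite_field alg_closure poly"
  assumes q: "q \<ge> 2" "coprime (Polynomial.degree g) q" "Polynomial.degree g \<ge> 1"
    and y: "y ^ q - y = of_polynomial g"
    and H: "eval2 y H = 0" "Polynomial.degree H < q"
  shows "H = 0"
proof (rule ccontr)
  assume "H \<noteq> 0"
  define Q where "Q = (\<lambda>m. \<exists>H. H \<noteq> 0 \<and> Polynomial.degree H = m \<and> eval2 y H = 0)"
  define m where "m = (LEAST m. Q m)"
  have QH: "Q (Polynomial.degree H)" using H \<open>H \<noteq> 0\<close> by (auto simp: Q_def)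
  have "Q m" unfolding m_def using QH by (rule LeastI)
  then obtain R' where R': "R' \<noteq> 0" "Polynomial.degree R' = m" "eval2 y R' = 0" unfolding Q_def by blast
  have "m \<le> Polynomial.degree H" unfolding m_def by (rule Least_le[of Q, OF QH])
  hence mq: "m < q" using H by simp
  have least: "P = 0" if "eval2 y P = 0" "P = 0 \<or> Polynomial.degree P < m" for P
  proof (rule ccontr)
    assume "P \<noteq> 0"
    hence "Q (Polynomial.degree P)" "Polynomial.degree P < m" using that by (auto simp: Q_def)
    thus False using Least_le[of Q "Polynomial.degree P"] by (simp add: m_def)
  qed
  define R where "R = primitive_part R'"
  have R: "R \<noteq> 0" "Polynomial.degree R = m" "Polynomial.content R = 1" using R' by (auto simp: R_def)
  have "eval2 y (Polynomial.smult (Polynomial.content R') R) = 0" using R'(3) by (simp add: R_def del: eval2_simps)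
  hence evR: "eval2 y R = 0" using R'(1) by simp
  have mpos: "m > 0"
  proof (rule ccontr)
    assume "\<not> m > 0"
    then obtain c where "R = [:c:]" using R(2) by (auto elim: degree_eq_zeroE)
    thus False using evR R(1) by simp
  qed
  define M where "M = curve_poly q g"
  have evM: "eval2 y M = 0" by (simp add: M_def eval_curve_poly y)
  obtain D R1 where dm: "pseudo_divmod M R = (D, R1)" by (cases "pseudo_divmod M R")
  define c where "c = Polynomial.coeff R (Polynomial.degree R) ^ (Suc (Polynomial.degree M) - Polynomial.degree R)"
  have c0: "c \<noteq> 0" using R(1) by (simp add: c_def)
  have div: "Polynomial.smult c M = R * D + R1" "R1 = 0 \<or> Polynomial.degree R1 < m"
    using pseudo_divmod[OF R(1) dm] R(2) unfolding c_def by auto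
  have "eval2 y (R * D + R1) = 0" unfolding div(1)[symmetric] by (simp add: evM)
  hence "eval2 y R1 = 0" using evR by simp
  hence "R1 = 0" using div(2) by (rule least)
  hence "map_poly to_fract R dvd map_poly to_fract (Polynomial.smult c M)" using div(1) by (metis add_0_right dvd_triv_left fract_poly_dvd)
  hence "map_poly to_fract R dvd map_poly to_fract M" using c0 by (auto dest!: dvd_smult_cancel)
  hence "R dvd M" using R(3) by (rule fract_poly_dvdD)
  then obtain G where "M = R * G" by (elim dvdE)
  thus False using curve_poly_no_factor[OF q, of R G] mpos mq R(2) by (simp add: M_def)
qed

text \<open>The ring generated by x and y over the constants is thus the polynomial ring modulo the
  curve polynomial, and evaluation at a point of the curve is well defined on it. Since the curve
  polynomial is monic in y, division leaves a remainder of small degree.\<close>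

lemma eval2_eq_0_iff:
  fixes g :: "'k::finite_field alg_closure poly"
  assumes q: "q \<ge> 2" "coprime (Polynomial.degree g) q" "Polynomial.degree g \<ge> 1"
    and y: "y ^ q - y = of_polynomial g"
  shows "eval2 y H = 0 \<longleftrightarrow> curve_poly q g dvd H"
proof
  define M where "M = curve_poly q g"
  have evM: "eval2 y M = 0" by (simp add: M_def eval_curve_poly y)
  have M: "M \<noteq> 0" "Polynomial.degree M = q" "Polynomial.coeff M q = 1"
    using curve_poly_degree[OF q(1), of g] by (auto simp: M_def)
  {
    assume H: "eval2 y H = 0"
    obtain D R where dm: "pseudo_divmod H M = (D, R)" by (cases "pseudo_divmod H M")
    have div: "H = M * D + R" "R = 0 \<or> Polynomial.degree R < q"
      using pseudo_divmod[OF M(1) dm] M by auto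
    have "eval2 y R = 0" using H evM by (simp add: div(1))
    hence "R = 0" using div(2) eval2_eq_0_small_degree[OF q y] by blast
    thus "curve_poly q g dvd H" using div(1) by (simp add: M_def)
  }
  {
    assume "curve_poly q g dvd H"
    thus "eval2 y H = 0" using evM by (auto simp: M_def elim!: dvdE)
  }
qed

text \<open>N acts as a norm of h: it is the constant term of a relation of least degree for h over
  the polynomials in x. It is nonzero, since otherwise the relation could be divided by h.\<close>

lemma eval2_divides_polynomial:
  fixes h :: "'k::finite_field ambient"
  assumes h: "h = eval2 y H" "h \<noteq> 0"
  shows "\<exists>G N. N \<noteq> 0 \<and> h * eval2 y G = of_polynomial N"
proof -
  obtain P :: "'k alg_closure poly fract poly" where P: "P \<noteq> 0" "poly (map_poly to_ac P) h = 0"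
    using alg_closure_algebraic .
  define P1 where "P1 = primitive_part_fract P"
  define c where "c = fract_content P"
  have Peq: "P = Polynomial.smult c (map_poly to_fract P1)"
    unfolding P1_def c_def by (rule content_times_primitive_part_fract[symmetric])
  have c0: "c \<noteq> 0" and P10: "P1 \<noteq> 0" using P(1) Peq by auto
  have "map_poly to_ac P = Polynomial.smult (to_ac c) (map_poly to_ac (map_poly to_fract P1))"
    by (subst Peq) (rule poly_eqI, simp add: coeff_map_poly)
  hence "poly (map_poly to_ac (map_poly to_fract P1)) h = 0" using P(2) c0 by simp
  moreover have "map_poly to_ac (map_poly to_fract P1) = map_poly of_polynomial P1"
    by (rule poly_eqI) (simp add: coeff_map_poly of_polynomial_def)
  ultimately have ex: "\<exists>R. R \<noteq> 0 \<and> eval2 h R = 0" using P10 by (auto simp: eval2_def)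
  define Q where "Q = (\<lambda>m. \<exists>R. R \<noteq> 0 \<and> Polynomial.degree R = m \<and> eval2 h R = 0)"
  have "\<exists>m. Q m" using ex by (auto simp: Q_def)
  define m where "m = (LEAST m. Q m)"
  have "Q m" unfolding m_def using \<open>\<exists>m. Q m\<close> by (rule LeastI_ex)
  then obtain R where R: "R \<noteq> 0" "Polynomial.degree R = m" "eval2 h R = 0" unfolding Q_def by blast
  obtain N R2 where NR: "R = pCons N R2" by (cases R) auto
  have ev: "of_polynomial N + h * eval2 h R2 = 0" using R(3) by (simp add: NR)
  have "N \<noteq> 0"
  proof
    assume N: "N = 0"
    hence "R2 \<noteq> 0" "eval2 h R2 = 0" using R(1) NR ev h(2) by auto
    hence "Q (Polynomial.degree R2)" by (auto simp: Q_def)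
    hence "m \<le> Polynomial.degree R2" unfolding m_def by (rule Least_le)
    thus False using R(2) NR \<open>R2 \<noteq> 0\<close> by simp
  qed
  have "\<exists>G. eval2 h S = eval2 y G" for S
  proof (induction S)
    case 0
    show ?case by (rule exI[of _ 0]) simp
  next
    case (pCons c S)
    then obtain G where "eval2 h S = eval2 y G" by blast
    hence "eval2 h (pCons c S) = eval2 y ([:c:] + H * G)" by (simp add: h(1))
    thus ?case by blast
  qed
  then obtain G where "eval2 h R2 = eval2 y G" by blast
  hence "of_polynomial N = - (h * eval2 y G)" using ev by (simp add: eq_neg_iff_add_eq_0)
  moreover have "eval2 y (- G) = - eval2 y G" using eval2_diff[of y 0 G] by simp
  ultimately have "h * eval2 y (- G) = of_polynomial N" by simp
  thus ?thesis using \<open>N \<noteq> 0\<close> by blast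
qed

subsection \<open>The coordinate ring\<close>

inductive_set gen_ring :: "'a::comm_ring_1 set \<Rightarrow> 'a set" for S where
  base: "s \<in> S \<Longrightarrow> s \<in> gen_ring S"
| add: "a \<in> gen_ring S \<Longrightarrow> b \<in> gen_ring S \<Longrightarrow> a + b \<in> gen_ring S"
| mult: "a \<in> gen_ring S \<Longrightarrow> b \<in> gen_ring S \<Longrightarrow> a * b \<in> gen_ring S"

lemma is_subring_gen_ring:
  assumes "1 \<in> S" "- 1 \<in> S" shows "is_subring (gen_ring S)"
proof -
  have "a - b \<in> gen_ring S" if "a \<in> gen_ring S" "b \<in> gen_ring S" for a b
    using gen_ring.add[OF that(1) gen_ring.mult[OF gen_ring.base[OF assms(2)] that(2)]] by simp
  thus ?thesis using assms by (auto simp: is_subring_def intro: gen_ring.intros)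
qed

lemma gen_ring_subset:
  assumes "is_subring T" "S \<subseteq> T" shows "gen_ring S \<subseteq> T"
proof
  fix a assume "a \<in> gen_ring S"
  thus "a \<in> T" by induction (use assms in \<open>auto intro: is_subringD[OF assms(1)]\<close>)
qed

definition kap :: "'k::finite_field alg_closure \<Rightarrow> 'k ambient" where
  "kap c = of_polynomial [:c:]"

lemma kap_simps [simp]:
  "kap 0 = 0" "kap 1 = 1" "kap (a + b) = kap a + kap b" "kap (a - b) = kap a - kap b" "kap (- a) = - kap a"
  "kap (a * b) = kap a * kap b" "kap a = 0 \<longleftrightarrow> a = 0" "kap a = kap b \<longleftrightarrow> a = b"
proof -
  show "kap (a * b) = kap a * kap b" unfolding kap_def of_polynomial_simps(6)[symmetric] by (simp add: mult.commute del: of_polynomial_simps)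
  show "kap 1 = 1" unfolding kap_def one_pCons[symmetric] by simp
  show "kap 0 = 0" "kap a = 0 \<longleftrightarrow> a = 0" "kap a = kap b \<longleftrightarrow> a = b" by (simp_all add: kap_def)
qed (simp_all add: kap_def flip: of_polynomial_simps(3-5))

lemma kap_power [simp]: "kap (a ^ n) = kap a ^ n"
  by (induction n) simp_all

lemma kap_inverse [simp]: "kap (inverse a) = inverse (kap a)"
proof (cases "a = 0")
  case False
  hence "kap a * kap (inverse a) = 1" by (simp flip: kap_simps)
  thus ?thesis by (metis inverse_unique)
qed simp

lemma of_polynomial_pCons: "of_polynomial (pCons c h) = kap c + x_coord * of_polynomial h"
proof -
  have "pCons c h = [:c:] + [:0, 1:] * h" by simp
  thus ?thesis unfolding kap_def x_coord_def by (metis of_polynomial_simps(3,6))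
qed

text \<open>K is the constant field of one extension. The characteristic is hidden: it enters the
  geometry through the additivity of the q-th power.\<close>

locale artin_schreier_curve =
  fixes K :: "'k::finite_field alg_closure set" and q :: nat and g :: "'k alg_closure poly" and y :: "'k ambient"
  assumes K: "fraction_closed K" and finK: "finite K" and gK: "\<And>i. Polynomial.coeff g i \<in> K"
    and q: "q \<ge> 2" "coprime (Polynomial.degree g) q" "Polynomial.degree g \<ge> 1"
    and frob: "\<And>a b :: 'k ambient. (a + b) ^ q = a ^ q + b ^ q"
    and y: "y ^ q - y = of_polynomial g"
begin

abbreviation x :: "'k ambient" where "x \<equiv> x_coord"
definition C :: "'k ambient set" where "C = kap ` K"
definition A :: "'k ambient set" where "A = gen_ring (C \<union> {x, y})"
text \<open>The fraction field of A; a zero denominator only produces 0.\<close>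

definition L :: "'k ambient set" where "L = {u / v | u v. u \<in> A \<and> v \<in> A}"

lemma Kr: "1 \<in> K" "0 \<in> K" "a \<in> K \<Longrightarrow> b \<in> K \<Longrightarrow> a + b \<in> K" "a \<in> K \<Longrightarrow> b \<in> K \<Longrightarrow> a - b \<in> K"
    "a \<in> K \<Longrightarrow> b \<in> K \<Longrightarrow> a * b \<in> K" "a \<in> K \<Longrightarrow> - a \<in> K" "a \<in> K \<Longrightarrow> a ^ n \<in> K" "a \<in> K \<Longrightarrow> inverse a \<in> K"
proof -
  have S: "is_subring K" using K by (simp add: fraction_closed_def)
  show "1 \<in> K" "0 \<in> K" "a \<in> K \<Longrightarrow> b \<in> K \<Longrightarrow> a + b \<in> K" "a \<in> K \<Longrightarrow> b \<in> K \<Longrightarrow> a - b \<in> K"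
    "a \<in> K \<Longrightarrow> b \<in> K \<Longrightarrow> a * b \<in> K" "a \<in> K \<Longrightarrow> - a \<in> K" "a \<in> K \<Longrightarrow> a ^ n \<in> K"
    by (rule is_subringD[OF S]; assumption)+
  show "a \<in> K \<Longrightarrow> inverse a \<in> K" using K by (simp add: fraction_closed_def)
qed

lemma kapA: "c \<in> K \<Longrightarrow> kap c \<in> A" and xA: "x \<in> A" and yA: "y \<in> A"
  by (auto simp: A_def C_def intro: gen_ring.base)

lemma A: "is_subring A"
  unfolding A_def
proof (rule is_subring_gen_ring)
  have "kap 1 \<in> C" "kap (- 1) \<in> C" unfolding C_def using Kr(1,6) by blast+
  thus "1 \<in> C \<union> {x, y}" "- 1 \<in> C \<union> {x, y}" by simp_all
qed

lemmas Ar = is_subringD[OF A]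

lemma A_eval: "h \<in> A \<Longrightarrow> \<exists>H. h = eval2 y H"
  unfolding A_def
proof (induction rule: gen_ring.induct)
  case (base s)
  show ?case
  proof (cases "s \<in> C")
    case True
    then obtain c where "s = kap c" by (auto simp: C_def)
    thus ?thesis by (intro exI[of _ "[:[:c:]:]"]) (simp add: kap_def)
  next
    case False
    hence "s = x \<or> s = y" using base by auto
    thus ?thesis
    proof
      assume "s = x"
      thus ?thesis by (intro exI[of _ "[:[:0, 1:]:]"]) (simp add: x_coord_def)
    next
      assume "s = y"
      thus ?thesis by (intro exI[of _ "[:0, 1:]"]) simp
    qed
  qed
next
  case (add a b)
  thus ?case by (metis eval2_simps(3))
next
  case (mult a b)
  thus ?case by (metis eval2_simps(4))
qed

lemma L: "fraction_closed L"
proof -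
  have LI: "u / v \<in> L" if "u \<in> A" "v \<in> A" for u v using that by (auto simp: L_def)
  have "1 / 1 \<in> L" by (rule LI) (rule Ar)+
  hence one: "1 \<in> L" by simp
  have "a + b \<in> L \<and> a - b \<in> L \<and> a * b \<in> L" if ab: "a \<in> L" "b \<in> L" for a b
  proof -
    obtain u v u' v' where uv: "a = u / v" "b = u' / v'" "u \<in> A" "v \<in> A" "u' \<in> A" "v' \<in> A"
      using ab by (auto simp: L_def)
    have "a * b \<in> L" unfolding uv times_divide_times_eq using uv Ar(5) by (intro LI) auto
    moreover have "a + b \<in> L \<and> a - b \<in> L"
    proof (cases "v = 0 \<or> v' = 0")
      case True
      have "- u' / v' \<in> L" using uv Ar(6) by (intro LI) auto
      thus ?thesis using True ab uv by auto
    next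
      case False
      hence "a + b = (u * v' + u' * v) / (v * v')" "a - b = (u * v' - u' * v) / (v * v')"
        by (simp_all add: uv add_frac_eq diff_frac_eq)
      thus ?thesis using uv Ar(3,4,5) LI by metis
    qed
    ultimately show ?thesis by blast
  qed
  moreover have "inverse a \<in> L" if "a \<in> L" for a
    using that LI by (auto simp: L_def)
  ultimately show ?thesis using one by (simp add: fraction_closed_def is_subring_def)
qed

lemma AL: "A \<subseteq> L"
proof
  fix a assume "a \<in> A"
  hence "a / 1 \<in> L" unfolding L_def using Ar(1) by blast
  thus "a \<in> L" by simp
qed

lemma CA: "C \<subseteq> A" using kapA by (auto simp: C_def)

lemma Lr: "a \<in> L \<Longrightarrow> b \<in> L \<Longrightarrow> a * b \<in> L" "a \<in> L \<Longrightarrow> inverse a \<in> L" "a \<in> L \<Longrightarrow> b \<in> L \<Longrightarrow> a / b \<in> L"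
proof -
  have L': "is_subring L" "\<And>a. a \<in> L \<Longrightarrow> inverse a \<in> L" using L by (auto simp: fraction_closed_def)
  show m: "a \<in> L \<Longrightarrow> b \<in> L \<Longrightarrow> a * b \<in> L" for a b using is_subringD(5)[OF L'(1)] .
  show i: "a \<in> L \<Longrightarrow> inverse a \<in> L" for a using L'(2) .
  show "a \<in> L \<Longrightarrow> b \<in> L \<Longrightarrow> a / b \<in> L" using m[OF _ i] by (simp add: divide_inverse)
qed

lemma frob_diff: "(a - b :: 'k ambient) ^ q = a ^ q - b ^ q"
  using frob[of "a - b" b] by (simp add: eq_diff_eq)

lemma valuation_ringI:
  assumes V: "is_subring V" "C \<subseteq> V" "V \<subseteq> L" "\<And>w. w \<in> L \<Longrightarrow> w \<in> V \<or> inverse w \<in> V" and z: "z \<in> L" "z \<notin> V"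
  shows "valuation_ring C L V"
  unfolding valuation_ring_def subring_iff_is_subring using assms by blast

lemma kap_unit:
  assumes V: "valuation_ring C L V" and c: "c \<in> K" "c \<noteq> 0"
  shows "kap c \<in> V" "inverse (kap c) \<in> V" "kap c \<notin> valuation_ideal V"
proof -
  have "kap c \<in> C" "kap (inverse c) \<in> C" unfolding C_def using c Kr(8) by blast+
  thus 1: "kap c \<in> V" "inverse (kap c) \<in> V" using valuation_ringD(2)[OF V] by auto
  thus "kap c \<notin> valuation_ideal V" using valuation_ideal(9)[OF V L] c by simp
qed

end

subsection \<open>The affine places\<close>

locale affine_point = artin_schreier_curve K q g y
  for K :: "'k::finite_field alg_closure set" and q g y +
  fixes a b :: "'k alg_closure"
  assumes ab: "a \<in> K" "b \<in> K" "b ^ q - b = poly g a"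
begin

definition z :: "'k ambient" where "z = x - kap a"
definition yb :: "'k ambient" where "yb = y - kap b"
text \<open>The cofactor in yb^q - yb = yb w. It is -1 at (a, b) and vanishes at the other points
  with the same x-coordinate.\<close>

definition w :: "'k ambient" where "w = yb ^ (q - 1) - 1"
definition I :: "'k ambient set" where "I = {z * h1 + yb * h2 | h1 h2. h1 \<in> A \<and> h2 \<in> A}"

lemma zA: "z \<in> A" and ybA: "yb \<in> A" and wA: "w \<in> A"
proof -
  show "z \<in> A" "yb \<in> A" unfolding z_def yb_def by (intro Ar(4) xA yA kapA ab)+
  thus "w \<in> A" unfolding w_def by (intro Ar(1,4,7))
qed

lemma z_poly: "z = of_polynomial [:- a, 1:]"
proof -
  have "of_polynomial [:- a, 1:] = kap (- a) + x * of_polynomial [:1:]" by (rule of_polynomial_pCons)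
  also have "of_polynomial [:1:] = 1" by (simp flip: one_pCons)
  finally show ?thesis by (simp add: z_def)
qed

lemma z_nonzero: "z \<noteq> 0" by (simp add: z_poly)

lemma eval_at_cong:
  assumes "eval2 y H = eval2 y G" shows "eval_at a b H = eval_at a b G"
proof -
  have "eval2 y (H - G) = 0" using assms by simp
  hence "curve_poly q g dvd H - G" using eval2_eq_0_iff[OF q y] by blast
  then obtain M where "H - G = curve_poly q g * M" by (elim dvdE)
  hence "eval_at a b (H - G) = 0" using ab by (simp add: eval_curve_poly del: eval_at_simps(4))
  thus ?thesis by simp
qed

definition w_poly :: "'k alg_closure poly poly" where "w_poly = ([:0, 1:] - [:[:b:]:]) ^ (q - 1) - 1"

lemma w_poly: "eval2 y w_poly = w" "eval_at a b w_poly = -1"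
proof -
  have "eval2 y ([:0, 1:] - [:[:b:]:]) = yb" by (simp only: eval2_diff) (simp add: yb_def kap_def)
  thus "eval2 y w_poly = w" by (simp only: w_poly_def w_def eval2_diff eval2_power eval2_simps)
  have "eval_at a b ([:0, 1:] - [:[:b:]:]) = 0" by (simp only: eval_at_simps) simp
  thus "eval_at a b w_poly = -1" using q(1) unfolding w_poly_def
    by (simp only: eval_at_simps) (simp add: power_0_left)
qed

lemma w_nonzero: "w \<noteq> 0"
proof
  assume "w = 0"
  hence "eval2 y w_poly = eval2 y 0" by (simp add: w_poly)
  hence "eval_at a b w_poly = eval_at a b 0" by (rule eval_at_cong)
  thus False by (simp add: w_poly)
qed

lemma poly_expand:
  assumes "\<And>i. Polynomial.coeff c i \<in> K"
  shows "\<exists>h\<in>A. of_polynomial c = kap (poly c a) + z * h"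
  using assms
proof (induction c)
  case 0
  show ?case using Ar(2) by (intro bexI[of _ 0]) auto
next
  case (pCons e c)
  have cK: "Polynomial.coeff c i \<in> K" for i using pCons.prems[of "Suc i"] by simp
  then obtain h where h: "h \<in> A" "of_polynomial c = kap (poly c a) + z * h" using pCons.IH by blast
  have x: "x = kap a + z" by (simp add: z_def)
  have eq: "of_polynomial (pCons e c) = kap (poly (pCons e c) a) + z * (kap (poly c a) + x * h)"
    by (simp add: of_polynomial_pCons h(2)) (simp add: x algebra_simps)
  have "poly c a \<in> K"
    unfolding poly_altdef using K cK ab Kr(5,7) by (intro is_subring_sum) (auto simp: fraction_closed_def)
  hence "kap (poly c a) + x * h \<in> A" by (intro Ar(3,5) kapA xA h(1))
  thus ?case using eq by blast
qed

text \<open>The q-th power is additive, so (y - b)^q - (y - b) is g(x) - g(a), a multiple of x - a.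
  As w is a unit at the point, x - a is a uniformizer there.\<close>

lemma yb_w: "\<exists>h\<in>A. yb * w = z * h"
proof -
  obtain h where h: "h \<in> A" "of_polynomial g = kap (poly g a) + z * h" using poly_expand gK by blast
  have "yb * w = yb * yb ^ (q - 1) - yb" by (simp add: w_def algebra_simps)
  also have "yb * yb ^ (q - 1) = yb ^ q" using q(1) by (metis power_Suc Suc_diff_1 less_le_trans zero_less_numeral)
  also have "yb ^ q - yb = (y ^ q - y) - kap (b ^ q - b)" by (simp add: yb_def frob_diff)
  also have "\<dots> = z * h" using h(2) ab(3) by (simp only: y) simp
  finally show ?thesis using h(1) by blast
qed

lemma I_add: "h \<in> I \<Longrightarrow> h' \<in> I \<Longrightarrow> h + h' \<in> I"
proof -
  assume "h \<in> I" "h' \<in> I"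
  then obtain h1 h2 h3 h4 where h: "h = z * h1 + yb * h2" "h' = z * h3 + yb * h4"
    and A: "h1 \<in> A" "h2 \<in> A" "h3 \<in> A" "h4 \<in> A"
    unfolding I_def by blast
  have "h + h' = z * (h1 + h3) + yb * (h2 + h4)" by (simp add: h algebra_simps)
  thus ?thesis unfolding I_def using Ar(3)[OF A(1,3)] Ar(3)[OF A(2,4)] by blast
qed

lemma I_mult: "h \<in> I \<Longrightarrow> h' \<in> A \<Longrightarrow> h' * h \<in> I"
proof -
  assume "h \<in> I" and h': "h' \<in> A"
  then obtain h1 h2 where h: "h = z * h1 + yb * h2" and A: "h1 \<in> A" "h2 \<in> A" unfolding I_def by blast
  have "h' * h = z * (h' * h1) + yb * (h' * h2)" by (simp add: h algebra_simps)
  thus ?thesis unfolding I_def using Ar(5)[OF h' A(1)] Ar(5)[OF h' A(2)] by blast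
qed

lemma I_gens: "z \<in> I" "yb \<in> I" "0 \<in> I"
proof -
  have "z * 1 + yb * 0 \<in> I" "z * 0 + yb * 1 \<in> I" "z * 0 + yb * 0 \<in> I" unfolding I_def using Ar(1,2) by blast+
  thus "z \<in> I" "yb \<in> I" "0 \<in> I" by simp_all
qed

lemma A_expand: "h \<in> A \<Longrightarrow> \<exists>c\<in>K. h - kap c \<in> I"
  unfolding A_def
proof (induction rule: gen_ring.induct)
  case (base s)
  show ?case
  proof (cases "s \<in> C")
    case True
    then obtain c where "c \<in> K" "s = kap c" by (auto simp: C_def)
    thus ?thesis using I_gens(3) by (intro bexI[of _ c]) auto
  next
    case False
    hence "s = x \<or> s = y" using base by auto
    thus ?thesis using I_gens ab unfolding z_def yb_def by blast
  qed
next
  case (add h h')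
  then obtain c c' where c: "c \<in> K" "c' \<in> K" "h - kap c \<in> I" "h' - kap c' \<in> I" by blast
  have "(h + h') - kap (c + c') = (h - kap c) + (h' - kap c')" by simp
  thus ?case using I_add[OF c(3,4)] Kr(3)[OF c(1,2)] by metis
next
  case (mult h h')
  then obtain c c' where c: "c \<in> K" "c' \<in> K" "h - kap c \<in> I" "h' - kap c' \<in> I" by blast
  have h: "h \<in> A" using mult.hyps by (simp add: A_def)
  have "(h * h') - kap (c * c') = h * (h' - kap c') + kap c' * (h - kap c)" by (simp add: algebra_simps)
  moreover have "h * (h' - kap c') + kap c' * (h - kap c) \<in> I"
    using c h kapA by (intro I_add I_mult) auto
  ultimately show ?case using Kr(5)[OF c(1,2)] by metis
qed

text \<open>Inverting w removes the other points above x = a: in a valuation ring containing A[1/w]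
  with z in its ideal, y - b is z times some h / w and lies in the ideal too. In A[1/w] itself z has
  no inverse, since w^i = z h evaluated at (a, b) would say (-1)^i = 0.\<close>

lemma exists_affine_place: "\<exists>V. valuation_ring C L V \<and> z \<in> valuation_ideal V \<and> yb \<in> valuation_ideal V"
proof -
  define R where "R = {h / w ^ i | h i. h \<in> A}"
  have RI: "h / w ^ i \<in> R" if "h \<in> A" for h i using that by (auto simp: R_def)
  have AR: "A \<subseteq> R" using RI[of _ 0] by auto
  have Rr: "is_subring R"
    unfolding is_subring_def
  proof (intro conjI ballI)
    show "1 \<in> R" using AR Ar(1) by blast
    fix r t assume "r \<in> R" "t \<in> R"
    then obtain h i h' i' where rt: "r = h / w ^ i" "t = h' / w ^ i'" "h \<in> A" "h' \<in> A" by (auto simp: R_def)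
    have "r + t = (h * w ^ i' + h' * w ^ i) / w ^ (i + i')" "r - t = (h * w ^ i' - h' * w ^ i) / w ^ (i + i')"
      "r * t = (h * h') / w ^ (i + i')"
      using w_nonzero by (simp_all add: rt power_add add_frac_eq diff_frac_eq)
    moreover have "h * w ^ i' + h' * w ^ i \<in> A" "h * w ^ i' - h' * w ^ i \<in> A" "h * h' \<in> A"
      using rt wA Ar(3,4,5,7) by auto
    ultimately show "r + t \<in> R" "r - t \<in> R" "r * t \<in> R" using RI by metis+
  qed
  have RL: "R \<subseteq> L" using AL Ar(7)[OF wA] by (auto simp: R_def L_def)
  have zR: "inverse z \<notin> R"
  proof
    assume "inverse z \<in> R"
    then obtain h i where h: "h \<in> A" "inverse z = h / w ^ i" by (auto simp: R_def)
    hence e: "w ^ i = z * h" using z_nonzero w_nonzero by (simp add: field_simps)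
    obtain H where H: "h = eval2 y H" using A_eval[OF h(1)] by blast
    have "eval2 y (w_poly ^ i) = eval2 y ([:[:- a, 1:]:] * H)" using e by (simp add: w_poly H z_poly)
    hence "eval_at a b (w_poly ^ i) = eval_at a b ([:[:- a, 1:]:] * H)" by (rule eval_at_cong)
    hence "(- 1) ^ i = (0 :: 'k alg_closure)" by (simp only: eval_at_simps w_poly) simp
    thus False by simp
  qed
  have L': "is_subring L" "\<And>a. a \<in> L \<Longrightarrow> inverse a \<in> L" using L by (auto simp: fraction_closed_def)
  have zinR: "z \<in> R" using AR zA by blast
  obtain V where
    V: "is_subring V" "R \<subseteq> V" "V \<subseteq> L" "inverse z \<notin> V" "\<And>w. w \<in> L \<Longrightarrow> w \<in> V \<or> inverse w \<in> V"
    using exists_valuation_ring[OF L' Rr RL zinR zR] by blast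
  have "C \<subseteq> V" using CA AR V(2) by blast
  moreover have "inverse z \<in> L" using L'(2) AL zA by blast
  ultimately have val: "valuation_ring C L V" using valuation_ringI V by blast
  have zm: "z \<in> valuation_ideal V" using V AR zA by (auto simp: valuation_ideal_def)
  obtain h where h: "h \<in> A" "yb * w = z * h" using yb_w by blast
  have "yb = z * (h / w ^ 1)" using h(2) w_nonzero by (simp add: field_simps)
  moreover have "h / w ^ 1 \<in> V" using RI[OF h(1)] V(2) by blast
  ultimately have "yb \<in> valuation_ideal V" using valuation_ideal(4)[OF val L zm] by metis
  thus ?thesis using val zm by blast
qed

text \<open>
  The iteration \<open>h \<mapsto> w h / z\<close> on functions vanishing at the point stops because \<open>h\<close> divides a
  polynomial in \<open>x\<close>.
\<close>
lemma local_factorization: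
  assumes h: "h \<in> A" "h \<noteq> 0"
  shows "\<exists>i. \<exists>h'\<in>A. \<exists>c\<in>K. c \<noteq> 0 \<and> h' - kap c \<in> I \<and> w ^ i * h = z ^ i * h'"
proof (rule ccontr)
  assume neg: "\<not> ?thesis"
  have iter: "\<exists>h'\<in>A. w ^ i * h = z ^ i * h'" for i
  proof (induction i)
    case (Suc i)
    then obtain h' where h': "h' \<in> A" "w ^ i * h = z ^ i * h'" by blast
    obtain c where c: "c \<in> K" "h' - kap c \<in> I" using A_expand[OF h'(1)] by blast
    have "c = 0" using neg h' c by blast
    hence "h' \<in> I" using c by simp
    then obtain h1 h2 where hh: "h' = z * h1 + yb * h2" "h1 \<in> A" "h2 \<in> A" unfolding I_def by blast
    obtain e where e: "e \<in> A" "yb * w = z * e" using yb_w by blast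
    have "w * h' = z * (w * h1) + (yb * w) * h2" by (simp add: hh algebra_simps)
    also have "\<dots> = z * (w * h1 + e * h2)" by (simp only: e) (simp add: algebra_simps)
    finally have wh: "w * h' = z * (w * h1 + e * h2)" .
    have "w ^ Suc i * h = w * (w ^ i * h)" by (simp add: mult_ac)
    also have "\<dots> = z ^ i * (w * h')" unfolding h'(2) by (simp add: mult_ac)
    also have "\<dots> = z ^ Suc i * (w * h1 + e * h2)" unfolding wh by (simp add: mult_ac)
    finally have "w ^ Suc i * h = z ^ Suc i * (w * h1 + e * h2)" .
    moreover have "w * h1 + e * h2 \<in> A" by (intro Ar(3,5) wA hh e)
    ultimately show ?case by blast
  qed (use h in auto)
  obtain H where H: "h = eval2 y H" using A_eval[OF h(1)] by blast
  obtain G N where GN: "N \<noteq> 0" "h * eval2 y G = of_polynomial N" using eval2_divides_polynomial[OF H h(2)] by blast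
  \<comment> \<open>After m + 1 steps h has more factors z than N can provide: cancelling z^m and
    evaluating at (a, b) leaves (-1)^(m+1) N1(a) = 0.\<close>
  define m where "m = Polynomial.order a N"
  obtain N1 where N1: "N = [:- a, 1:] ^ m * N1" "\<not> [:- a, 1:] dvd N1"
    using order_decomp[OF GN(1), of a] unfolding m_def by blast
  hence N1a: "poly N1 a \<noteq> 0" by (simp add: poly_eq_0_iff_dvd)
  obtain h' where h': "h' \<in> A" "w ^ Suc m * h = z ^ Suc m * h'" using iter by blast
  obtain H' where H': "h' = eval2 y H'" using A_eval[OF h'(1)] by blast
  have "z ^ m * (w ^ Suc m * of_polynomial N1) = w ^ Suc m * (h * eval2 y G)"
    by (simp add: GN(2) N1(1) z_poly mult_ac)
  also have "\<dots> = (w ^ Suc m * h) * eval2 y G" by (simp add: mult.assoc)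
  also have "\<dots> = z ^ m * (z * h' * eval2 y G)" unfolding h'(2) by (simp add: mult_ac)
  finally have "w ^ Suc m * of_polynomial N1 = z * h' * eval2 y G" using z_nonzero by simp
  hence "eval2 y (w_poly ^ Suc m * [:N1:]) = eval2 y ([:[:- a, 1:]:] * H' * G)"
    by (simp add: w_poly H' z_poly mult_ac del: power_Suc)
  hence "eval_at a b (w_poly ^ Suc m * [:N1:]) = eval_at a b ([:[:- a, 1:]:] * H' * G)" by (rule eval_at_cong)
  hence "(- 1) ^ Suc m * poly N1 a = 0" by (simp only: eval_at_simps w_poly) simp
  thus False using N1a by simp
qed

lemma affine_units:
  assumes V: "valuation_ring C L V" and m: "z \<in> valuation_ideal V" "yb \<in> valuation_ideal V"
  shows "A \<subseteq> V" "I \<subseteq> valuation_ideal V" "w \<notin> valuation_ideal V"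
    "h \<in> A \<Longrightarrow> c \<in> K \<Longrightarrow> c \<noteq> 0 \<Longrightarrow> h - kap c \<in> I \<Longrightarrow> h \<notin> valuation_ideal V"
proof -
  note R = is_subringD[OF valuation_ringD(1)[OF V]]
  note J = valuation_ideal[OF V L]
  have CV: "C \<subseteq> V" by (rule valuation_ringD(2)[OF V])
  have "kap a \<in> V" "kap b \<in> V" using CV ab by (auto simp: C_def)
  moreover have "z \<in> V" "yb \<in> V" using m J(1) by blast+
  ultimately have "z + kap a \<in> V" "yb + kap b \<in> V" using R(3) by blast+
  hence "C \<union> {x, y} \<subseteq> V" using CV by (simp add: z_def yb_def)
  thus AV: "A \<subseteq> V" unfolding A_def by (rule gen_ring_subset[OF valuation_ringD(1)[OF V]])
  show IV: "I \<subseteq> valuation_ideal V"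
  proof
    fix h assume "h \<in> I"
    then obtain h1 h2 where "h = z * h1 + yb * h2" "h1 \<in> A" "h2 \<in> A" unfolding I_def by blast
    thus "h \<in> valuation_ideal V" using m AV J(4,5) by blast
  qed
  show key: "h \<notin> valuation_ideal V" if "h \<in> A" "c \<in> K" "c \<noteq> 0" "h - kap c \<in> I" for h c
  proof
    assume "h \<in> valuation_ideal V"
    hence "h - (h - kap c) \<in> valuation_ideal V" using IV that J(6) by blast
    thus False using kap_unit[OF V that(2,3)] by simp
  qed
  \<comment> \<open>As q is at least 2, yb divides yb^(q-1), so w is -1 modulo I.\<close>
  have "yb ^ (q - 1) = yb ^ (q - 2) * yb" using q(1) by (metis Suc_diff_Suc Suc_1 less_eq_Suc_le power_Suc2 Suc_diff_le diff_Suc_Suc)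
  hence "w - kap (- 1) \<in> I" unfolding w_def using I_mult[OF I_gens(2) Ar(7)[OF ybA]] by simp
  moreover have "- 1 \<in> K" using Kr(1,6) by blast
  ultimately show "w \<notin> valuation_ideal V" by (intro key[OF wA]) auto
qed

text \<open>In terms of the uniformizer z / w, u and v are its i-th and j-th power times units u'
  and v', whose quotient has residue c / e. These data are found without reference to V and decide
  membership in V, which yields both uniqueness and rationality.\<close>

lemma affine_place_value:
  assumes u: "u \<in> A" "u' \<in> A" "c \<in> K" "c \<noteq> 0" "u' - kap c \<in> I" "w ^ i * u = z ^ i * u'"
    and v: "v \<in> A" "v' \<in> A" "e \<in> K" "e \<noteq> 0" "v' - kap e \<in> I" "w ^ j * v = z ^ j * v'"
    and V: "valuation_ring C L V" and m: "z \<in> valuation_ideal V" "yb \<in> valuation_ideal V"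
  shows "i < j \<Longrightarrow> u / v \<notin> V" "i > j \<Longrightarrow> u / v \<in> valuation_ideal V"
    "i = j \<Longrightarrow> u / v - kap (c / e) \<in> valuation_ideal V"
proof -
  note R = is_subringD[OF valuation_ringD(1)[OF V]]
  note J = valuation_ideal[OF V L]
  note U = affine_units[OF V m]
  have uV: "u' \<in> V" "v' \<in> V" "w \<in> V" "kap c \<in> V" "kap e \<in> V" using U(1) u v wA kapA by auto
  have un: "u' \<notin> valuation_ideal V" "v' \<notin> valuation_ideal V" using U(4) u v by blast+
  have inv: "u' \<noteq> 0" "inverse u' \<in> V" "v' \<noteq> 0" "inverse v' \<in> V" "inverse w \<in> V"
    using J(7) un U(3) uV by blast+
  define \<pi> where "\<pi> = z * inverse w"
  have \<pi>: "\<pi> \<in> valuation_ideal V" "\<pi> \<noteq> 0" using J(4)[OF m(1) inv(5)] z_nonzero w_nonzero by (auto simp: \<pi>_def)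
  have \<pi>n: "\<pi> ^ n \<in> valuation_ideal V" if "n > 0" for n
  proof -
    obtain k where "n = Suc k" using \<open>n > 0\<close> by (cases n) auto
    thus ?thesis using J(4)[OF \<pi>(1) R(7)] \<pi>(1) J(1) by auto
  qed
  have ueq: "u = \<pi> ^ i * u'" "v = \<pi> ^ j * v'"
    using u(6) v(6) w_nonzero by (simp_all add: \<pi>_def power_mult_distrib field_simps)
  have quot: "u' * inverse v' \<in> V" "v' * inverse u' \<in> V" using uV inv R(5) by auto
  have big: "u / v \<in> valuation_ideal V" if "i > j"
  proof -
    have "u / v = \<pi> ^ (i - j) * (u' * inverse v')"
      using that \<pi>(2) inv by (simp add: ueq power_diff divide_inverse)
    thus ?thesis using J(4)[OF \<pi>n quot(1), of "i - j"] that by simp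
  qed
  show "i > j \<Longrightarrow> u / v \<in> valuation_ideal V" by (rule big)
  show "u / v \<notin> V" if "i < j"
  proof
    assume uv: "u / v \<in> V"
    have "v / u = \<pi> ^ (j - i) * (v' * inverse u')"
      using that \<pi>(2) inv by (simp add: ueq power_diff divide_inverse)
    hence "v / u \<in> valuation_ideal V" using J(4)[OF \<pi>n quot(2), of "j - i"] that by simp
    hence "(v / u) * (u / v) \<in> valuation_ideal V" using uv J(4) by blast
    moreover have "(v / u) * (u / v) = 1" using \<pi>(2) inv by (simp add: ueq)
    ultimately show False using J(3) by simp
  qed
  show "u / v - kap (c / e) \<in> valuation_ideal V" if "i = j"
  proof -
    have "u / v - kap (c / e) = ((u' - kap c) * kap e - (v' - kap e) * kap c) * (inverse v' * inverse (kap e))"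
      using that \<pi>(2) inv v(4) by (simp add: ueq divide_inverse) (simp add: field_simps)
    moreover have "(u' - kap c) * kap e - (v' - kap e) * kap c \<in> valuation_ideal V"
      using U(2) u v uV J(4,6) by blast
    moreover have "inverse v' * inverse (kap e) \<in> V" using inv kap_unit[OF V v(3,4)] R(5) by blast
    ultimately show ?thesis using J(4) by metis
  qed
qed

lemma L_cases:
  assumes "t \<in> L" "t \<noteq> 0"
  obtains u u' c i v v' e j where "t = u / v"
    "u \<in> A" "u' \<in> A" "c \<in> K" "c \<noteq> 0" "u' - kap c \<in> I" "w ^ i * u = z ^ i * u'"
    "v \<in> A" "v' \<in> A" "e \<in> K" "e \<noteq> 0" "v' - kap e \<in> I" "w ^ j * v = z ^ j * v'"
proof -
  obtain u v where uv: "t = u / v" "u \<in> A" "v \<in> A" using assms(1) by (auto simp: L_def)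
  have nz: "u \<noteq> 0" "v \<noteq> 0" using assms(2) uv by auto
  obtain i u' c where "u' \<in> A" "c \<in> K" "c \<noteq> 0" "u' - kap c \<in> I" "w ^ i * u = z ^ i * u'"
    using local_factorization[OF uv(2) nz(1)] by blast
  moreover obtain j v' e where "v' \<in> A" "e \<in> K" "e \<noteq> 0" "v' - kap e \<in> I" "w ^ j * v = z ^ j * v'"
    using local_factorization[OF uv(3) nz(2)] by blast
  ultimately show thesis using that uv by blast
qed

lemma affine_place_unique:
  assumes V: "valuation_ring C L V" "z \<in> valuation_ideal V" "yb \<in> valuation_ideal V"
    and V': "valuation_ring C L V'" "z \<in> valuation_ideal V'" "yb \<in> valuation_ideal V'"
  shows "V \<subseteq> V'"
proof
  fix t assume t: "t \<in> V"
  show "t \<in> V'"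
  proof (cases "t = 0")
    case True
    thus ?thesis using is_subringD(2)[OF valuation_ringD(1)[OF V'(1)]] by simp
  next
    case False
    have "t \<in> L" using t valuation_ringD(3)[OF V(1)] by blast
    from L_cases[OF this False] obtain u u' c i v v' e j where tt: "t = u / v"
      and f: "u \<in> A" "u' \<in> A" "c \<in> K" "c \<noteq> 0" "u' - kap c \<in> I" "w ^ i * u = z ^ i * u'"
      "v \<in> A" "v' \<in> A" "e \<in> K" "e \<noteq> 0" "v' - kap e \<in> I" "w ^ j * v = z ^ j * v'" .
    note J' = valuation_ideal[OF V'(1) L]
    have "\<not> i < j" using affine_place_value(1)[OF f V] t tt by blast
    then consider "i > j" | "i = j" by linarith
    thus ?thesis
    proof cases
      case 1
      thus ?thesis using affine_place_value(2)[OF f V'] tt J'(1) by blast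
    next
      case 2
      have "c / e \<in> K" using f Kr(5,8) by (simp add: divide_inverse)
      hence "kap (c / e) \<in> V'" using valuation_ringD(2)[OF V'(1)] by (auto simp: C_def)
      moreover have "t - kap (c / e) \<in> V'" using affine_place_value(3)[OF f V' 2] tt J'(1) by blast
      ultimately have "(t - kap (c / e)) + kap (c / e) \<in> V'"
        by (rule is_subringD(3)[OF valuation_ringD(1)[OF V'(1)], rotated])
      thus ?thesis by simp
    qed
  qed
qed

lemma affine_place_rational:
  assumes V: "valuation_ring C L V" "z \<in> valuation_ideal V" "yb \<in> valuation_ideal V"
  shows "rational_place C L V"
  unfolding rational_place_def
proof (intro conjI ballI V(1))
  fix t assume t: "t \<in> V"
  have z0: "0 \<in> C" using Kr(2) by (auto simp: C_def intro: image_eqI[of _ _ 0])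
  note J = valuation_ideal[OF V(1) L]
  show "\<exists>c\<in>C. t - c \<in> valuation_ideal V"
  proof (cases "t = 0")
    case True
    thus ?thesis using z0 J(2) by (intro bexI[of _ 0]) auto
  next
    case False
    have "t \<in> L" using t valuation_ringD(3)[OF V(1)] by blast
    from L_cases[OF this False] obtain u u' c i v v' e j where tt: "t = u / v"
      and f: "u \<in> A" "u' \<in> A" "c \<in> K" "c \<noteq> 0" "u' - kap c \<in> I" "w ^ i * u = z ^ i * u'"
      "v \<in> A" "v' \<in> A" "e \<in> K" "e \<noteq> 0" "v' - kap e \<in> I" "w ^ j * v = z ^ j * v'" .
    have "\<not> i < j" using affine_place_value(1)[OF f V] t tt by blast
    then consider "i > j" | "i = j" by linarith
    thus ?thesis
    proof cases
      case 1
      thus ?thesis using affine_place_value(2)[OF f V] tt z0 by (intro bexI[of _ 0]) auto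
    next
      case 2
      have "c / e \<in> K" using f Kr(5,8) by (simp add: divide_inverse)
      thus ?thesis using affine_place_value(3)[OF f V 2] tt by (auto simp: C_def)
    qed
  qed
qed

end

subsection \<open>The place at infinity\<close>

context artin_schreier_curve
begin

definition NF :: "'k ambient set" where
  "NF = {\<Sum>j<q. of_polynomial (c j) * y ^ j | c. \<forall>j i. Polynomial.coeff (c j) i \<in> K}"

lemma KsubR: "is_subring K"
  using K by (simp add: fraction_closed_def)

lemma kap_divide: "kap (c / e) = kap c / (kap e :: 'k ambient)"
  by (simp add: divide_inverse kap_inverse)

lemma NF_I: "(\<And>j i. Polynomial.coeff (c j) i \<in> K) \<Longrightarrow> (\<Sum>j<q. of_polynomial (c j) * y ^ j) \<in> NF"
  by (auto simp: NF_def)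

lemma NF_add: "u \<in> NF \<Longrightarrow> v \<in> NF \<Longrightarrow> u + v \<in> NF"
proof -
  assume "u \<in> NF" "v \<in> NF"
  then obtain c e where c: "u = (\<Sum>j<q. of_polynomial (c j) * y ^ j)" "v = (\<Sum>j<q. of_polynomial (e j) * y ^ j)"
    "\<forall>j i. Polynomial.coeff (c j) i \<in> K" "\<forall>j i. Polynomial.coeff (e j) i \<in> K" unfolding NF_def by blast
  have "(\<Sum>j<q. of_polynomial (c j + e j) * y ^ j) \<in> NF" by (rule NF_I) (use c Kr(3) in auto)
  thus "u + v \<in> NF" by (simp add: c(1,2) sum.distrib distrib_right)
qed

lemma NF_mult_poly:
  assumes h: "\<And>i. Polynomial.coeff h i \<in> K" and u: "u \<in> NF"
  shows "of_polynomial h * u \<in> NF"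
proof -
  obtain c where c: "u = (\<Sum>j<q. of_polynomial (c j) * y ^ j)" "\<forall>j i. Polynomial.coeff (c j) i \<in> K"
    using u unfolding NF_def by blast
  have "(\<Sum>j<q. of_polynomial (h * c j) * y ^ j) \<in> NF"
    unfolding coeff_mult by (intro NF_I) (auto simp: coeff_mult intro!: is_subring_sum[OF KsubR] Kr(5) h c(2)[rule_format])
  thus ?thesis by (simp add: c(1) sum_distrib_left mult.assoc)
qed

lemma NF_mult_y:
  assumes u: "u \<in> NF" shows "y * u \<in> NF"
proof -
  obtain c where c: "u = (\<Sum>j<q. of_polynomial (c j) * y ^ j)" "\<forall>j i. Polynomial.coeff (c j) i \<in> K"
    using u unfolding NF_def by blast
  obtain r where r: "q = Suc (Suc r)" using q(1) le_Suc_ex[of 2 q] by auto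
  \<comment> \<open>Multiplication by y shifts the coefficients; y^q = y + g brings the last one
    back to the places 1 and 0.\<close>
  define e where "e = (\<lambda>j. (if j = 0 then c (q - 1) * g else c (j - 1)) + (if j = 1 then c (q - 1) else 0))"
  have "Polynomial.coeff (e j) i \<in> K" for j i
  proof -
    have "Polynomial.coeff (c (q - 1) * g) i \<in> K"
      unfolding coeff_mult by (intro is_subring_sum[OF KsubR] Kr(5) gK c(2)[rule_format])
    thus ?thesis by (auto simp: e_def intro!: Kr(2,3) c(2)[rule_format])
  qed
  hence "(\<Sum>j<q. of_polynomial (e j) * y ^ j) \<in> NF" by (rule NF_I)
  also have "(\<Sum>j<q. of_polynomial (e j) * y ^ j) =
      (\<Sum>j<q. (if j = 0 then of_polynomial (c (q - 1) * g) else of_polynomial (c (j - 1))) * y ^ j)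
      + (\<Sum>j<q. if j = 1 then of_polynomial (c (q - 1)) * y ^ j else 0)"
    unfolding sum.distrib[symmetric] by (intro sum.cong refl) (auto simp: e_def distrib_right)
  also have "(\<Sum>j<q. if j = 1 then of_polynomial (c (q - 1)) * y ^ j else 0) = of_polynomial (c (q - 1)) * y"
    using q(1) by simp
  also have "(\<Sum>j<q. (if j = 0 then of_polynomial (c (q - 1) * g) else of_polynomial (c (j - 1))) * y ^ j)
      = of_polynomial (c (q - 1) * g) + (\<Sum>j<Suc r. of_polynomial (c j) * y ^ Suc j)"
    unfolding r by (subst sum.lessThan_Suc_shift) simp
  also have "of_polynomial (c (q - 1) * g) + (\<Sum>j<Suc r. of_polynomial (c j) * y ^ Suc j) + of_polynomial (c (q - 1)) * y
      = (\<Sum>j<Suc r. of_polynomial (c j) * y ^ Suc j) + of_polynomial (c (q - 1)) * (y + of_polynomial g)"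
    by (simp add: algebra_simps)
  also have "y + of_polynomial g = y ^ Suc (q - 1)" using q(1) by (simp flip: y)
  also have "(\<Sum>j<Suc r. of_polynomial (c j) * y ^ Suc j) + of_polynomial (c (q - 1)) * y ^ Suc (q - 1)
      = (\<Sum>j<q. of_polynomial (c j) * y ^ Suc j)" by (simp add: r)
  also have "\<dots> = y * u" by (simp add: c(1) sum_distrib_left mult_ac)
  finally show ?thesis .
qed

lemma A_NF: "u \<in> A \<Longrightarrow> u \<in> NF"
proof -
  have K1: "Polynomial.coeff (1 :: 'k alg_closure poly) i \<in> K" for i
    using Kr(1,2) by (cases i) (auto simp: one_pCons)
  have "(\<Sum>j<q. of_polynomial (if j = 0 then 1 else 0) * y ^ j) \<in> NF"
    by (rule NF_I) (use K1 Kr(2) in auto)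
  also have "(\<Sum>j<q. of_polynomial (if j = 0 then 1 else 0) * y ^ j) = (\<Sum>j<q. if j = 0 then 1 else 0)"
    by (intro sum.cong) auto
  also have "\<dots> = 1" using q(1) by simp
  finally have one: "1 \<in> NF" .
  \<comment> \<open>Stability of \<open>NF\<close> under multiplication by A follows from the
    generators, without multiplying two normal forms. The claim is the case v = 1.\<close>
  have "\<forall>v\<in>NF. u * v \<in> NF" if "u \<in> A" for u
    using that unfolding A_def
  proof (induction rule: gen_ring.induct)
    case (base s)
    have xK: "Polynomial.coeff [:0, 1:] i \<in> K" for i using Kr(1,2) by (auto simp: coeff_pCons split: nat.splits)
    consider c where "c \<in> K" "s = of_polynomial [:c:]" | "s = of_polynomial [:0, 1:]" | "s = y"
      using base by (auto simp: C_def kap_def x_coord_def)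
    thus ?case
    proof cases
      case 1
      have "Polynomial.coeff [:c:] i \<in> K" for i using 1 Kr(2) by (auto simp: coeff_pCons split: nat.splits)
      thus ?thesis using NF_mult_poly[of "[:c:]"] unfolding 1(2) by blast
    next
      case 2
      thus ?thesis using NF_mult_poly[OF xK] by simp
    next
      case 3
      thus ?thesis using NF_mult_y by simp
    qed
  next
    case (add a b)
    thus ?case by (auto simp: distrib_right intro: NF_add)
  next
    case (mult a b)
    thus ?case by (auto simp: mult.assoc)
  qed
  thus "u \<in> A \<Longrightarrow> u \<in> NF" using one by force
qed

definition at_infinity :: "'k ambient set \<Rightarrow> bool" where
  "at_infinity V \<longleftrightarrow> valuation_ring C L V \<and> x \<notin> V"

lemma x_nonzero: "x \<noteq> 0" by (simp add: x_coord_def)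

lemma infinity_x:
  assumes "at_infinity V" and "n > 0"
  shows "inverse x ^ n \<in> valuation_ideal V"
proof -
  have V: "valuation_ring C L V" and xV: "x \<notin> V" using assms by (auto simp: at_infinity_def)
  have "x \<in> L" using xA AL by blast
  hence "inverse x \<in> valuation_ideal V" using valuation_ideal(8)[OF V L] xV by blast
  thus ?thesis using valuation_power(2)[OF V L, of "inverse x" n] assms(2) Lr(2) \<open>x \<in> L\<close> by blast
qed

lemma infinity_poly_lead:
  assumes V: "at_infinity V" and c: "\<And>i. Polynomial.coeff c i \<in> K" "c \<noteq> 0"
  shows "same_lead V (of_polynomial c) (kap (Polynomial.lead_coeff c) * x ^ Polynomial.degree c)"
  using c
proof (induction c)
  case (pCons a c)
  have val: "valuation_ring C L V" using V by (simp add: at_infinity_def)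
  note SL = same_lead[OF val L]
  have aK: "a \<in> K" using pCons.prems(1)[of 0] by simp
  have cK: "Polynomial.coeff c i \<in> K" for i using pCons.prems(1)[of "Suc i"] by simp
  show ?case
  proof (cases "c = 0")
    case True
    hence "a \<noteq> 0" using pCons.prems by simp
    hence "same_lead V (kap a) (kap a)" using SL(1) by simp
    thus ?thesis using True by (simp add: of_polynomial_pCons)
  next
    case False
    define T where "T = kap (Polynomial.lead_coeff c) * x ^ Suc (Polynomial.degree c)"
    have "same_lead V (of_polynomial c * x) (kap (Polynomial.lead_coeff c) * x ^ Polynomial.degree c * x)"
      using pCons.IH[OF cK False] SL(1)[OF x_nonzero] SL(4) by blast
    hence "same_lead V (x * of_polynomial c) T" by (simp add: T_def mult_ac)
    moreover have "kap a / T \<in> valuation_ideal V"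
    proof -
      have lc: "Polynomial.lead_coeff c \<in> K" "Polynomial.lead_coeff c \<noteq> 0" using cK False by auto
      have "kap a * inverse (kap (Polynomial.lead_coeff c)) \<in> V"
        using kap_unit(2)[OF val lc] is_subringD(5)[OF valuation_ringD(1)[OF val]] valuation_ringD(2)[OF val] aK
        by (auto simp: C_def)
      hence "inverse x ^ Suc (Polynomial.degree c) * (kap a * inverse (kap (Polynomial.lead_coeff c))) \<in> valuation_ideal V"
        using infinity_x[OF V] valuation_ideal(4)[OF val L] by blast
      also have "inverse x ^ Suc (Polynomial.degree c) * (kap a * inverse (kap (Polynomial.lead_coeff c))) = kap a / T"
        by (simp add: T_def divide_inverse power_inverse mult_ac)
      finally show ?thesis .
    qed
    ultimately have "same_lead V (x * of_polynomial c + kap a) T" by (rule SL(8))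
    thus ?thesis using False by (simp add: T_def of_polynomial_pCons add.commute)
  qed
qed simp

definition lead_term :: "'k alg_closure \<Rightarrow> nat \<Rightarrow> nat \<Rightarrow> 'k ambient" where
  "lead_term c i j = kap c * x ^ i * y ^ j"

lemma g_nonzero: "g \<noteq> 0" using q(3) by auto

text \<open>y has a pole, since otherwise g(x) and then x would lie in V. Hence y is negligible
  against y^q, which has the lead of g(x).\<close>

lemma infinity_y:
  assumes V: "at_infinity V"
  shows "same_lead V (y ^ q) (kap (Polynomial.lead_coeff g) * x ^ Polynomial.degree g)" "y \<noteq> 0"
proof -
  have val: "valuation_ring C L V" using V by (simp add: at_infinity_def)
  note SL = same_lead[OF val L]
  note R = is_subringD[OF valuation_ringD(1)[OF val]]
  note J = valuation_ideal[OF val L]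
  have lc: "Polynomial.lead_coeff g \<in> K" "Polynomial.lead_coeff g \<noteq> 0" using gK g_nonzero by auto
  have g: "same_lead V (of_polynomial g) (kap (Polynomial.lead_coeff g) * x ^ Polynomial.degree g)"
    by (rule infinity_poly_lead[OF V gK g_nonzero])
  have xL: "x \<in> L" and yL: "y \<in> L" using xA yA AL by auto
  have "y \<notin> V"
  proof
    assume "y \<in> V"
    hence "of_polynomial g \<in> V" using R(4,7) by (simp flip: y)
    hence "kap (Polynomial.lead_coeff g) * x ^ Polynomial.degree g \<in> V" using SL(9)[OF g] by simp
    hence "inverse (kap (Polynomial.lead_coeff g)) * (kap (Polynomial.lead_coeff g) * x ^ Polynomial.degree g) \<in> V"
      using kap_unit(2)[OF val lc] R(5) by blast
    hence "x ^ Polynomial.degree g \<in> V" using lc by (simp flip: mult.assoc)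
    hence "x \<in> V" using valuation_power(1)[OF val L xL, of "Polynomial.degree g"] q(3) by simp
    thus False using V by (simp add: at_infinity_def)
  qed
  hence y0: "y \<noteq> 0" and iy: "inverse y \<in> valuation_ideal V" using J(8) yL by auto
  show "y \<noteq> 0" by fact
  have "inverse y ^ (q - 1) \<in> valuation_ideal V"
    using valuation_power(2)[OF val L Lr(2)[OF yL], of "q - 1"] iy q(1) by simp
  moreover have "(- y) / y ^ q = 0 - inverse y ^ (q - 1)"
  proof -
    have "y ^ q = y ^ (q - 1) * y" using q(1) by (metis Suc_diff_1 less_le_trans power_Suc2 zero_less_numeral)
    thus ?thesis using y0 by (simp add: power_inverse field_simps)
  qed
  ultimately have "(- y) / y ^ q \<in> valuation_ideal V" using J(2,6) by metis
  with SL(1)[OF power_not_zero[OF y0, of q]] have "same_lead V (y ^ q + (- y)) (y ^ q)" by (rule SL(8))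
  hence "same_lead V (of_polynomial g) (y ^ q)" by (simp flip: y)
  thus "same_lead V (y ^ q) (kap (Polynomial.lead_coeff g) * x ^ Polynomial.degree g)" using SL(3,5) g by blast
qed

lemma weight_inj:
  assumes "q * i + Polynomial.degree g * j = q * i' + Polynomial.degree g * j'" "j < q" "j' < q"
  shows "i = i' \<and> j = j'"
proof -
  have *: "j = j'" if h: "q * i + Polynomial.degree g * j = q * i' + Polynomial.degree g * j'" "j \<le> j'" "j' < q" for i j i' j'
  proof -
    have "i' \<le> i"
    proof (rule ccontr)
      assume "\<not> i' \<le> i"
      hence "q * i < q * i'" using q(1) by simp
      moreover have "Polynomial.degree g * j \<le> Polynomial.degree g * j'" using h by simp
      ultimately show False using h by linarith
    qed
    then obtain m where "i = i' + m" by (metis le_Suc_ex)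
    hence "q * m + Polynomial.degree g * j = Polynomial.degree g * j'" using h(1) by (simp add: algebra_simps)
    moreover obtain l where l: "j' = j + l" using h(2) by (metis le_Suc_ex)
    ultimately have "q * m = Polynomial.degree g * l" by (simp add: algebra_simps)
    hence "q dvd Polynomial.degree g * l" by (metis dvd_triv_left)
    hence "q dvd l" using q(2) by (simp add: coprime_commute coprime_dvd_mult_right_iff)
    thus ?thesis using l h(3) by (auto dest: dvd_imp_le)
  qed
  have "j = j'" using *[of i j i' j'] *[of i' j' i j] assms by (cases "j \<le> j'") auto
  thus ?thesis using assms q(1) by simp
qed

text \<open>V comes without a valuation map, so the quotient is raised to the power q: there y^q can
  be traded for x^d, leaving a constant times a positive power of 1/x.\<close>

lemma infinity_compare:
  assumes V: "at_infinity V" and c: "c \<in> K" "c \<noteq> 0" "c' \<in> K" "c' \<noteq> 0"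
    and less: "q * i + Polynomial.degree g * j < q * i' + Polynomial.degree g * j'"
  shows "lead_term c i j / lead_term c' i' j' \<in> valuation_ideal V"
proof -
  have val: "valuation_ring C L V" using V by (simp add: at_infinity_def)
  note SL = same_lead[OF val L]
  note R = is_subringD[OF valuation_ringD(1)[OF val]]
  define d where "d = Polynomial.degree g"
  define G where "G = Polynomial.lead_coeff g"
  have G: "G \<in> K" "G \<noteq> 0" using gK g_nonzero by (auto simp: G_def)
  have lead: "same_lead V (lead_term e m n ^ q) (kap (e ^ q * G ^ n) * x ^ (q * m + d * n))" if e: "e \<noteq> 0" for e m n
  proof -
    have 1: "same_lead V ((y ^ q) ^ n) ((kap G * x ^ d) ^ n)" unfolding G_def d_def by (rule SL(6)[OF infinity_y(1)[OF V]])
    have "same_lead V (kap (e ^ q) * x ^ (q * m)) (kap (e ^ q) * x ^ (q * m))" using e x_nonzero by (intro SL(1)) simp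
    from SL(4)[OF this 1]
    have "same_lead V (kap (e ^ q) * x ^ (q * m) * (y ^ q) ^ n) (kap (e ^ q) * x ^ (q * m) * (kap G * x ^ d) ^ n)" .
    also have "kap (e ^ q) * x ^ (q * m) * (y ^ q) ^ n = lead_term e m n ^ q"
      by (simp add: lead_term_def power_mult_distrib mult.commute flip: power_mult)
    also have "kap (e ^ q) * x ^ (q * m) * (kap G * x ^ d) ^ n = kap (e ^ q * G ^ n) * x ^ (q * m + d * n)"
      by (simp add: power_mult_distrib power_add mult_ac flip: power_mult)
    finally show ?thesis .
  qed
  define W where "W = q * i + d * j"
  define W' where "W' = q * i' + d * j'"
  have WW: "W < W'" using less by (simp add: W_def W'_def d_def)
  have "same_lead V (lead_term c i j ^ q * inverse (lead_term c' i' j' ^ q))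
      (kap (c ^ q * G ^ j) * x ^ W * inverse (kap (c' ^ q * G ^ j') * x ^ W'))"
    unfolding W_def W'_def by (intro SL(4) SL(7) lead c)
  also have "lead_term c i j ^ q * inverse (lead_term c' i' j' ^ q) = (lead_term c i j / lead_term c' i' j') ^ q"
    by (simp add: divide_inverse power_mult_distrib power_inverse)
  also have "kap (c ^ q * G ^ j) * x ^ W * inverse (kap (c' ^ q * G ^ j') * x ^ W') =
      inverse x ^ (W' - W) * (kap (c ^ q * G ^ j) * inverse (kap (c' ^ q * G ^ j')))"
    using WW x_nonzero by (simp add: power_inverse power_diff divide_inverse mult_ac)
  finally have s: "same_lead V ((lead_term c i j / lead_term c' i' j') ^ q)
      (inverse x ^ (W' - W) * (kap (c ^ q * G ^ j) * inverse (kap (c' ^ q * G ^ j'))))" .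
  have "c ^ q * G ^ j \<in> K" "c' ^ q * G ^ j' \<in> K" "c' ^ q * G ^ j' \<noteq> 0" "c ^ q * G ^ j \<noteq> 0" using c G by (auto intro: Kr(5,7))
  hence "kap (c ^ q * G ^ j) * inverse (kap (c' ^ q * G ^ j')) \<in> V"
    using kap_unit(1,2)[OF val] R(5) by blast
  hence "inverse x ^ (W' - W) * (kap (c ^ q * G ^ j) * inverse (kap (c' ^ q * G ^ j'))) \<in> valuation_ideal V"
    using infinity_x[OF V, of "W' - W"] WW valuation_ideal(4)[OF val L] by simp
  hence "(lead_term c i j / lead_term c' i' j') ^ q \<in> valuation_ideal V" using SL(10)[OF s] by simp
  moreover have "lead_term c i j / lead_term c' i' j' \<in> L"
  proof -
    have "lead_term e m n \<in> A" if "e \<in> K" for e m n unfolding lead_term_def by (intro Ar(5,7) kapA xA yA that)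
    thus ?thesis using c unfolding L_def by blast
  qed
  ultimately show ?thesis using valuation_power(2)[OF val L] q(1) by simp
qed

text \<open>The weights \<open>q i + d j\<close> with \<open>j < q\<close> are distinct, so one term of the normal form dominates.\<close>

lemma infinity_lead:
  assumes u: "u \<in> A" "u \<noteq> 0"
  shows "\<exists>c\<in>K. \<exists>i. \<exists>j<q. c \<noteq> 0 \<and> (\<forall>V. at_infinity V \<longrightarrow> same_lead V u (lead_term c i j))"
proof -
  obtain c where c: "u = (\<Sum>j<q. of_polynomial (c j) * y ^ j)" "\<forall>j i. Polynomial.coeff (c j) i \<in> K"
    using A_NF[OF u(1)] unfolding NF_def by blast
  define J where "J = {j. j < q \<and> c j \<noteq> 0}"
  have finJ: "finite J" by (simp add: J_def)
  have uJ: "u = (\<Sum>j\<in>J. of_polynomial (c j) * y ^ j)"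
    unfolding c(1) by (rule sum.mono_neutral_right) (auto simp: J_def)
  have "J \<noteq> {}" using u(2) uJ by auto
  define wt where "wt = (\<lambda>j. q * Polynomial.degree (c j) + Polynomial.degree g * j)"
  have "Max (wt ` J) \<in> wt ` J" using finJ \<open>J \<noteq> {}\<close> by (intro Max_in) auto
  then obtain j0 where j0: "j0 \<in> J" "wt j0 = Max (wt ` J)" by auto
  have max: "wt j < wt j0" if "j \<in> J" "j \<noteq> j0" for j
  proof -
    have "wt j \<le> wt j0" using j0 finJ that by simp
    moreover have "wt j \<noteq> wt j0" using weight_inj that j0(1) unfolding wt_def J_def by blast
    ultimately show ?thesis by simp
  qed
  define lc where "lc = (\<lambda>j. Polynomial.lead_coeff (c j))"
  define dg where "dg = (\<lambda>j. Polynomial.degree (c j))"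
  have lc: "lc j \<in> K" "lc j \<noteq> 0" if "j \<in> J" for j using that c(2) by (auto simp: lc_def J_def)
  \<comment> \<open>The lead term has been fixed before V; uniqueness of the place at infinity rests
    on this.\<close>
  have "same_lead V u (lead_term (lc j0) (dg j0) j0)" if V: "at_infinity V" for V
  proof -
    have val: "valuation_ring C L V" using V by (simp add: at_infinity_def)
    note SL = same_lead[OF val L]
    define T where "T = lead_term (lc j0) (dg j0) j0"
    have term_lead: "same_lead V (of_polynomial (c j) * y ^ j) (lead_term (lc j) (dg j) j)" if "j \<in> J" for j
    proof -
      have "same_lead V (of_polynomial (c j)) (kap (lc j) * x ^ dg j)"
        unfolding lc_def dg_def using that c(2) by (intro infinity_poly_lead[OF V]) (auto simp: J_def)
      moreover have "same_lead V (y ^ j) (y ^ j)" using infinity_y(2)[OF V] by (intro SL(1)) simp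
      ultimately show ?thesis unfolding lead_term_def by (rule SL(4))
    qed
    have T0: "T \<noteq> 0" using term_lead[OF j0(1)] by (simp add: T_def same_lead_def)
    have "of_polynomial (c j) * y ^ j / T \<in> valuation_ideal V" if "j \<in> J - {j0}" for j
    proof -
      have "same_lead V (of_polynomial (c j) * y ^ j * inverse T) (lead_term (lc j) (dg j) j * inverse T)"
        using that T0 by (intro SL(4) term_lead SL(1)) auto
      moreover have "lead_term (lc j) (dg j) j / T \<in> valuation_ideal V"
        unfolding T_def using lc j0(1) that max[of j] by (intro infinity_compare[OF V]) (auto simp: wt_def dg_def)
      ultimately show ?thesis using SL(10) by (simp add: divide_inverse)
    qed
    hence "(\<Sum>j\<in>J - {j0}. of_polynomial (c j) * y ^ j / T) \<in> valuation_ideal V"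
      by (rule valuation_ideal_sum[OF val L])
    hence "(\<Sum>j\<in>J - {j0}. of_polynomial (c j) * y ^ j) / T \<in> valuation_ideal V" by (simp add: sum_divide_distrib)
    with term_lead[OF j0(1)]
    have "same_lead V (of_polynomial (c j0) * y ^ j0 + (\<Sum>j\<in>J - {j0}. of_polynomial (c j) * y ^ j)) T"
      unfolding T_def by (rule SL(8))
    thus ?thesis unfolding uJ T_def using sum.remove[OF finJ j0(1), of "\<lambda>j. of_polynomial (c j) * y ^ j"] by simp
  qed
  thus ?thesis using lc[OF j0(1)] j0(1) unfolding J_def by blast
qed

text \<open>Weights are pole orders, so the larger one decides against membership. Equal weights
  force equal exponents by \<open>weight_inj\<close>, and the quotient of the lead terms is then the
  constant c / e.\<close>

lemma infinity_value:
  assumes c: "c \<in> K" "c \<noteq> 0" "e \<in> K" "e \<noteq> 0" and j: "j < q" "j' < q"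
    and u: "same_lead V u (lead_term c i j)" and v: "same_lead V v (lead_term e i' j')" and V: "at_infinity V"
  defines "W \<equiv> q * i + Polynomial.degree g * j" and "W' \<equiv> q * i' + Polynomial.degree g * j'"
  shows "W > W' \<Longrightarrow> u / v \<notin> V" "W < W' \<Longrightarrow> u / v \<in> valuation_ideal V"
    "W = W' \<Longrightarrow> u / v - kap (c / e) \<in> valuation_ideal V"
proof -
  have val: "valuation_ring C L V" using V by (simp add: at_infinity_def)
  note SL = same_lead[OF val L]
  note R = is_subringD[OF valuation_ringD(1)[OF val]]
  note J = valuation_ideal[OF val L]
  define T where "T = lead_term c i j"
  define T' where "T' = lead_term e i' j'"
  have nz: "T \<noteq> 0" "T' \<noteq> 0" "u \<noteq> 0" "v \<noteq> 0" using u v by (auto simp: same_lead_def T_def T'_def)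
  have s: "same_lead V (u / v) (T / T')" unfolding divide_inverse T_def T'_def by (intro SL(4) SL(7) u v)
  show "u / v \<in> valuation_ideal V" if "W < W'"
    using SL(10)[OF s] infinity_compare[OF V c, of i j i' j'] that by (simp add: W_def W'_def T_def T'_def)
  show "u / v \<notin> V" if "W > W'"
  proof
    assume "u / v \<in> V"
    hence "T / T' \<in> V" using SL(9)[OF s] by simp
    moreover have "T' / T \<in> valuation_ideal V"
      unfolding T_def T'_def using that c by (intro infinity_compare[OF V]) (auto simp: W_def W'_def)
    ultimately have "(T' / T) * (T / T') \<in> valuation_ideal V" using J(4) by blast
    thus False using nz J(3) by simp
  qed
  show "u / v - kap (c / e) \<in> valuation_ideal V" if "W = W'"
  proof -
    have ij: "i = i'" "j = j'" using weight_inj[of i j i' j'] that j by (auto simp: W_def W'_def)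
    have ce: "c / e \<in> K" "c / e \<noteq> 0" using c Kr(5,8) by (auto simp: divide_inverse)
    have "T / T' = kap (c / e)"
      using ij x_nonzero infinity_y(2)[OF V] c by (simp add: T_def T'_def lead_term_def kap_divide)
    hence "(u / v) / kap (c / e) - 1 \<in> valuation_ideal V" using s by (simp add: same_lead_def)
    hence "((u / v) / kap (c / e) - 1) * kap (c / e) \<in> valuation_ideal V"
      using J(4) kap_unit(1)[OF val ce] by blast
    moreover have "((u / v) / kap (c / e) - 1) * kap (c / e) = u / v - kap (c / e)"
    proof -
      have "kap (c / e) \<noteq> 0" using ce by (simp only: kap_simps) simp
      thus ?thesis by (simp add: left_diff_distrib)
    qed
    ultimately show ?thesis by simp
  qed
qed

lemma infinity_cases:
  assumes "t \<in> L" "t \<noteq> 0"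
  shows "\<exists>u v c i j e i' j'. t = u / v \<and> c \<in> K \<and> c \<noteq> 0 \<and> e \<in> K \<and> e \<noteq> 0 \<and> j < q \<and> j' < q \<and>
    (\<forall>V. at_infinity V \<longrightarrow> same_lead V u (lead_term c i j) \<and> same_lead V v (lead_term e i' j'))"
proof -
  obtain u v where uv: "t = u / v" "u \<in> A" "v \<in> A" using assms(1) by (auto simp: L_def)
  have nz: "u \<noteq> 0" "v \<noteq> 0" using assms(2) uv by auto
  obtain c i j where "c \<in> K" "c \<noteq> 0" "j < q" "\<And>V. at_infinity V \<Longrightarrow> same_lead V u (lead_term c i j)"
    using infinity_lead[OF uv(2) nz(1)] by blast
  moreover obtain e i' j' where "e \<in> K" "e \<noteq> 0" "j' < q" "\<And>V. at_infinity V \<Longrightarrow> same_lead V v (lead_term e i' j')"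
    using infinity_lead[OF uv(3) nz(2)] by blast
  ultimately show ?thesis using uv(1) by blast
qed

lemma infinity_unique:
  assumes V: "at_infinity V" and V': "at_infinity V'"
  shows "V \<subseteq> V'"
proof
  fix t assume t: "t \<in> V"
  have val: "valuation_ring C L V" and val': "valuation_ring C L V'" using V V' by (auto simp: at_infinity_def)
  note J' = valuation_ideal[OF val' L]
  show "t \<in> V'"
  proof (cases "t = 0")
    case False
    have "t \<in> L" using t valuation_ringD(3)[OF val] by blast
    from infinity_cases[OF this False] obtain u v c i j e i' j' where tt: "t = u / v"
      and c: "c \<in> K" "c \<noteq> 0" "e \<in> K" "e \<noteq> 0" and j: "j < q" "j' < q"
      and l: "\<And>V. at_infinity V \<Longrightarrow> same_lead V u (lead_term c i j)" "\<And>V. at_infinity V \<Longrightarrow> same_lead V v (lead_term e i' j')"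
      by blast
    note val1 = infinity_value[OF c j l[OF V] V] and val2 = infinity_value[OF c j l[OF V'] V']
    consider "q * i + Polynomial.degree g * j < q * i' + Polynomial.degree g * j'" |
      "q * i + Polynomial.degree g * j = q * i' + Polynomial.degree g * j'"
      using val1(1) t tt by (metis linorder_neqE_nat)
    thus ?thesis
    proof cases
      case 1
      thus ?thesis using val2(2) tt J'(1) by blast
    next
      case 2
      have "c / e \<in> K" using c Kr(5,8) by (simp add: divide_inverse)
      hence k: "kap (c / e) \<in> V'" using valuation_ringD(2)[OF val'] by (auto simp: C_def)
      have "t - kap (c / e) \<in> V'" using val2(3)[OF 2] tt J'(1) by blast
      from is_subringD(3)[OF valuation_ringD(1)[OF val'] this k] show ?thesis by simp
    qed
  qed (use is_subringD(2)[OF valuation_ringD(1)[OF val']] in simp)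
qed

lemma infinity_rational:
  assumes V: "at_infinity V" shows "rational_place C L V"
  unfolding rational_place_def
proof (intro conjI ballI)
  show val: "valuation_ring C L V" using V by (simp add: at_infinity_def)
  note J = valuation_ideal[OF val L]
  have z0: "0 \<in> C" using Kr(2) by (auto simp: C_def intro: image_eqI[of _ _ 0])
  fix t assume t: "t \<in> V"
  show "\<exists>c\<in>C. t - c \<in> valuation_ideal V"
  proof (cases "t = 0")
    case True
    thus ?thesis using z0 J(2) by (intro bexI[of _ 0]) auto
  next
    case False
    have "t \<in> L" using t valuation_ringD(3)[OF val] by blast
    from infinity_cases[OF this False] obtain u v c i j e i' j' where tt: "t = u / v"
      and c: "c \<in> K" "c \<noteq> 0" "e \<in> K" "e \<noteq> 0" and j: "j < q" "j' < q"
      and l: "\<And>V. at_infinity V \<Longrightarrow> same_lead V u (lead_term c i j)" "\<And>V. at_infinity V \<Longrightarrow> same_lead V v (lead_term e i' j')"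
      by blast
    note val1 = infinity_value[OF c j l[OF V] V]
    consider "q * i + Polynomial.degree g * j < q * i' + Polynomial.degree g * j'" |
      "q * i + Polynomial.degree g * j = q * i' + Polynomial.degree g * j'"
      using val1(1) t tt by (metis linorder_neqE_nat)
    thus ?thesis
    proof cases
      case 1
      thus ?thesis using val1(2) tt z0 by (intro bexI[of _ 0]) auto
    next
      case 2
      have "c / e \<in> K" using c Kr(5,8) by (simp add: divide_inverse)
      thus ?thesis using val1(3)[OF 2] tt by (auto simp: C_def)
    qed
  qed
qed

text \<open>The elements of C[1/x] have the form P(x) / x^n with deg P at most n, so x is not among
  them and 1/x is not invertible.\<close>

lemma exists_infinity: "\<exists>V. at_infinity V"
proof -
  define R where "R = gen_ring (C \<union> {inverse x})"
  have "kap 1 \<in> C" "kap (- 1) \<in> C" unfolding C_def using Kr(1,6) by blast+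
  hence Rr: "is_subring R" unfolding R_def by (intro is_subring_gen_ring) simp_all
  have L': "is_subring L" "\<And>a. a \<in> L \<Longrightarrow> inverse a \<in> L" using L by (auto simp: fraction_closed_def)
  have xL: "x \<in> L" using xA AL by blast
  have "C \<union> {inverse x} \<subseteq> L" using CA AL L'(2)[OF xL] by blast
  hence RL: "R \<subseteq> L" unfolding R_def by (rule gen_ring_subset[OF L'(1)])
  have form: "\<exists>n P. Polynomial.degree P \<le> n \<and> r * x ^ n = of_polynomial P" if "r \<in> R" for r
    using that unfolding R_def
  proof (induction rule: gen_ring.induct)
    case (base r)
    then consider c where "r = kap c" | "r = inverse x" by (auto simp: C_def)
    thus ?case
    proof cases
      case 1
      thus ?thesis by (intro exI[of _ 0] exI[of _ "[:c:]"]) (simp add: kap_def)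
    next
      case 2
      thus ?thesis using x_nonzero by (intro exI[of _ 1] exI[of _ 1]) simp
    qed
  next
    case (add r t)
    then obtain n P m S where PS: "Polynomial.degree P \<le> n" "r * x ^ n = of_polynomial P"
      "Polynomial.degree S \<le> m" "t * x ^ m = of_polynomial S" by blast
    have xp: "x ^ l = of_polynomial (Polynomial.monom 1 l)" for l
      by (induction l) (simp_all add: monom_Suc of_polynomial_pCons)
    have "(r + t) * x ^ (n + m) = (r * x ^ n) * x ^ m + (t * x ^ m) * x ^ n" by (simp add: algebra_simps power_add)
    also have "\<dots> = of_polynomial (P * Polynomial.monom 1 m + S * Polynomial.monom 1 n)" by (simp only: PS(2,4)) (simp add: xp)
    finally have "(r + t) * x ^ (n + m) = of_polynomial (P * Polynomial.monom 1 m + S * Polynomial.monom 1 n)" .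
    moreover have "Polynomial.degree (P * Polynomial.monom 1 m + S * Polynomial.monom 1 n) \<le> n + m"
    proof (intro degree_add_le)
      show "Polynomial.degree (P * Polynomial.monom 1 m) \<le> n + m"
        using degree_mult_le[of P "Polynomial.monom 1 m"] degree_monom_le[of "1 :: 'k alg_closure" m] PS by linarith
      show "Polynomial.degree (S * Polynomial.monom 1 n) \<le> n + m"
        using degree_mult_le[of S "Polynomial.monom 1 n"] degree_monom_le[of "1 :: 'k alg_closure" n] PS by linarith
    qed
    ultimately show ?case by blast
  next
    case (mult r t)
    then obtain n P m S where PS: "Polynomial.degree P \<le> n" "r * x ^ n = of_polynomial P"
      "Polynomial.degree S \<le> m" "t * x ^ m = of_polynomial S" by blast
    have "(r * t) * x ^ (n + m) = (r * x ^ n) * (t * x ^ m)" by (simp add: power_add mult_ac)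
    also have "\<dots> = of_polynomial (P * S)" by (simp add: PS)
    finally show ?case using degree_mult_le[of P S] PS by (intro exI[of _ "n + m"] exI[of _ "P * S"]) auto
  qed
  have xR: "inverse (inverse x) \<notin> R"
  proof
    assume "inverse (inverse x) \<in> R"
    then obtain n P where P: "Polynomial.degree P \<le> n" "x * x ^ n = of_polynomial P" using form[of x] by auto
    have "x * x ^ n = of_polynomial (Polynomial.monom 1 (Suc n))"
      by (simp add: of_polynomial_pCons monom_Suc) (induction n; simp add: monom_Suc of_polynomial_pCons)
    hence "P = Polynomial.monom 1 (Suc n)" using P(2) by simp
    thus False using P(1) by (simp add: degree_monom_eq)
  qed
  have "inverse x \<in> R" unfolding R_def by (intro gen_ring.base) simp
  from exists_valuation_ring[OF L' Rr RL this xR] obtain V where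
    V: "is_subring V" "R \<subseteq> V" "V \<subseteq> L" "x \<notin> V" "\<And>w. w \<in> L \<Longrightarrow> w \<in> V \<or> inverse w \<in> V" by auto
  have "C \<subseteq> R" unfolding R_def by (auto intro: gen_ring.base)
  hence "C \<subseteq> V" using V(2) by blast
  thus ?thesis using valuation_ringI[OF V(1) _ V(3,5) xL V(4)] V(4) unfolding at_infinity_def by blast
qed

text \<open>y is integral over C[x], so it lies in V together with x. Reducing the equation gives an
  equation between the residues a and b, because a constant in the ideal is 0.\<close>

lemma finite_place_coordinates:
  assumes V: "rational_place C L V" and x: "x \<in> V"
  shows "\<exists>a b. a \<in> K \<and> b \<in> K \<and> b ^ q - b = poly g a \<and> x - kap a \<in> valuation_ideal V \<and> y - kap b \<in> valuation_ideal V"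
proof -
  have val: "valuation_ring C L V" using V by (simp add: rational_place_def)
  note R = is_subringD[OF valuation_ringD(1)[OF val]]
  note J = valuation_ideal[OF val L]
  have CV: "C \<subseteq> V" by (rule valuation_ringD(2)[OF val])
  have polyV: "of_polynomial c \<in> V" if "\<And>i. Polynomial.coeff c i \<in> K" for c
    using that
  proof (induction c)
    case (pCons e c)
    have "e \<in> K" using pCons.prems[of 0] by simp
    hence "kap e \<in> V" using CV by (auto simp: C_def)
    moreover have "of_polynomial c \<in> V" using pCons.IH pCons.prems[of "Suc i" for i] by simp
    ultimately show ?case using x R(3,5) by (simp add: of_polynomial_pCons)
  qed (simp add: R)
  have yL: "y \<in> L" using yA AL by blast
  have yV: "y \<in> V"
  proof (rule ccontr)
    assume "y \<notin> V"
    hence y0: "y \<noteq> 0" and iy: "inverse y \<in> valuation_ideal V" using J(8) yL by auto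
    have "inverse y ^ (q - 1) \<in> valuation_ideal V"
      using valuation_power(2)[OF val L Lr(2)[OF yL], of "q - 1"] iy q(1) by simp
    moreover have "inverse y ^ q \<in> valuation_ideal V"
      using valuation_power(2)[OF val L Lr(2)[OF yL], of q] iy q(1) by simp
    \<comment> \<open>Dividing y^q = y + g by y^q expresses 1 by elements of the ideal.\<close>
    ultimately have "inverse y ^ (q - 1) + inverse y ^ q * of_polynomial g \<in> valuation_ideal V"
      using polyV[OF gK] J(4,5) by blast
    also have "inverse y ^ (q - 1) + inverse y ^ q * of_polynomial g = 1"
    proof -
      have "inverse y ^ (q - 1) = inverse y ^ q * y"
        using y0 q(1) by (cases q) (auto simp: field_simps)
      hence "inverse y ^ (q - 1) + inverse y ^ q * of_polynomial g = inverse y ^ q * y ^ q"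
        by (simp add: algebra_simps flip: y)
      thus ?thesis using y0 by (simp flip: power_mult_distrib)
    qed
    finally show False using J(3) by simp
  qed
  obtain a where a: "a \<in> K" "x - kap a \<in> valuation_ideal V" using V x by (auto simp: rational_place_def C_def)
  obtain b where b: "b \<in> K" "y - kap b \<in> valuation_ideal V" using V yV by (auto simp: rational_place_def C_def)
  have diff: "of_polynomial c - kap (poly c a) \<in> valuation_ideal V" if "\<And>i. Polynomial.coeff c i \<in> K" for c
    using that
  proof (induction c)
    case (pCons e c)
    have cK: "Polynomial.coeff c i \<in> K" for i using pCons.prems[of "Suc i"] by simp
    have "of_polynomial (pCons e c) - kap (poly (pCons e c) a) =
        (of_polynomial c - kap (poly c a)) * kap a + (x - kap a) * of_polynomial c"
      by (simp add: of_polynomial_pCons algebra_simps)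
    moreover have "kap a \<in> V" using a(1) CV by (auto simp: C_def)
    hence "(of_polynomial c - kap (poly c a)) * kap a + (x - kap a) * of_polynomial c \<in> valuation_ideal V"
      using J(5)[OF J(4)[OF pCons.IH[OF cK]] J(4)[OF a(2) polyV[OF cK]]] by simp
    ultimately show ?case by simp
  qed (simp add: J)
  have "(y - kap b) ^ q \<in> valuation_ideal V"
  proof -
    have "y - kap b \<in> L" using b(2) J(1) valuation_ringD(3)[OF val] by blast
    thus ?thesis using valuation_power(2)[OF val L, of "y - kap b" q] b(2) q(1) by simp
  qed
  hence "((y - kap b) ^ q - (y - kap b)) - (of_polynomial g - kap (poly g a)) \<in> valuation_ideal V"
    by (intro J(6) b(2) diff gK)
  also have "((y - kap b) ^ q - (y - kap b)) - (of_polynomial g - kap (poly g a)) = kap (poly g a - (b ^ q - b))"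
    by (simp add: frob_diff flip: y)
  finally have m: "kap (poly g a - (b ^ q - b)) \<in> valuation_ideal V" .
  have "poly g a - (b ^ q - b) \<in> K"
    unfolding poly_altdef using gK a b by (intro Kr(4) is_subring_sum[OF KsubR] Kr(5) Kr(7)) auto
  hence "poly g a - (b ^ q - b) = 0" using m kap_unit(3)[OF val] by blast
  hence "b ^ q - b = poly g a" by simp
  thus ?thesis using a b by blast
qed

theorem card_rational_places:
  "card {V. rational_place C L V} = Suc (card {(a, b). a \<in> K \<and> b \<in> K \<and> b ^ q - b = poly g a})"
proof -
  define Pt where "Pt = {(a, b). a \<in> K \<and> b \<in> K \<and> b ^ q - b = poly g a}"
  have finPt: "finite Pt" by (rule finite_subset[of _ "K \<times> K"]) (use finK in \<open>auto simp: Pt_def\<close>)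
  define centre where "centre = (\<lambda>(a, b) V. valuation_ring C L V \<and> x - kap a \<in> valuation_ideal V \<and> y - kap b \<in> valuation_ideal V)"
  have loc: "affine_point K q g y a b" if "(a, b) \<in> Pt" for a b
    using that artin_schreier_curve_axioms by (simp add: affine_point_def affine_point_axioms_def Pt_def)
  define F where "F = (\<lambda>P. SOME V. centre P V)"
  have F: "centre P (F P)" if P: "P \<in> Pt" for P
  proof -
    obtain a b where Pab: "P = (a, b)" by (cases P)
    interpret affine_point K q g y a b using loc P Pab by simp
    have "\<exists>V. centre P V" using exists_affine_place by (simp add: centre_def Pab z_def yb_def)
    thus ?thesis unfolding F_def by (rule someI_ex)
  qed
  have uniq: "V = V'" if P: "P \<in> Pt" and "centre P V" "centre P V'" for P V V'
  proof -
    obtain a b where Pab: "P = (a, b)" by (cases P)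
    interpret affine_point K q g y a b using loc P Pab by simp
    show ?thesis using affine_place_unique that by (auto simp: centre_def Pab z_def yb_def)
  qed
  have rat: "rational_place C L V" if P: "P \<in> Pt" and "centre P V" for P V
  proof -
    obtain a b where Pab: "P = (a, b)" by (cases P)
    interpret affine_point K q g y a b using loc P Pab by simp
    show ?thesis using affine_place_rational that by (auto simp: centre_def Pab z_def yb_def)
  qed
  have xV: "x \<in> V" if P: "P \<in> Pt" and centre: "centre P V" for P V
  proof -
    obtain a b where Pab: "P = (a, b)" by (cases P)
    have val: "valuation_ring C L V" using centre by (simp add: centre_def Pab)
    have "kap a \<in> V" using P valuation_ringD(2)[OF val] by (auto simp: Pt_def Pab C_def)
    moreover have "x - kap a \<in> V" using centre valuation_ideal(1)[OF val L] by (auto simp: centre_def Pab)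
    ultimately have "(x - kap a) + kap a \<in> V" using is_subringD(3)[OF valuation_ringD(1)[OF val]] by blast
    thus ?thesis by simp
  qed
  have inj: "inj_on F Pt"
  proof (rule inj_onI)
    fix P P' assume P: "P \<in> Pt" "P' \<in> Pt" "F P = F P'"
    obtain a b a' b' where ab: "P = (a, b)" "P' = (a', b')" by (cases P, cases P')
    have centre: "centre (a, b) (F P)" "centre (a', b') (F P)" using F[OF P(1)] F[OF P(2)] P(3) ab by auto
    have val: "valuation_ring C L (F P)" using centre by (simp add: centre_def)
    have eq: "e = e'" if "e \<in> K" "e' \<in> K" "h - kap e \<in> valuation_ideal (F P)" "h - kap e' \<in> valuation_ideal (F P)" for e e' h
    proof -
      have "(h - kap e') - (h - kap e) \<in> valuation_ideal (F P)" using that valuation_ideal(6)[OF val L] by blast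
      hence "kap (e - e') \<in> valuation_ideal (F P)" by simp
      moreover have "e - e' \<in> K" using that Kr(4) by blast
      ultimately have "e - e' = 0" using kap_unit(3)[OF val] by blast
      thus ?thesis by simp
    qed
    show "P = P'" using eq[of a a' x] eq[of b b' y] centre P(1,2) by (auto simp: centre_def ab Pt_def)
  qed
  obtain V0 where V0: "at_infinity V0" using exists_infinity by blast
  have "{V. rational_place C L V} = insert V0 (F ` Pt)"
  proof (intro equalityI subsetI)
    fix V assume "V \<in> {V. rational_place C L V}"
    hence V: "rational_place C L V" by simp
    hence val: "valuation_ring C L V" by (simp add: rational_place_def)
    show "V \<in> insert V0 (F ` Pt)"
    proof (cases "x \<in> V")
      case True
      then obtain a b where ab: "(a, b) \<in> Pt" "centre (a, b) V"
        using finite_place_coordinates[OF V] val by (auto simp: Pt_def centre_def)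
      hence "V = F (a, b)" using uniq F by blast
      thus ?thesis using ab by blast
    next
      case False
      hence "at_infinity V" using val by (simp add: at_infinity_def)
      hence "V = V0" using infinity_unique V0 by blast
      thus ?thesis by simp
    qed
  next
    fix V assume "V \<in> insert V0 (F ` Pt)"
    thus "V \<in> {V. rational_place C L V}" using infinity_rational[OF V0] rat F by auto
  qed
  moreover have "V0 \<notin> F ` Pt" using xV F V0 by (auto simp: at_infinity_def)
  ultimately show ?thesis using inj finPt by (simp add: card_image Pt_def)
qed

lemma L_eq_generate_field: "generate_field ring_of_type_algebra (C \<union> {x, y}) = L"
proof -
  interpret F: field "ring_of_type_algebra :: 'k ambient ring" by (rule field_from_type_algebra)
  have simps: "carrier (ring_of_type_algebra :: 'k ambient ring) = UNIV" "\<one>\<^bsub>ring_of_type_algebra\<^esub> = (1 :: 'k ambient)"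
    "\<zero>\<^bsub>ring_of_type_algebra\<^esub> = (0 :: 'k ambient)" "\<And>a b :: 'k ambient. a \<otimes>\<^bsub>ring_of_type_algebra\<^esub> b = a * b"
    "\<And>a b :: 'k ambient. a \<oplus>\<^bsub>ring_of_type_algebra\<^esub> b = a + b" by (simp_all add: ring_of_type_algebra_def)
  have neg: "\<ominus>\<^bsub>ring_of_type_algebra\<^esub> a = - a" for a :: "'k ambient"
    by (rule F.minus_equality) (simp_all add: simps)
  have inv: "inv\<^bsub>ring_of_type_algebra\<^esub> a = inverse a" if "a \<noteq> 0" for a :: "'k ambient"
    by (rule F.comm_inv_char) (use that in \<open>simp_all add: simps\<close>)
  have L': "is_subring L" "\<And>a. a \<in> L \<Longrightarrow> inverse a \<in> L" using L by (auto simp: fraction_closed_def)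
  note Ls = is_subringD[OF L'(1)]
  show ?thesis
  proof (intro equalityI subsetI)
    fix h assume "h \<in> generate_field ring_of_type_algebra (C \<union> {x, y})"
    thus "h \<in> L"
    proof induction
      case one
      show ?case using Ls(1) by (simp add: simps)
    next
      case (incl h)
      thus ?case using CA AL xA yA by blast
    next
      case (a_inv h)
      thus ?case using Ls(6) by (simp add: neg)
    next
      case (m_inv h)
      thus ?case using L'(2) inv by (simp add: simps)
    next
      case (eng_add h1 h2)
      thus ?case using Ls(3) by (simp add: simps)
    next
      case (eng_mult h1 h2)
      thus ?case using Ls(5) by (simp add: simps)
    qed
  next
    define G where "G = generate_field ring_of_type_algebra (C \<union> {x, y})"
    have Gmult: "a * b \<in> G" if "a \<in> G" "b \<in> G" for a b
      using generate_field.eng_mult[of a _ _ b] that unfolding G_def by (metis simps(4))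
    have "A \<subseteq> G"
    proof
      fix u assume "u \<in> A"
      thus "u \<in> G" unfolding A_def
      proof induction
        case (base s)
        thus ?case unfolding G_def by (rule generate_field.incl)
      next
        case (add a b)
        thus ?case using generate_field.eng_add[of a _ _ b] unfolding G_def by (metis simps(5))
      next
        case (mult a b)
        thus ?case by (intro Gmult)
      qed
    qed
    moreover have "inverse v \<in> G" if "v \<in> G" for v
    proof (cases "v = 0")
      case False
      thus ?thesis using generate_field.m_inv[of v _ "C \<union> {x, y}"] that inv[OF False] unfolding G_def by (metis simps(3))
    qed (use that in simp)
    moreover fix h assume "h \<in> L"
    then obtain u v where "h = u * inverse v" "u \<in> A" "v \<in> A" by (auto simp: L_def divide_inverse)
    ultimately show "h \<in> generate_field ring_of_type_algebra (C \<union> {x, y})" using Gmult unfolding G_def by blast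
  qed
qed

end

lemma point_count_eq:
  fixes f :: "'k::finite_field poly"
  assumes p: "Factorial_Ring.prime p" "CHAR('k) = p" and u: "u \<ge> 1" and s: "s \<ge> 1" "CARD('k) = p ^ s"
    and d: "Polynomial.degree f \<ge> 1" "\<not> p dvd Polynomial.degree f" and n: "n \<ge> 1"
  shows "point_count (p ^ u) f n = 1 + affine_count p (s * n) (p ^ u) (map_poly to_ac f)"
proof -
  define g where "g = (map_poly to_ac f :: 'k alg_closure poly)"
  define q where "q = p ^ u"
  define K where "K = (field_extension n :: 'k alg_closure set)"
  define yy where "yy = (y_coord q f :: 'k ambient)"
  have chr: "CHAR('k alg_closure) = p" using p(2) by simp
  \<comment> \<open>The ambient field contains the constants and hence has their
    characteristic.\<close>
  have "of_nat m = (of_polynomial [:of_nat m:] :: 'k ambient)" for m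
  proof (induction m)
    case (Suc m)
    have "of_polynomial [:of_nat (Suc m):] = (of_polynomial (1 + [:of_nat m:]) :: 'k ambient)" by (simp add: one_pCons)
    thus ?case using Suc by (simp only: of_polynomial_simps of_nat_Suc)
  qed simp
  hence "(of_nat m = (0 :: 'k ambient)) = (of_nat m = (0 :: 'k alg_closure))" for m by simp
  hence chr': "CHAR('k ambient) = p"
    unfolding of_nat_eq_0_iff_char_dvd chr by (metis dvd_antisym dvd_refl)
  have Kff: "K = fixed_field (p ^ (s * n))"
    by (simp add: K_def field_extension_def fixed_field_def s(2) power_mult)
  have q2: "q \<ge> 2"
  proof -
    have "p ^ 1 \<le> p ^ u" using u prime_gt_0_nat[OF p(1)] by (intro power_increasing) auto
    thus ?thesis using prime_ge_2_nat[OF p(1)] by (simp add: q_def)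
  qed
  \<comment> \<open>The choice in \<open>y_coord\<close> is meaningful because the ambient field is
    algebraically closed.\<close>
  have "yy ^ q - yy = of_polynomial g"
  proof -
    define h where "h = Polynomial.monom (1 :: 'k ambient) q - Polynomial.monom 1 1 - [:of_polynomial g:]"
    have "Polynomial.coeff h q = 1" using q2 by (cases q) (auto simp: h_def)
    hence "q \<le> Polynomial.degree h" by (intro le_degree) simp
    hence "Polynomial.degree h > 0" using q2 by simp
    then obtain r where "poly h r = 0" using alg_closed_imp_poly_has_root by blast
    hence "\<exists>r. r ^ q - r = of_polynomial (map_poly to_ac f)" by (intro exI[of _ r]) (simp add: h_def poly_monom g_def)
    thus ?thesis unfolding yy_def y_coord_def g_def by (rule someI_ex)
  qed
  moreover have "fraction_closed K"
    unfolding fraction_closed_def is_subring_def Kff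
    by (safe intro!: fixed_field_closed[OF p(1) chr] fixed_field_0_1[OF p(1)])
  moreover have "finite K" unfolding Kff using s n by (intro finite_fixed_field[OF p(1) chr]) simp
  moreover have "Polynomial.coeff g i \<in> K" for i
  proof -
    have "Polynomial.coeff f i ^ (CARD('k) ^ n) = Polynomial.coeff f i"
      by (rule finite_field_power_card_power_eq_same) simp
    thus ?thesis by (simp add: g_def K_def field_extension_def coeff_map_poly flip: to_ac_power)
  qed
  moreover have "Polynomial.degree g = Polynomial.degree f" by (simp add: g_def degree_map_poly)
  moreover have "coprime (Polynomial.degree f) q"
    using prime_imp_coprime_nat[OF p(1) d(2)] by (simp add: q_def coprime_commute)
  moreover have "(a + b) ^ q = a ^ q + b ^ q" for a b :: "'k ambient"
    by (rule freshmans_dream') (use p(1) chr' in \<open>auto simp: q_def\<close>)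
  ultimately interpret artin_schreier_curve K q g yy
    using q2 d by unfold_locales auto
  have C: "constants n = C" unfolding constants_def C_def kap_def unfolding K_def ..
  have "function_field q f n = L"
  proof -
    have "function_field q f n = generate_field ring_of_type_algebra (C \<union> {x, yy})"
      by (simp only: function_field_def C yy_def)
    thus ?thesis by (simp only: L_eq_generate_field)
  qed
  hence "point_count q f n = card {V. rational_place C L V}" by (simp add: point_count_def C)
  also have "\<dots> = Suc (card {(a, b). a \<in> K \<and> b \<in> K \<and> b ^ q - b = poly g a})" by (rule card_rational_places)
  finally show ?thesis by (simp add: affine_count_def Kff g_def q_def)
qed

subsection \<open>First slopes and the logarithmic derivative\<close>

lemma first_slope_eqI:
  assumes "N 0 = 0" and e: "e > 0" "\<And>t. 0 < t \<Longrightarrow> t \<le> e \<Longrightarrow> N t = \<mu> * ereal t"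
  shows "first_slope N = \<mu>"
  unfolding first_slope_def
proof (rule the_equality)
  show "\<exists>e>0. \<forall>t. 0 < t \<and> t \<le> e \<longrightarrow> N t = N 0 + \<mu> * ereal t"
    using assms by (intro exI[of _ e]) auto
  fix m assume "\<exists>e>0. \<forall>t. 0 < t \<and> t \<le> e \<longrightarrow> N t = N 0 + m * ereal t"
  then obtain e' where e': "e' > 0" "\<And>t. 0 < t \<Longrightarrow> t \<le> e' \<Longrightarrow> N t = m * ereal t"
    using assms(1) by auto
  define t where "t = min e e'"
  have t: "t > 0" "t \<le> e" "t \<le> e'" using e e' by (auto simp: t_def)
  hence "m * ereal t = \<mu> * ereal t" using e(2)[of t] e'(2)[of t] by simp
  thus "m = \<mu>" using t(1) by (cases m; cases \<mu>) (auto split: if_splits)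
qed

text \<open>The first slope is the least of the ratios \<open>v i / i\<close>. Without finite points
  beyond 0 the hull is a single point; its value to the right of 0 is \<infinity>, and so is the
  slope.\<close>

lemma first_slope_lower_hull_ge:
  fixes v :: "nat \<Rightarrow> ereal"
  assumes v0: "v 0 = 0" and v: "\<And>i. 1 \<le> i \<Longrightarrow> i \<le> m \<Longrightarrow> ereal (real i * w) \<le> v i"
  shows "ereal w \<le> first_slope (lower_hull v m)"
proof -
  define Pts where "Pts = {(real i, real_of_ereal (v i)) | i. i \<le> m \<and> v i \<noteq> \<infinity>}"
  define I where "I = {i. 1 \<le> i \<and> i \<le> m \<and> v i \<noteq> \<infinity>}"
  have Pts: "Pts = insert (0, 0) ((\<lambda>i. (real i, real_of_ereal (v i))) ` I)"
  proof (intro equalityI subsetI)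
    fix x assume "x \<in> Pts"
    then obtain i where i: "x = (real i, real_of_ereal (v i))" "i \<le> m" "v i \<noteq> \<infinity>" by (auto simp: Pts_def)
    thus "x \<in> insert (0, 0) ((\<lambda>i. (real i, real_of_ereal (v i))) ` I)"
      using v0 by (cases "i = 0") (auto simp: I_def)
  next
    fix x assume "x \<in> insert (0, 0) ((\<lambda>i. (real i, real_of_ereal (v i))) ` I)"
    thus "x \<in> Pts" using v0 by (auto simp: Pts_def I_def intro: exI[of _ 0])
  qed
  have hull: "lower_hull v m t = Inf {ereal y | y. (t, y) \<in> convex hull Pts}" for t
    by (simp add: lower_hull_def Pts_def)
  have fin: "finite I" unfolding I_def by (rule finite_subset[of _ "{..m}"]) auto
  show ?thesis
  proof (cases "I = {}")
    case True
    hence H: "convex hull Pts = {(0, 0)}" by (simp add: Pts)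
    have "{ereal y | y. (t, y) \<in> convex hull Pts} = (if t = 0 then {0} else {})" for t :: real
      by (auto simp: H zero_ereal_def)
    hence N: "lower_hull v m t = (if t = 0 then 0 else \<infinity>)" for t
      by (simp add: hull top_ereal_def)
    have "first_slope (lower_hull v m) = \<infinity>"
      by (rule first_slope_eqI[of _ 1]) (auto simp: N)
    thus ?thesis by simp
  next
    case False
    define \<mu> where "\<mu> = Min ((\<lambda>i. real_of_ereal (v i) / real i) ` I)"
    have "\<mu> \<in> (\<lambda>i. real_of_ereal (v i) / real i) ` I" unfolding \<mu>_def using fin False by (intro Min_in) auto
    then obtain i0 where i0: "i0 \<in> I" "\<mu> = real_of_ereal (v i0) / real i0" by auto
    have \<mu>le: "\<mu> * real i \<le> real_of_ereal (v i)" if "i \<in> I" for i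
    proof -
      have "\<mu> \<le> real_of_ereal (v i) / real i" unfolding \<mu>_def using fin that by (intro Min_le) auto
      thus ?thesis using that by (simp add: I_def field_simps)
    qed
    have vr: "v i = ereal (real_of_ereal (v i))" if "i \<in> I" for i
      using that v[of i] by (cases "v i") (auto simp: I_def)
    have "w \<le> \<mu>"
    proof -
      have "ereal (real i0 * w) \<le> ereal (real_of_ereal (v i0))" using v[of i0] vr[OF i0(1)] i0(1) by (simp add: I_def)
      hence "w * real i0 \<le> \<mu> * real i0" using i0 by (simp add: I_def mult.commute)
      thus ?thesis using i0(1) by (simp add: I_def)
    qed
    \<comment> \<open>The line of slope \<mu> through the origin supports the hull from
      below.\<close>
    have half: "\<mu> * x \<le> y" if "(x, y) \<in> convex hull Pts" for x y
    proof -
      have "Pts \<subseteq> {z. inner (\<mu>, -1) z \<le> 0}" using \<mu>le by (auto simp: Pts inner_prod_def)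
      hence "convex hull Pts \<subseteq> {z. inner (\<mu>, -1) z \<le> 0}" by (rule hull_minimal) (rule convex_halfspace_le)
      hence "inner (\<mu>, -1) (x, y) \<le> 0" using that by blast
      thus ?thesis by (simp add: inner_prod_def)
    qed
    \<comment> \<open>Up to abscissa 1 the hull contains this line, since the segment from the
      origin ends at an integer i0 of at least 1.\<close>
    have mem: "(t, \<mu> * t) \<in> convex hull Pts" if t: "0 \<le> t" "t \<le> 1" for t
    proof -
      have i1: "real i0 \<ge> 1" using i0(1) by (simp add: I_def)
      have p0: "(0, 0) \<in> convex hull Pts" by (rule hull_inc) (simp add: Pts)
      have p1: "(real i0, real_of_ereal (v i0)) \<in> convex hull Pts" by (rule hull_inc) (use i0(1) in \<open>auto simp: Pts\<close>)
      define c where "c = t / real i0"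
      have c: "0 \<le> c" "c \<le> 1" using t i1 by (auto simp: c_def field_simps)
      have "(1 - c) *\<^sub>R (0, 0) + c *\<^sub>R (real i0, real_of_ereal (v i0)) \<in> convex hull Pts"
        using c by (intro convexD_alt convex_convex_hull p0 p1)
      also have "(1 - c) *\<^sub>R (0, 0) + c *\<^sub>R (real i0, real_of_ereal (v i0)) = (t, \<mu> * t)"
        using i1 i0(2) by (simp add: c_def)
      finally show ?thesis .
    qed
    have N: "lower_hull v m t = ereal (\<mu> * t)" if t: "0 \<le> t" "t \<le> 1" for t
      unfolding hull
    proof (rule Inf_eqI)
      fix y assume "y \<in> {ereal y | y. (t, y) \<in> convex hull Pts}"
      thus "ereal (\<mu> * t) \<le> y" using half by auto
    next
      fix y assume "\<And>z. z \<in> {ereal y | y. (t, y) \<in> convex hull Pts} \<Longrightarrow> y \<le> z"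
      thus "y \<le> ereal (\<mu> * t)" using mem[OF t] by auto
    qed
    have "first_slope (lower_hull v m) = ereal \<mu>"
      by (rule first_slope_eqI[of _ 1]) (auto simp: N zero_ereal_def)
    thus ?thesis using \<open>w \<le> \<mu>\<close> by simp
  qed
qed

section \<open>The L-function and the bound for its first slope\<close>

lemma L_function_log_deriv:
  fixes f :: "'k::finite_field poly"
  shows "L_function q f $ 0 = 1"
    and "fps_deriv (L_function q f) = L_function q f *
       Abs_fps (\<lambda>n. of_nat (point_count q f (Suc n)) - of_nat (CARD('k)) ^ Suc n - 1)"
    (is "_ = _ * ?D")
proof -
  define G where "G = Abs_fps (\<lambda>i. if i = 0 then 0
        else (of_nat (point_count q f i) - of_nat (CARD('k)) ^ i - 1) / of_nat i :: rat)"
  have L: "L_function q f = fps_exp 1 oo G" by (simp add: L_function_def G_def)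
  have G0: "G $ 0 = 0" by (simp add: G_def)
  show "L_function q f $ 0 = 1" by (simp add: L)
  have "fps_deriv (L_function q f) = (fps_deriv (fps_exp 1) oo G) * fps_deriv G"
    unfolding L by (rule fps_compose_deriv[OF G0])
  also have "fps_deriv G = ?D" by (rule fps_ext) (simp add: G_def del: of_nat_Suc)
  finally show "fps_deriv (L_function q f) = L_function q f * ?D" by (simp add: L)
qed

text \<open>Adding 1 permutes the field and so preserves the sum of all elements; hence the order of
  the field is 0 in it.\<close>

lemma CHAR_of_card:
  assumes p: "Factorial_Ring.prime p" and "CARD('k::finite_field) = p ^ s"
  shows "CHAR('k) = p"
proof -
  have "(\<Sum>x\<in>(UNIV :: 'k set). x) = (\<Sum>x\<in>UNIV. x + 1)"
    by (rule sum.reindex_bij_witness[of _ "\<lambda>x. x + 1" "\<lambda>x. x - 1"]) auto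
  hence "of_nat (p ^ s) = (0 :: 'k)" using assms(2) by (simp add: sum.distrib)
  hence "CHAR('k) dvd p ^ s" by (simp only: of_nat_eq_0_iff_char_dvd)
  hence "CHAR('k) dvd p" using prime_dvd_power[OF CHAR_prime] by blast
  thus ?thesis using p CHAR_prime[where 'a='k] by (metis primes_dvd_imp_eq)
qed

lemma digit_sum_pos:
  assumes "Factorial_Ring.prime p" "n \<ge> 1" shows "digit_sum p n \<ge> 1"
  using assms(2)
proof (induction n rule: less_induct)
  case (less n)
  have p2: "p \<ge> 2" using assms(1) by (rule prime_ge_2_nat)
  show ?case
  proof (cases "n mod p = 0")
    case True
    hence "n div p \<ge> 1" using less.prems by (cases "n div p = 0") auto
    moreover have "n div p < n" using less.prems p2 by simp
    ultimately have "digit_sum p (n div p) \<ge> 1" by (intro less.IH)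
    thus ?thesis using digit_sum_rec[OF p2, of n] less.prems by simp
  next
    case False
    thus ?thesis using digit_sum_rec[OF p2, of n] less.prems by simp
  qed
qed

theorem theorem1:
  fixes p u s q d :: nat and f :: "'k::finite_field poly"
  assumes "Factorial_Ring.prime p"
    and "u \<ge> 1" and "s \<ge> 1"
    and "q = p ^ u" and "CARD('k) = p ^ s"
    and "Polynomial.degree f = d" and "d \<ge> 2" and "gcd d p = 1"
  shows "first_slope (newton_polygon p s q f) \<ge> ereal (1 / real (max_digit_sum p f))"
proof -
  note p = assms(1)
  define g where "g = (map_poly to_ac f :: 'k alg_closure poly)"
  define \<sigma> where "\<sigma> = max_digit_sum p f"
  have chr: "CHAR('k alg_closure) = p" using CHAR_of_card[OF p assms(5)] by simp
  have cg: "Polynomial.coeff g i = to_ac (Polynomial.coeff f i)" for i by (simp add: g_def coeff_map_poly)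
  have dg: "Polynomial.degree g = d" using assms(6) by (simp add: g_def degree_map_poly)
  have ndvd: "\<not> p dvd d"
  proof
    assume "p dvd d"
    hence "p dvd gcd d p" by simp
    thus False using assms(8) p by (simp add: not_prime_unit)
  qed
  have gf: "Polynomial.coeff g i \<in> fixed_field (p ^ s)" for i
    using finite_field_power_card_eq_same[of "Polynomial.coeff f i"] assms(5)
    by (simp add: cg fixed_field_def flip: to_ac_power)
  have "finite (supp f)"
    by (rule finite_subset[of _ "{..Polynomial.degree f}"]) (auto simp: supp_def intro: le_degree)
  hence ds: "digit_sum p l \<le> \<sigma>" if "Polynomial.coeff f l \<noteq> 0" for l
    unfolding \<sigma>_def max_digit_sum_def using that by (intro Max_ge) (auto simp: supp_def)
  have "Polynomial.coeff f d \<noteq> 0" using assms(6,7) by auto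
  \<comment> \<open>The exponent d is in the support and has positive digit sum.\<close>
  hence \<sigma>1: "\<sigma> \<ge> 1" using ds[of d] digit_sum_pos[OF p, of d] assms(7) by linarith
  define S where "S = (\<lambda>n. int (affine_count p (s * Suc n) (p ^ u) g) - int (p ^ (s * Suc n)))"
  \<comment> \<open>The place at infinity cancels the - 1 of the power sum.\<close>
  have S: "of_nat (point_count q f (Suc n)) - of_nat (CARD('k)) ^ Suc n - 1 = (of_int (S n) :: rat)" for n
    using point_count_eq[OF p CHAR_of_card[OF p assms(5)] assms(2,3,5), of f "Suc n"] assms ndvd
    by (simp add: S_def g_def power_add flip: power_mult)
  have val: "vge p (real n * (real s / real \<sigma>)) (L_function q f $ n)" for n
  proof (rule L_coeff_valuation[OF p chr assms(3,2) gf])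
    show "fps_deriv (L_function q f) = L_function q f * Abs_fps (\<lambda>n. of_int (int (affine_count p (s * Suc n) (p ^ u) g) - int (p ^ (s * Suc n))))"
      using L_function_log_deriv(2)[of q f] unfolding S by (simp add: S_def)
  qed (use assms ndvd dg \<sigma>1 ds cg L_function_log_deriv(1) in auto)
  define v where "v = (\<lambda>i. p_adic_ord p (L_function q f $ i) / ereal (real s))"
  have "v 0 = 0" by (simp add: v_def L_function_log_deriv p_adic_ord_def)
  \<comment> \<open>The normalization by s turns i s / \<sigma> into i / \<sigma>.\<close>
  moreover have "ereal (real i * (1 / real \<sigma>)) \<le> v i" for i
  proof (cases "L_function q f $ i = 0")
    case True
    thus ?thesis using assms(3) by (simp add: v_def p_adic_ord_def)
  next
    case False
    hence "real i * (real s / real \<sigma>) \<le> real_of_int (pval p (L_function q f $ i))"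
      using val[of i] by (simp add: vge_def)
    hence "real i * (1 / real \<sigma>) \<le> real_of_int (pval p (L_function q f $ i)) / real s"
      using assms(3) by (simp add: field_simps)
    thus ?thesis using False assms(3) by (simp add: v_def p_adic_ord_pval)
  qed
  ultimately have "ereal (1 / real \<sigma>) \<le> first_slope (lower_hull v (2 * genus q f))"
    by (intro first_slope_lower_hull_ge) auto
  thus ?thesis by (simp add: newton_polygon_def v_def \<sigma>_def)
qed

end
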